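(* Let $M$ be a smooth $n$-dimensional hypersurface of $\mathbb{R}^{n+1}$ and let $a\in[0,n)$. Then for every $\varphi\in C^1_c(M)$, \[ (n-a)\int_M\frac{\varphi^2}{|x|^a}\,dV+a\int_M\left(\frac{x}{|x|}\cdot\nu_M\right)^2\frac{\varphi^2}{|x|^a}\,dV \leq \left(\int_M\frac{\varphi^2}{|x|^a}\,dV\right)^{1/2} \left(\int_M\frac{4|\nabla_T\varphi|^2+|H\varphi|^2}{|x|^{a-2}}\,dV\right)^{1/2}. \]
   Context: $x$ denotes the position vector in $\mathbb{R}^{n+1}$ and $|x|$ its Euclidean norm; $dV$ is the $n$-dimensional volume (Hausdorff) measure on $M$. $\nu_M$ is a unit normal vector field to $M$. $C^1_c(M)$ is the space of $C^1$ functions with compact support on $M$ (if $M$ is compact without boundary, this is all of $C^1(M)$). The tangential gradient is $\nabla_T\varphi=\nabla\varphi-(\nabla\varphi\cdot\nu_M)\nu_M$ (for any $C^1$ extension of $\varphi$). $H$ is the mean curvature of $M$, defined as the sum (not the average) of the principal curvatures, namely $H=\operatorname{div}_T\nu_M=\sum_{i=1}^{n+1}\delta_i\nu_M^i$ with $\delta_i f=\partial_i f-\nu_M^i\sum_j(\partial_jf)\nu_M^j$. *)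

theory Defs
  imports "HOL-Analysis.Analysis"
begin

fun Ck_on :: "nat \<Rightarrow> 'a::euclidean_space set \<Rightarrow> ('a \<Rightarrow> real) \<Rightarrow> bool" where
  "Ck_on 0 U f = continuous_on U f"
| "Ck_on (Suc k) U f =
     (\<exists>G. (\<forall>x\<in>U. GDERIV f x :> G x) \<and> continuous_on U f \<and>
          (\<forall>b\<in>Basis. Ck_on k U (\<lambda>x. G x \<bullet> b)))"

definition smooth_on :: "'a::euclidean_space set \<Rightarrow> ('a \<Rightarrow> real) \<Rightarrow> bool" where
  "smooth_on U f \<longleftrightarrow> (\<forall>k. Ck_on k U f)"

definition smooth_hypersurface :: "'a::euclidean_space set \<Rightarrow> bool" where
  "smooth_hypersurface M \<longleftrightarrow>
     (\<forall>p\<in>M. \<exists>U g. open U \<and> p \<in> U \<and> smooth_on U g \<and>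
        (\<forall>x\<in>U. \<exists>D. (GDERIV g x :> D) \<and> D \<noteq> 0) \<and>
        M \<inter> U = {x\<in>U. g x = 0})"

definition tangent_space :: "'a::euclidean_space set \<Rightarrow> 'a \<Rightarrow> 'a set" where
  "tangent_space M p = {v. \<exists>\<gamma> e. e > 0 \<and> \<gamma> 0 = p \<and> \<gamma> ` ball 0 e \<subseteq> M \<and>
                                  (\<gamma> has_vector_derivative v) (at 0)}"

definition hausdorff_delta :: "nat \<Rightarrow> real \<Rightarrow> 'a::euclidean_space set \<Rightarrow> ennreal" where
  "hausdorff_delta n \<delta> A =
     (INF C \<in> {C :: nat \<Rightarrow> 'a set. A \<subseteq> (\<Union>i. C i) \<and> (\<forall>i. bounded (C i) \<and> diameter (C i) \<le> \<delta>)}.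
        (\<Sum>i. ennreal (unit_ball_vol (real n) / 2 ^ n * diameter (C i) ^ n)))"

definition hausdorff_outer :: "nat \<Rightarrow> 'a::euclidean_space set \<Rightarrow> ennreal" where
  "hausdorff_outer n A = (SUP \<delta> \<in> {0<..}. hausdorff_delta n \<delta> A)"

definition hausdorff_measure :: "nat \<Rightarrow> 'a::euclidean_space measure" where
  "hausdorff_measure n = measure_of UNIV (sets borel) (hausdorff_outer n)"

text \<open>Tangential gradient of phi at x, given the gradient Dphi x of a C^1 extension.\<close>
definition tgrad :: "'a::euclidean_space \<Rightarrow> 'a \<Rightarrow> 'a" where
  "tgrad \<nu> Dphi = Dphi - (Dphi \<bullet> \<nu>) *\<^sub>R \<nu>"

text \<open>Mean curvature (sum of principal curvatures) H = sum_i delta_i nu^i, where DN is the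
  derivative (Jacobian) at x of a C^1 extension N of the normal field, \<nu> = N x, and
  partial_j N^i = (DN e_j) . e_i.\<close>
definition mean_curv :: "'a::euclidean_space \<Rightarrow> ('a \<Rightarrow> 'a) \<Rightarrow> real" where
  "mean_curv \<nu> DN =
     (\<Sum>i\<in>Basis. DN i \<bullet> i - (\<nu> \<bullet> i) * (\<Sum>j\<in>Basis. (DN j \<bullet> i) * (\<nu> \<bullet> j)))"

end

theory Submission
  imports Defs
begin

text \<open>
  Integrating the tangential divergence of \<open>\<phi>\<^sup>2 |x|\<^sup>-\<^sup>a x\<close> over \<open>M\<close> gives
  \<open>(n - a) \<integral> \<phi>\<^sup>2 |x|\<^sup>-\<^sup>a + a \<integral> (x/|x| \<bullet> \<nu>)\<^sup>2 \<phi>\<^sup>2 |x|\<^sup>-\<^sup>a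
    = \<integral> |x|\<^sup>-\<^sup>a \<phi> (H \<phi> (x \<bullet> \<nu>) - 2 \<nabla>\<^sub>T\<phi> \<bullet> x)\<close>,
  and the right-hand side is estimated by Cauchy--Schwarz, in the plane for the integrand and then
  for the integral. The singularity at the origin is handled by replacing \<open>|x|\<^sup>2\<close> with
  \<open>|x|\<^sup>2 + \<epsilon>\<close>.

  Both sides are linear in the measure, so the normalisation of the Hausdorff measure is irrelevant,
  and Lebesgue measure on hyperplanes is never needed. On a hyperplane the Hausdorff measure is
  translation invariant, hence (uniqueness of such measures, by Tonelli) scales correctly under linear
  maps. A hypersurface is locally almost flat, so its projection along \<open>b\<close> onto the
  hyperplane orthogonal to \<open>b\<close> has density \<open>|\<nu> \<bullet> b|\<close>. Translation invariance on the
  hyperplane then yields \<open>\<integral> (\<nu> \<bullet> b) \<partial>\<^sub>v F - (\<nu> \<bullet> v) \<partial>\<^sub>b F = 0\<close>, from which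
  the divergence theorem follows by summing over pairs of basis vectors.
\<close>


section \<open>Hausdorff outer measure and translation invariant measures\<close>

text \<open>The formula with \<open>v\<close> and \<open>b\<close> carries no curvature because it
  is a flat statement pulled back. Over the hyperplane orthogonal to b, the field tau = v -
  ((nu.v)/(nu.b)) b is the tangential lift of the constant field v, and the density |nu.b| of the
  projection turns the derivative of F along tau into the stated integrand up to a constant sign.
  Only first-order information on M enters: charts are Lipschitz inverses of projections, and
  derivatives along M are taken along curves differentiable at a single point. Curvature appears
  only when the formula is applied to F = h x_i nu_j, with h = phi^2 (|x|^2 + eps)^(-a/2), and a
  derivative falls on nu_j. The bound a < n lets eps tend to 0: the area of M in a ball of radius s
  about one of its points is O(s^n), so |x|^(-a) is locally integrable and dominates. The plane
  vectors of the first Cauchy-Schwarz estimate are (|H phi|, 2 |grad_T phi|) and (|x.nu|, |x -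
  (x.nu) nu|); the second has length |x|.\<close>

lemma hausdorff_outer_lipschitz:
  fixes f :: "'a::euclidean_space \<Rightarrow> 'b::euclidean_space"
  assumes L: "0 < L" and lip: "\<And>x y. x \<in> S \<Longrightarrow> y \<in> S \<Longrightarrow> norm (f x - f y) \<le> L * norm (x - y)"
  shows "hausdorff_outer n (f ` S) \<le> ennreal (L ^ n) * hausdorff_outer n S"
proof -
  let ?w = "\<lambda>d::real. ennreal (unit_ball_vol (real n) / 2 ^ n * d ^ n)"
  have delta: "hausdorff_delta n (L * d) (f ` S) \<le> ennreal (L ^ n) * hausdorff_delta n d S" for d
  proof -
    \<comment> \<open>The factor \<open>L ^ n\<close> is divided out first, so that the bare infimum
      stands on the right and one cover can be treated at a time.\<close>
    have "ennreal (1 / L ^ n) * hausdorff_delta n (L * d) (f ` S) \<le> hausdorff_delta n d S"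
      unfolding hausdorff_delta_def[of n d S]
    proof (rule INF_greatest)
      fix C :: "nat \<Rightarrow> 'a set"
      assume "C \<in> {C. S \<subseteq> (\<Union>i. C i) \<and> (\<forall>i. bounded (C i) \<and> diameter (C i) \<le> d)}"
      then have C: "S \<subseteq> (\<Union>i. C i)" "\<And>i. bounded (C i)" "\<And>i. diameter (C i) \<le> d" by auto
      \<comment> \<open>The cover is cut down to \<open>S\<close> because \<open>f\<close> is
        Lipschitz only there.\<close>
      define D where "D i = f ` (C i \<inter> S)" for i
      have dist: "norm (x - y) \<le> L * diameter (C i)" if "x \<in> D i" "y \<in> D i" for i x y
      proof -
        from that obtain u v where uv: "u \<in> C i \<inter> S" "v \<in> C i \<inter> S" "x = f u" "y = f v"
          by (auto simp: D_def)
        have "norm (x - y) \<le> L * norm (u - v)" using uv lip by auto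
        also have "\<dots> \<le> L * diameter (C i)"
          using L uv diameter_bounded_bound[OF C(2)[of i], of u v] by (auto simp: dist_norm)
        finally show ?thesis .
      qed
      have bD: "bounded (D i)" for i
        unfolding bounded_two_points using dist by (auto simp: dist_norm)
      have dC: "0 \<le> diameter (C i)" for i by (rule diameter_ge_0[OF C(2)])
      have dD: "diameter (D i) \<le> L * diameter (C i)" for i
        using dist dC L by (intro diameter_le) auto
      have "D \<in> {C. f ` S \<subseteq> (\<Union>i. C i) \<and> (\<forall>i. bounded (C i) \<and> diameter (C i) \<le> L * d)}"
        using C(1) bD order.trans[OF dD] C(3) L by (fastforce simp: D_def)
      then have "hausdorff_delta n (L * d) (f ` S) \<le> (\<Sum>i. ?w (diameter (D i)))"
        unfolding hausdorff_delta_def by (rule INF_lower)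
      also have "\<dots> \<le> (\<Sum>i. ennreal (L ^ n) * ?w (diameter (C i)))"
      proof (rule suminf_le)
        fix i
        have "diameter (D i) ^ n \<le> (L * diameter (C i)) ^ n"
          by (intro power_mono dD diameter_ge_0 bD)
        then have "unit_ball_vol (real n) / 2 ^ n * diameter (D i) ^ n
             \<le> L ^ n * (unit_ball_vol (real n) / 2 ^ n * diameter (C i) ^ n)"
          using mult_left_mono[of "diameter (D i) ^ n" "(L * diameter (C i)) ^ n"
              "unit_ball_vol (real n) / 2 ^ n"]
          by (simp add: power_mult_distrib ac_simps)
        then show "?w (diameter (D i)) \<le> ennreal (L ^ n) * ?w (diameter (C i))"
          using L dC[of i] by (subst ennreal_mult''[symmetric]) (auto intro!: ennreal_leI)
      qed auto
      also have "\<dots> = ennreal (L ^ n) * (\<Sum>i. ?w (diameter (C i)))" by simp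
      finally have "ennreal (1 / L ^ n) * hausdorff_delta n (L * d) (f ` S)
          \<le> ennreal (1 / L ^ n) * (ennreal (L ^ n) * (\<Sum>i. ?w (diameter (C i))))"
        by (rule mult_left_mono) simp
      also have "\<dots> = (\<Sum>i. ?w (diameter (C i)))"
        using L by (simp add: mult.assoc[symmetric] ennreal_mult[symmetric])
      finally show "ennreal (1 / L ^ n) * hausdorff_delta n (L * d) (f ` S)
          \<le> (\<Sum>i. ?w (diameter (C i)))" .
    qed
    then have "ennreal (L ^ n) * (ennreal (1 / L ^ n) * hausdorff_delta n (L * d) (f ` S))
        \<le> ennreal (L ^ n) * hausdorff_delta n d S"
      by (rule mult_left_mono) simp
    then show ?thesis
      using L by (simp add: mult.assoc[symmetric] ennreal_mult[symmetric])
  qed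
  show ?thesis
    unfolding hausdorff_outer_def[of n "f ` S"]
  proof (rule SUP_least)
    fix d :: real assume "d \<in> {0<..}"
    then have "0 < d / L" using L by simp
    have "hausdorff_delta n d (f ` S) \<le> ennreal (L ^ n) * hausdorff_delta n (d / L) S"
      using delta[of "d / L"] L by simp
    also have "\<dots> \<le> ennreal (L ^ n) * hausdorff_outer n S"
      unfolding hausdorff_outer_def using \<open>0 < d / L\<close> by (intro mult_left_mono SUP_upper) auto
    finally show "hausdorff_delta n d (f ` S) \<le> ennreal (L ^ n) * hausdorff_outer n S" .
  qed
qed

text \<open>Since \<open>g x = g y\<close> forces \<open>f x = f y\<close>, the map \<open>f\<close>
  factors through \<open>g\<close> on \<open>S\<close> by an \<open>L\<close>-Lipschitz map. Two
  maps on a common index set are the convenient form whenever a projection or a chart has to be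
  undone.\<close>

lemma hausdorff_outer_image_le:
  fixes f :: "'c \<Rightarrow> 'a::euclidean_space" and g :: "'c \<Rightarrow> 'b::euclidean_space"
  assumes L: "0 < L"
    and lip: "\<And>x y. x \<in> S \<Longrightarrow> y \<in> S \<Longrightarrow> norm (f x - f y) \<le> L * norm (g x - g y)"
  shows "hausdorff_outer n (f ` S) \<le> ennreal (L ^ n) * hausdorff_outer n (g ` S)"
proof -
  define h where "h z = f (SOME x. x \<in> S \<and> g x = z)" for z
  have h: "h (g x) = f x" if x: "x \<in> S" for x
  proof -
    define y where "y = (SOME y. y \<in> S \<and> g y = g x)"
    have "y \<in> S \<and> g y = g x"
      unfolding y_def by (rule someI[of _ x]) (use x in auto)
    then have "norm (f y - f x) \<le> 0" using lip[of y x] x by simp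
    then show ?thesis by (simp add: h_def y_def)
  qed
  have "hausdorff_outer n (h ` (g ` S)) \<le> ennreal (L ^ n) * hausdorff_outer n (g ` S)"
    by (rule hausdorff_outer_lipschitz) (auto simp: h lip L)
  moreover have "h ` g ` S = f ` S" by (force simp: h image_image)
  ultimately show ?thesis by simp
qed

lemma hausdorff_outer_isometry:
  fixes f :: "'c \<Rightarrow> 'a::euclidean_space" and g :: "'c \<Rightarrow> 'b::euclidean_space"
  assumes "\<And>x y. x \<in> S \<Longrightarrow> y \<in> S \<Longrightarrow> norm (f x - f y) = norm (g x - g y)"
  shows "hausdorff_outer n (f ` S) = hausdorff_outer n (g ` S)"
  using hausdorff_outer_image_le[of 1 S f g n] hausdorff_outer_image_le[of 1 S g f n] assms
  by (auto intro!: antisym)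

lemma hausdorff_outer_mono: "A \<subseteq> B \<Longrightarrow> hausdorff_outer n A \<le> hausdorff_outer n B"
  unfolding hausdorff_outer_def hausdorff_delta_def
  by (intro SUP_mono' INF_superset_mono) auto

lemma hausdorff_outer_singleton:
  assumes "0 < n" shows "hausdorff_outer n {x} = 0"
proof -
  have "hausdorff_delta n d {x} \<le> 0" if "0 < d" for d
  proof -
    have "hausdorff_delta n d {x} \<le>
        (\<Sum>i::nat. ennreal (unit_ball_vol (real n) / 2 ^ n * diameter {x} ^ n))"
      unfolding hausdorff_delta_def by (rule INF_lower) (use that in auto)
    then show ?thesis using assms by (simp add: zero_power)
  qed
  then show ?thesis unfolding hausdorff_outer_def
    by (metis SUP_least greaterThan_iff le_zero_eq)
qed

text \<open>A grid of mesh \<open>h\<close> in orthonormal coordinates covers the set by O(h^(-n))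
  cells of diameter O(h), so the sum of the n-th powers stays bounded as the mesh shrinks.\<close>

lemma hausdorff_outer_subspace_finite:
  fixes S :: "'a::euclidean_space set"
  assumes S: "subspace S" "dim S = n" and n: "0 < n" and A: "A \<subseteq> S" "bounded A"
  shows "hausdorff_outer n A < \<infinity>"
proof -
  obtain B where B: "B \<subseteq> S" "pairwise orthogonal B" "\<And>x. x \<in> B \<Longrightarrow> norm x = 1"
      "independent B" "card B = n" "span B = S"
    using orthonormal_basis_subspace[OF S(1)] S(2) by metis
  have finB: "finite B" using B(4) by (rule independent_imp_finite)
  obtain R where R: "0 < R" "\<And>x. x \<in> A \<Longrightarrow> norm x \<le> R"
    using A(2) bounded_pos by blast
  \<comment> \<open>There will be \<open>(k + 1) ^ n\<close> cells of diameter at most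
    \<open>h * n\<close>, and \<open>(k + 1) * h \<le> 4 * R\<close> because
    \<open>k \<ge> 1\<close>. The bound is therefore independent of \<open>d\<close>.\<close>
  define K where "K = unit_ball_vol (real n) / 2 ^ n * (4 * R * n) ^ n"
  have "hausdorff_delta n d A \<le> ennreal K" if d: "0 < d" for d
  proof -
    obtain k0 :: nat where k0: "2 * R * n / d < k0" using reals_Archimedean2 by blast
    define k where "k = Suc k0"
    define h where "h = 2 * R / k"
    have k: "0 < k" "2 * R * n / d \<le> k" using k0 by (auto simp: k_def)
    have h: "0 < h" "h * n \<le> d" using k R d by (auto simp: h_def field_simps)
    \<comment> \<open>The index \<open>k\<close> is included: a point with
      \<open>x \<bullet> e = R\<close> has floor exactly \<open>k\<close>.\<close>
    define I where "I = (B \<rightarrow>\<^sub>E {..k})"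
    have finI: "finite I" "card I = (k + 1) ^ n"
      using finB B(5) by (auto simp: I_def finite_PiE card_PiE)
    define cell where
      "cell f = {x \<in> A. \<forall>e\<in>B. real (f e) * h \<le> x \<bullet> e + R \<and> x \<bullet> e + R \<le> (real (f e) + 1) * h}" for f
    have dist: "norm (x - y) \<le> h * n" if "x \<in> cell f" "y \<in> cell f" for x y f
    proof -
      have "x - y \<in> span B" using that A B(6) by (auto simp: cell_def intro!: span_diff)
      then have "(\<Sum>e\<in>B. ((x - y) \<bullet> e) *\<^sub>R e) = x - y"
        using B(2,3) finB by (intro orthonormal_basis_expand) auto
      then have "norm (x - y) = norm (\<Sum>e\<in>B. ((x - y) \<bullet> e) *\<^sub>R e)" by simp
      also have "\<dots> \<le> (\<Sum>e\<in>B. norm (((x - y) \<bullet> e) *\<^sub>R e))" by (rule norm_sum)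
      also have "\<dots> \<le> (\<Sum>e\<in>B. h)"
      proof (rule sum_mono)
        fix e assume e: "e \<in> B"
        have "real (f e) * h \<le> x \<bullet> e + R" "x \<bullet> e + R \<le> real (f e) * h + h"
             "real (f e) * h \<le> y \<bullet> e + R" "y \<bullet> e + R \<le> real (f e) * h + h"
          using that e by (auto simp: cell_def algebra_simps)
        then show "norm (((x - y) \<bullet> e) *\<^sub>R e) \<le> h"
          using B(3)[OF e] by (auto simp: inner_diff_left)
      qed
      finally show ?thesis using B(5) by (simp add: mult.commute)
    qed
    obtain g where g: "bij_betw g {0..<card I} I" using ex_bij_betw_nat_finite[OF finI(1)] by blast
    \<comment> \<open>Padding with empty sets produces the infinite sequence demanded by
      \<open>hausdorff_delta\<close>; each of them costs \<open>0 ^ n = 0\<close> because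
      \<open>n\<close> is positive.\<close>
    define C where "C i = (if i < card I then cell (g i) else {})" for i
    have Cb: "bounded (C i)" for i
      using A(2) by (auto simp: C_def cell_def intro: bounded_subset)
    have Cd: "diameter (C i) \<le> h * n" for i
      using dist h by (intro diameter_le) (auto simp: C_def split: if_splits)
    have cover: "A \<subseteq> (\<Union>i. C i)"
    proof
      fix x assume x: "x \<in> A"
      define f where "f = restrict (\<lambda>e. nat \<lfloor>(x \<bullet> e + R) / h\<rfloor>) B"
      have xe: "0 \<le> x \<bullet> e + R" "x \<bullet> e + R \<le> 2 * R" if "e \<in> B" for e
        using R(2)[OF x] B(3)[OF that] Cauchy_Schwarz_ineq2[of x e] by auto
      have "f \<in> I"
      proof -
        have "f e \<le> k" if "e \<in> B" for e
        proof -
          have "(x \<bullet> e + R) / h \<le> k" using xe[OF that] k R by (auto simp: h_def field_simps)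
          then have "\<lfloor>(x \<bullet> e + R) / h\<rfloor> \<le> \<lfloor>real k\<rfloor>" by (rule floor_mono)
          then show ?thesis using that by (auto simp: f_def)
        qed
        then show ?thesis by (auto simp: I_def f_def)
      qed
      moreover have "x \<in> cell f"
      proof -
        have "real (f e) * h \<le> x \<bullet> e + R \<and> x \<bullet> e + R \<le> (real (f e) + 1) * h" if e: "e \<in> B" for e
        proof -
          have fe: "real (f e) = of_int \<lfloor>(x \<bullet> e + R) / h\<rfloor>"
            using xe(1)[OF e] h e by (auto simp: f_def)
          have "real (f e) \<le> (x \<bullet> e + R) / h" "(x \<bullet> e + R) / h \<le> real (f e) + 1"
            unfolding fe by linarith+
          then show ?thesis using h(1) by (auto simp: field_simps)
        qed
        then show ?thesis using x by (auto simp: cell_def)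
      qed
      ultimately obtain i where "i < card I" "g i = f"
        using g by (metis atLeastLessThan_iff bij_betw_iff_bijections)
      then show "x \<in> (\<Union>i. C i)" using \<open>x \<in> cell f\<close> by (auto simp: C_def)
    qed
    let ?w = "\<lambda>d::real. ennreal (unit_ball_vol (real n) / 2 ^ n * d ^ n)"
    have "hausdorff_delta n d A \<le> (\<Sum>i. ?w (diameter (C i)))"
      unfolding hausdorff_delta_def using cover Cb order.trans[OF Cd h(2)] by (intro INF_lower) auto
    also have "\<dots> = (\<Sum>i<card I. ?w (diameter (C i)))"
      by (rule suminf_finite) (use n in \<open>auto simp: C_def\<close>)
    also have "\<dots> \<le> (\<Sum>i<card I. ?w (h * n))"
      by (intro sum_mono ennreal_leI mult_left_mono power_mono Cd diameter_ge_0 Cb) auto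
    also have "\<dots> = ennreal (card I * (unit_ball_vol (real n) / 2 ^ n * (h * n) ^ n))"
      using h by (simp add: ennreal_of_nat_eq_real_of_nat ennreal_mult[symmetric])
    also have "\<dots> \<le> ennreal K"
    proof (rule ennreal_leI)
      have "real (k + 1) ^ n * (h * n) ^ n = ((k + 1) * (h * n)) ^ n"
        by (simp add: power_mult_distrib)
      also have "\<dots> \<le> (4 * R * n) ^ n"
      proof (rule power_mono)
        have "real (k + 1) * h \<le> 4 * R"
          using k R by (auto simp: h_def field_simps)
        then have "real (k + 1) * h * n \<le> 4 * R * n"
          by (rule mult_right_mono) simp
        then show "(k + 1) * (h * n) \<le> 4 * R * n" by (simp add: mult.assoc)
      qed (use h in auto)
      finally have "unit_ball_vol (real n) / 2 ^ n * (real (k + 1) ^ n * (h * n) ^ n) \<le> K"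
        unfolding K_def by (intro mult_left_mono) auto
      then show "card I * (unit_ball_vol (real n) / 2 ^ n * (h * n) ^ n) \<le> K"
        by (simp add: finI ac_simps)
    qed
    finally show ?thesis .
  qed
  then have "hausdorff_outer n A \<le> ennreal K"
    unfolding hausdorff_outer_def by (intro SUP_least) auto
  then show ?thesis by (simp add: le_less_trans)
qed

text \<open>The double integral of 1_A(x + y) 1_B(y) is computed in both orders: integrating x first
  gives mu(A) nu(B), and a translation in y followed by one in x gives nu(A) mu(B). The measures
  live on a set \<open>S\<close> of the ambient type, so the statement covers invariant measures on
  a hyperplane as well as on a full space.\<close>

lemma translation_invariant_measure_proportional:
  fixes \<mu> \<nu> :: "'a::euclidean_space measure"
  assumes sets[measurable_cong]: "sets \<mu> = sets borel" "sets \<nu> = sets borel"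
    and sf: "sigma_finite_measure \<mu>" "sigma_finite_measure \<nu>"
    and supp: "AE x in \<mu>. x \<in> S" "AE x in \<nu>. x \<in> S"
    and neg: "\<And>x. x \<in> S \<Longrightarrow> - x \<in> S"
    and inv: "\<And>v. v \<in> S \<Longrightarrow> distr \<mu> borel (\<lambda>x. x + v) = \<mu>"
             "\<And>v. v \<in> S \<Longrightarrow> distr \<nu> borel (\<lambda>x. x + v) = \<nu>"
    and A[measurable]: "A \<in> sets borel" and B[measurable]: "B \<in> sets borel"
    and sym: "\<And>x. - x \<in> B \<longleftrightarrow> x \<in> B"
  shows "emeasure \<mu> A * emeasure \<nu> B = emeasure \<nu> A * emeasure \<mu> B"
proof -
  interpret \<mu>: sigma_finite_measure \<mu> by (rule sf)
  interpret \<nu>: sigma_finite_measure \<nu> by (rule sf)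
  interpret pair_sigma_finite \<mu> \<nu> ..
  let ?a = "indicator A :: 'a \<Rightarrow> ennreal" and ?b = "indicator B :: 'a \<Rightarrow> ennreal"
  have shift\<mu>: "(\<integral>\<^sup>+x. f (x + v) \<partial>\<mu>) = (\<integral>\<^sup>+x. f x \<partial>\<mu>)"
    if "v \<in> S" "f \<in> borel_measurable borel" for f v
    using nn_integral_distr[of "\<lambda>x. x + v" \<mu> borel f] that inv(1)[of v] by simp
  have shift\<nu>: "(\<integral>\<^sup>+x. f (x + v) \<partial>\<nu>) = (\<integral>\<^sup>+x. f x \<partial>\<nu>)"
    if "v \<in> S" "f \<in> borel_measurable borel" for f v
    using nn_integral_distr[of "\<lambda>x. x + v" \<nu> borel f] that inv(2)[of v] by simp
  have b_sym: "?b (y - x) = ?b (x - y)" for x y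
    using sym[of "x - y"] by (simp add: indicator_def)
  have "emeasure \<mu> A * emeasure \<nu> B = (\<integral>\<^sup>+y. (\<integral>\<^sup>+x. ?a x \<partial>\<mu>) * ?b y \<partial>\<nu>)"
    by (subst nn_integral_cmult) auto
  also have "\<dots> = (\<integral>\<^sup>+y. (\<integral>\<^sup>+x. ?a (x + y) * ?b y \<partial>\<mu>) \<partial>\<nu>)"
  proof (rule nn_integral_cong_AE)
    show "AE y in \<nu>. (\<integral>\<^sup>+x. ?a x \<partial>\<mu>) * ?b y = (\<integral>\<^sup>+x. ?a (x + y) * ?b y \<partial>\<mu>)"
      using supp(2)
    proof eventually_elim
      case (elim y)
      then show ?case by (subst nn_integral_multc) (auto simp: shift\<mu>[OF elim, of ?a])
    qed
  qed
  also have "\<dots> = (\<integral>\<^sup>+x. (\<integral>\<^sup>+y. ?a (x + y) * ?b y \<partial>\<nu>) \<partial>\<mu>)"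
    by (rule Fubini') measurable
  \<comment> \<open>Translation of y by x, which lies in \<open>S\<close> almost everywhere.\<close>
  also have "\<dots> = (\<integral>\<^sup>+x. (\<integral>\<^sup>+y. ?a y * ?b (y - x) \<partial>\<nu>) \<partial>\<mu>)"
  proof (rule nn_integral_cong_AE)
    show "AE x in \<mu>. (\<integral>\<^sup>+y. ?a (x + y) * ?b y \<partial>\<nu>) = (\<integral>\<^sup>+y. ?a y * ?b (y - x) \<partial>\<nu>)"
      using supp(1)
    proof eventually_elim
      case (elim x)
      show ?case using shift\<nu>[OF elim, of "\<lambda>y. ?a y * ?b (y - x)"] by (simp add: add.commute)
    qed
  qed
  also have "\<dots> = (\<integral>\<^sup>+y. (\<integral>\<^sup>+x. ?a y * ?b (y - x) \<partial>\<mu>) \<partial>\<nu>)"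
    by (rule Fubini'[symmetric]) measurable
  \<comment> \<open>Symmetry of \<open>B\<close> turns its indicator at y - x into the one at x - y,
    and then x is translated by \<open>- y\<close>, an element of \<open>S\<close>.\<close>
  also have "\<dots> = (\<integral>\<^sup>+y. ?a y * emeasure \<mu> B \<partial>\<nu>)"
  proof (rule nn_integral_cong_AE)
    show "AE y in \<nu>. (\<integral>\<^sup>+x. ?a y * ?b (y - x) \<partial>\<mu>) = ?a y * emeasure \<mu> B"
      using supp(2)
    proof eventually_elim
      case (elim y)
      have "(\<integral>\<^sup>+x. ?a y * ?b (y - x) \<partial>\<mu>) = ?a y * (\<integral>\<^sup>+x. ?b (x - y) \<partial>\<mu>)"
        by (subst nn_integral_cmult[symmetric]) (auto simp: b_sym)
      then show ?case using shift\<mu>[OF neg[OF elim], of ?b] by simp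
    qed
  qed
  also have "\<dots> = emeasure \<nu> A * emeasure \<mu> B"
    by (subst nn_integral_multc) auto
  finally show ?thesis .
qed

section \<open>Hausdorff measure on hyperplanes\<close>

lemma sigma_finite_measure_cball:
  fixes M :: "'a::euclidean_space measure"
  assumes "sets M = sets borel" "\<And>k::nat. emeasure M (cball 0 (real k)) < \<infinity>"
  shows "sigma_finite_measure M"
proof
  have "(\<Union>k. cball 0 (real k)) = (UNIV::'a set)"
    by (auto simp: real_arch_simple)
  then show "\<exists>A. countable A \<and> A \<subseteq> sets M \<and> \<Union> A = space M \<and> (\<forall>a\<in>A. emeasure M a \<noteq> \<infinity>)"
    using assms sets_eq_imp_space_eq[OF assms(1)]
    by (intro exI[of _ "range (\<lambda>k::nat. cball 0 (real k))"]) (auto simp: less_top[symmetric])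
qed

section \<open>Hyperplanes, stretches and orthogonal projections\<close>

definition plane :: "'a::euclidean_space \<Rightarrow> 'a set" where
  "plane b = {x. x \<bullet> b = 0}"

text \<open>For a unit vector \<open>w\<close> this scales the component along \<open>w\<close> by
  \<open>s\<close> and fixes the orthogonal complement of \<open>w\<close>; it is the model of a
  linear map with determinant \<open>s\<close>.\<close>

definition stretch :: "'a::euclidean_space \<Rightarrow> real \<Rightarrow> 'a \<Rightarrow> 'a" where
  "stretch w s y = y + ((s - 1) * (y \<bullet> w)) *\<^sub>R w"

definition proj :: "'a::euclidean_space \<Rightarrow> 'a \<Rightarrow> 'a" where
  "proj b x = x - (x \<bullet> b) *\<^sub>R b"

lemma subspace_plane: "subspace (plane b)"
  unfolding plane_def using subspace_hyperplane[of b] by (simp add: inner_commute)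

lemma plane_borel [measurable]: "plane b \<in> sets borel"
  unfolding plane_def by (intro borel_closed closed_Collect_eq continuous_intros)

lemma stretch_add: "stretch w s (x + y) = stretch w s x + stretch w s y"
  by (simp add: stretch_def inner_add_left algebra_simps)

lemma stretch_inner: "norm w = 1 \<Longrightarrow> stretch w s y \<bullet> w = s * (y \<bullet> w)"
  by (simp add: stretch_def inner_add_left norm_eq_1 algebra_simps)

lemma stretch_inverse: "norm w = 1 \<Longrightarrow> s * t = 1 \<Longrightarrow> stretch w s (stretch w t y) = y"
proof -
  assume w: "norm w = 1" and st: "s * t = 1"
  have "stretch w s (stretch w t y) = y + (((t - 1) + (s - 1) * t) * (y \<bullet> w)) *\<^sub>R w"
    by (simp only: stretch_def[of w s] stretch_inner[OF w])
       (simp add: stretch_def algebra_simps)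
  also have "(t - 1) + (s - 1) * t = 0" using st by (simp add: algebra_simps)
  finally show ?thesis by simp
qed

lemma stretch_plane: "w \<in> plane b \<Longrightarrow> y \<in> plane b \<Longrightarrow> stretch w s y \<in> plane b"
  by (simp add: stretch_def plane_def inner_add_left)

lemma continuous_stretch [continuous_intros]:
  "continuous_on S f \<Longrightarrow> continuous_on S (\<lambda>x. stretch w s (f x))"
  unfolding stretch_def by (intro continuous_intros)

lemma measurable_stretch [measurable]: "stretch w s \<in> borel_measurable borel"
  by (intro borel_measurable_continuous_onI continuous_intros)

lemma continuous_proj [continuous_intros]:
  "continuous_on S f \<Longrightarrow> continuous_on S (\<lambda>x. proj b (f x))"
  unfolding proj_def by (intro continuous_intros)

lemma measurable_proj [measurable]: "proj b \<in> borel_measurable borel"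
  by (intro borel_measurable_continuous_onI continuous_intros)

lemma proj_diff: "proj b (x - y) = proj b x - proj b y"
  by (simp add: proj_def inner_diff_left algebra_simps)

lemma proj_add: "proj b (x + y) = proj b x + proj b y"
  by (simp add: proj_def inner_add_left algebra_simps)

lemma proj_scaleR: "proj b (r *\<^sub>R x) = r *\<^sub>R proj b x"
  by (simp add: proj_def algebra_simps)

lemma proj_self: "norm b = 1 \<Longrightarrow> proj b b = 0"
  by (simp add: proj_def norm_eq_1)

lemma proj_in_plane: "norm b = 1 \<Longrightarrow> proj b x \<in> plane b"
  by (simp add: proj_def plane_def inner_diff_left norm_eq_1)

lemma proj_plane: "x \<in> plane b \<Longrightarrow> proj b x = x"
  by (simp add: proj_def plane_def)

lemma norm_proj_le: "norm b = 1 \<Longrightarrow> norm (proj b x) \<le> norm x"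
proof -
  assume b: "norm b = 1"
  have "(norm (proj b x))\<^sup>2 = (norm x)\<^sup>2 - (x \<bullet> b)\<^sup>2"
    using b unfolding proj_def power2_norm_eq_inner
    by (simp add: inner_diff_left inner_diff_right norm_eq_1 inner_commute power2_eq_square)
  then have "(norm (proj b x))\<^sup>2 \<le> (norm x)\<^sup>2" by simp
  then show ?thesis by (rule power2_le_imp_le) simp
qed

text \<open>\<open>H\<close> is any measure on the Borel sets that agrees there with the outer
  measure. Countable additivity thus comes with the type of \<open>H\<close>, and whether such an
  \<open>H\<close> exists is settled by the case split in the final theorem.\<close>

locale hausdorff_codim1 =
  fixes n :: nat and H :: "'a::euclidean_space measure"
  assumes dim: "DIM('a) = n + 1" and n_pos: "0 < n"
    and sets_H [measurable_cong, simp]: "sets H = sets borel"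
    and emeasure_H: "A \<in> sets borel \<Longrightarrow> emeasure H A = hausdorff_outer n A"
begin

lemma space_H [simp]: "space H = UNIV"
  using sets_eq_imp_space_eq[OF sets_H] by simp

lemma emeasure_plane_bounded:
  assumes "b \<noteq> 0" "bounded A" "A \<subseteq> plane b" "A \<in> sets borel"
  shows "emeasure H A < \<infinity>"
proof -
  have "dim (plane b) = n"
    unfolding plane_def using dim_hyperplane[OF assms(1)] dim by (simp add: inner_commute)
  then show ?thesis
    using hausdorff_outer_subspace_finite[OF subspace_plane _ n_pos assms(3,2)]
    by (simp add: emeasure_H assms)
qed

text \<open>Restricting to the hyperplane keeps the ambient type while making the measure
  sigma-finite, as Tonelli requires.\<close>

definition "HP b = density H (indicator (plane b))"

lemma sets_HP [measurable_cong, simp]: "sets (HP b) = sets borel"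
  by (simp add: HP_def)

lemma space_HP [simp]: "space (HP b) = UNIV"
  by (simp add: HP_def)

lemma emeasure_HP: "A \<in> sets borel \<Longrightarrow> emeasure (HP b) A = emeasure H (plane b \<inter> A)"
  unfolding HP_def by (rule emeasure_restricted) auto

lemma emeasure_HP_bounded:
  "b \<noteq> 0 \<Longrightarrow> bounded A \<Longrightarrow> A \<in> sets borel \<Longrightarrow> emeasure (HP b) A < \<infinity>"
  using emeasure_plane_bounded[of b "plane b \<inter> A"] by (simp add: emeasure_HP bounded_Int)

lemma AE_HP: "AE x in HP b. x \<in> plane b"
  unfolding HP_def by (subst AE_density) (auto simp: indicator_def)

lemma sigma_finite_HP: "b \<noteq> 0 \<Longrightarrow> sigma_finite_measure (HP b)"
  by (rule sigma_finite_measure_cball[OF sets_HP emeasure_HP_bounded]) auto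

lemma HP_translation:
  assumes "v \<in> plane b"
  shows "distr (HP b) borel (\<lambda>x. x + v) = HP b"
proof (rule measure_eqI)
  fix A assume "A \<in> sets (distr (HP b) borel (\<lambda>x. x + v))"
  then have A [measurable]: "A \<in> sets borel" by simp
  let ?B = "plane b \<inter> (\<lambda>x. x + v) -` A"
  have [measurable]: "(\<lambda>x. x + v) -` A \<in> sets borel"
    by (rule measurable_sets_borel[of _ borel]) auto
  have img: "(\<lambda>x. x + v) ` ?B = plane b \<inter> A"
  proof (intro equalityI subsetI)
    fix y assume "y \<in> plane b \<inter> A"
    then have "y - v \<in> ?B" using assms by (auto simp: plane_def inner_diff_left)
    then show "y \<in> (\<lambda>x. x + v) ` ?B" by (metis diff_add_cancel imageI)
  qed (use assms in \<open>auto simp: plane_def inner_add_left\<close>)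
  have "emeasure (distr (HP b) borel (\<lambda>x. x + v)) A = hausdorff_outer n ((\<lambda>x. x) ` ?B)"
    by (simp add: emeasure_distr emeasure_HP emeasure_H)
  also have "\<dots> = hausdorff_outer n ((\<lambda>x. x + v) ` ?B)"
    by (rule hausdorff_outer_isometry) simp
  also have "\<dots> = emeasure (HP b) A"
    unfolding img by (simp add: emeasure_HP emeasure_H)
  finally show "emeasure (distr (HP b) borel (\<lambda>x. x + v)) A = emeasure (HP b) A" .
qed simp

text \<open>The pull-back \<open>m2\<close> of the measure on the hyperplane under the stretch is
  again translation invariant, hence proportional to \<open>m\<close>. The factor is read off on one
  cylinder around the axis \<open>w\<close>: stretching only changes its height, and height enters
  linearly because the heights carry a translation invariant measure on the real line.\<close>

lemma emeasure_stretch: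
  assumes b: "b \<noteq> 0" and w: "w \<in> plane b" "norm w = 1" and s: "0 < s"
    and A: "A \<in> sets borel" "A \<subseteq> plane b"
  shows "stretch w s ` A \<in> sets borel" "emeasure H (stretch w s ` A) = ennreal s * emeasure H A"
proof -
  have inv1: "stretch w s (stretch w (1/s) y) = y" and inv2: "stretch w (1/s) (stretch w s y) = y" for y
    using w s by (auto intro!: stretch_inverse)
  have vimg: "stretch w (1/s) -` E = stretch w s ` E" for E
  proof (intro equalityI subsetI)
    fix y assume "y \<in> stretch w (1/s) -` E"
    then show "y \<in> stretch w s ` E" using inv1[of y] by (intro image_eqI[of _ _ "stretch w (1/s) y"]) auto
  qed (auto simp: inv2)
  show *: "stretch w s ` A \<in> sets borel"
    using measurable_sets_borel[OF measurable_stretch[of w "1/s"] A(1)] vimg by simp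
  define m where "m = HP b"
  define m2 where "m2 = distr m borel (stretch w (1/s))"
  have [measurable_cong, simp]: "sets m = sets borel" "sets m2 = sets borel"
    and [simp]: "space m = UNIV"
    by (auto simp: m_def m2_def)
  have m_trans: "distr m borel (\<lambda>x. x + v) = m" if "v \<in> plane b" for v
    unfolding m_def by (rule HP_translation[OF that])
  have m2: "emeasure m2 E = emeasure m (stretch w s ` E)" if "E \<in> sets borel" for E
    using that by (simp add: m2_def emeasure_distr vimg)
  have m_sf: "sigma_finite_measure m" unfolding m_def by (rule sigma_finite_HP[OF b])
  have bl: "bounded_linear (stretch w s)"
    unfolding stretch_def
    by (intro bounded_linear_intros)
  have m2_fin: "emeasure m2 E < \<infinity>" if "bounded E" "E \<in> sets borel" for E
    using that emeasure_HP_bounded[OF b, of "stretch w s ` E"] bounded_linear_image[OF _ bl, of E]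
      measurable_sets_borel[OF measurable_stretch[of w "1/s"] that(2)] vimg
    by (simp add: m2 m_def)
  \<comment> \<open>The cylinder of radius 1 around the axis \<open>w\<close> with half-height
    \<open>r\<close>. It is symmetric under negation, as the proportionality lemma asks of its
    second set, and \<open>stretch w s\<close> maps \<open>B 1\<close> onto
    \<open>B s\<close>.\<close>
  define B where "B r = {y. norm (proj w y) \<le> 1 \<and> \<bar>y \<bullet> w\<bar> \<le> r}" for r
  have B_closed: "closed (B r)" for r
    unfolding B_def by (intro closed_Collect_conj closed_Collect_le continuous_intros)
  then have [measurable]: "B r \<in> sets borel" for r by (rule borel_closed)
  have B_bdd: "bounded (B r)" for r
  proof (rule boundedI)
    fix y assume y: "y \<in> B r"
    have "norm y \<le> norm (proj w y) + norm ((y \<bullet> w) *\<^sub>R w)"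
      unfolding proj_def by (metis diff_add_cancel norm_triangle_ineq)
    then show "norm y \<le> 1 + r" using y w by (auto simp: B_def)
  qed
  have "proj w (stretch w t y) = proj w y" for t y
    using w by (simp add: proj_def stretch_inner) (simp add: stretch_def algebra_simps)
  then have "stretch w (1/s) -` B 1 = B s"
    using s w by (auto simp: B_def stretch_inner abs_mult field_simps)
  then have m2B: "emeasure m2 (B 1) = emeasure m (B s)" by (simp add: m2 vimg)
  \<comment> \<open>the height of cylinders gives a translation invariant measure on the line\<close>
  define T where "T = {y. norm (proj w y) \<le> 1}"
  have "closed T" unfolding T_def by (intro closed_Collect_le continuous_intros)
  then have [measurable]: "T \<in> sets borel" by (rule borel_closed)
  define l where "l = distr (density m (indicator T)) borel (\<lambda>y. y \<bullet> w)"
  have [measurable_cong, simp]: "sets l = sets borel" by (simp add: l_def)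
  have l_emeasure: "emeasure l E = emeasure m (T \<inter> (\<lambda>y. y \<bullet> w) -` E)" if "E \<in> sets borel" for E
    unfolding l_def using that measurable_sets_borel[of "\<lambda>y. y \<bullet> w" borel E]
    by (subst emeasure_distr) (auto intro!: emeasure_restricted)
  have lB: "emeasure l {-r..r} = emeasure m (B r)" for r
    by (subst l_emeasure) (auto simp: T_def B_def intro!: arg_cong[where f = "emeasure m"])
  have l_fin: "emeasure l (cball 0 (real k)) < \<infinity>" for k :: nat
    using lB[of k] emeasure_HP_bounded[OF b B_bdd[of k]] by (simp add: cball_eq_atLeastAtMost m_def)
  have l_trans: "distr l borel (\<lambda>x. x + r) = l" for r
  proof (rule measure_eqI)
    fix E assume "E \<in> sets (distr l borel (\<lambda>x. x + r))"
    then have [measurable]: "E \<in> sets borel" by simp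
    have rw: "r *\<^sub>R w \<in> plane b" using w by (auto simp: plane_def)
    have E1 [measurable]: "(\<lambda>x. x + r) -` E \<in> sets borel"
      by (rule measurable_sets_borel[of _ borel]) auto
    have E2 [measurable]: "(\<lambda>y. y \<bullet> w) -` E \<in> sets borel"
      by (rule measurable_sets_borel[of _ borel]) auto
    have "emeasure (distr l borel (\<lambda>x. x + r)) E = emeasure l ((\<lambda>x. x + r) -` E)"
      by (simp add: emeasure_distr l_def)
    also have "\<dots> = emeasure m (T \<inter> (\<lambda>y. y \<bullet> w) -` ((\<lambda>x. x + r) -` E))"
      by (rule l_emeasure) measurable
    also have "T \<inter> (\<lambda>y. y \<bullet> w) -` ((\<lambda>x. x + r) -` E)
        = (\<lambda>y. y + r *\<^sub>R w) -` (T \<inter> (\<lambda>y. y \<bullet> w) -` E)"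
      using w by (auto simp: T_def proj_add proj_scaleR proj_self inner_add_left norm_eq_1)
    also have "emeasure m \<dots> = emeasure (distr m borel (\<lambda>y. y + r *\<^sub>R w)) (T \<inter> (\<lambda>y. y \<bullet> w) -` E)"
      by (subst emeasure_distr) auto
    also have "\<dots> = emeasure l E"
      unfolding m_trans[OF rw] by (simp add: l_emeasure)
    finally show "emeasure (distr l borel (\<lambda>x. x + r)) E = emeasure l E" .
  qed simp
  \<comment> \<open>Comparison with Lebesgue measure on the line: intervals of lengths
    \<open>2 * s\<close> and 2 give the factor \<open>s\<close>.\<close>
  have "emeasure l {-s..s} * emeasure lborel {-1..1::real} = emeasure lborel {-s..s} * emeasure l {-1..1}"
  proof (rule translation_invariant_measure_proportional[where S = UNIV])
    show "sigma_finite_measure l" by (rule sigma_finite_measure_cball) (use l_fin in auto)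
    show "distr lborel borel (\<lambda>x. x + v) = (lborel :: real measure)" for v
      using lborel_distr_plus[of v] by (simp only: add.commute[of _ v])
  qed (auto simp: l_trans sigma_finite_lborel)
  then have "2 * emeasure m (B s) = 2 * (ennreal s * emeasure m (B 1))"
    using s by (simp add: lB mult.commute[of _ 2] ennreal_mult mult.assoc[symmetric])
  then have mBs: "emeasure m (B s) = ennreal s * emeasure m (B 1)"
    by (simp add: ennreal_mult_cancel_left)
  have m2_trans: "distr m2 borel (\<lambda>x. x + v) = m2" if v: "v \<in> plane b" for v
  proof -
    have "distr m2 borel (\<lambda>x. x + v) = distr m borel (\<lambda>x. stretch w (1/s) x + v)"
      unfolding m2_def by (subst distr_distr) (auto simp: comp_def)
    also have "(\<lambda>x. stretch w (1/s) x + v) = stretch w (1/s) \<circ> (\<lambda>x. x + stretch w s v)"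
      by (auto simp: stretch_add inv2)
    also have "distr m borel \<dots> = distr (distr m borel (\<lambda>x. x + stretch w s v)) borel (stretch w (1/s))"
      by (subst distr_distr) auto
    also have "\<dots> = m2"
      unfolding m2_def by (subst m_trans) (auto intro!: stretch_plane w v)
    finally show ?thesis .
  qed
  have AEm: "AE x in m. x \<in> plane b" unfolding m_def by (rule AE_HP)
  have "emeasure m2 A * emeasure m (B 1) = emeasure m A * emeasure m2 (B 1)"
  proof (rule translation_invariant_measure_proportional[where S = "plane b"])
    show "sigma_finite_measure m2" by (rule sigma_finite_measure_cball[OF _ m2_fin]) auto
    show "AE x in m2. x \<in> plane b"
      unfolding m2_def using AEm
      by (subst AE_distr_iff) (auto elim!: eventually_mono intro!: stretch_plane w)
    show "- x \<in> B 1 \<longleftrightarrow> x \<in> B 1" for x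
    proof -
      have "proj w (- x) = - proj w x" by (simp add: proj_def)
      then show ?thesis by (simp add: B_def)
    qed
    show "- x \<in> plane b" if "x \<in> plane b" for x using that by (simp add: plane_def)
  qed (auto simp: m_sf m_trans m2_trans AEm A)
  then have key: "emeasure m2 A * emeasure m (B 1) = (ennreal s * emeasure m A) * emeasure m (B 1)"
    by (simp add: m2B mBs ac_simps)
  have "emeasure m2 A = ennreal s * emeasure m A"
  proof (cases "emeasure m (B 1) = 0")
    case False
    moreover have "emeasure m (B 1) < \<infinity>"
      unfolding m_def by (rule emeasure_HP_bounded[OF b B_bdd]) auto
    ultimately show ?thesis using key by (auto simp: ennreal_mult_cancel_left mult.commute[of _ "emeasure m (B 1)"])
  next
    case True
    \<comment> \<open>If the unit cylinder is null, its dilations show that every ball in the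
      hyperplane is null, so both sides vanish. Radius 0 is a single point and is separated because
      the dilation divides by \<open>k\<close>.\<close>
    have "emeasure m (cball 0 (real k)) = 0" for k
    proof (cases "k = 0")
      case True
      then show ?thesis
        using n_pos by (simp add: m_def emeasure_HP emeasure_H hausdorff_outer_singleton
             plane_def cball_trivial Int_absorb1)
    next
      case False
      let ?f = "\<lambda>x. real k *\<^sub>R x"
      have "plane b \<inter> cball 0 (real k) \<subseteq> ?f ` (plane b \<inter> B 1)"
      proof
        fix x assume x: "x \<in> plane b \<inter> cball 0 (real k)"
        let ?y = "(1 / real k) *\<^sub>R x"
        have y: "norm ?y \<le> 1" using x False by (simp add: field_simps)
        have "?y \<in> B 1"
          using norm_proj_le[OF w(2), of ?y] Cauchy_Schwarz_ineq2[of ?y w] y w by (auto simp: B_def)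
        moreover have "?y \<in> plane b" using x by (simp add: plane_def)
        moreover have "x = ?f ?y" using False by simp
        ultimately show "x \<in> ?f ` (plane b \<inter> B 1)" by blast
      qed
      then have "hausdorff_outer n (plane b \<inter> cball 0 (real k)) \<le> hausdorff_outer n (?f ` (plane b \<inter> B 1))"
        by (rule hausdorff_outer_mono)
      also have "\<dots> \<le> ennreal (real k ^ n) * hausdorff_outer n (plane b \<inter> B 1)"
        using False by (intro hausdorff_outer_lipschitz) (auto simp flip: scaleR_diff_right)
      also have "\<dots> = 0" using True by (simp add: m_def emeasure_HP emeasure_H)
      finally show ?thesis by (simp add: m_def emeasure_HP emeasure_H)
    qed
    moreover have "(\<Union>k. cball 0 (real k)) = (UNIV::'a set)"
      by (auto simp: real_arch_simple)
    ultimately have "emeasure m UNIV = 0"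
      using emeasure_UN_eq_0[of m "\<lambda>k::nat. cball 0 (real k)"] by (simp add: image_subset_iff)
    then have "emeasure m E = 0" for E
      using emeasure_space[of m E] by simp
    then show ?thesis using A by (simp add: m2)
  qed
  moreover have "emeasure m2 A = emeasure H (stretch w s ` A)"
  proof -
    have "plane b \<inter> stretch w s ` A = stretch w s ` A"
      using A(2) stretch_plane[OF w(1)] by auto
    then show ?thesis by (simp add: m2[OF A(1)] m_def emeasure_HP[OF *])
  qed
  moreover have "emeasure m A = emeasure H A"
    using A by (simp add: m_def emeasure_HP Int_absorb1)
  ultimately show "emeasure H (stretch w s ` A) = ennreal s * emeasure H A" by simp
qed

text \<open>Between two hyperplanes the projection contracts in exactly one direction, by the factor
  |nu.b|. Undoing this contraction by a stretch along the normalised projection \<open>w\<close> of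
  the normal yields an isometry.\<close>

lemma hausdorff_outer_proj_plane:
  fixes b \<nu> :: 'a
  assumes b: "norm b = 1" and \<nu>: "norm \<nu> = 1" "\<nu> \<bullet> b \<noteq> 0"
    and A: "A \<subseteq> plane \<nu>" "proj b ` A \<in> sets borel"
  shows "hausdorff_outer n (proj b ` A) = ennreal \<bar>\<nu> \<bullet> b\<bar> * hausdorff_outer n A"
proof -
  let ?c = "\<bar>\<nu> \<bullet> b\<bar>"
  have bb: "b \<bullet> b = 1" "\<nu> \<bullet> \<nu> = 1" using b \<nu> by (auto simp: norm_eq_1)
  have np: "(norm (proj b x))\<^sup>2 = (norm x)\<^sup>2 - (x \<bullet> b)\<^sup>2" for x
    unfolding proj_def power2_norm_eq_inner
    by (simp add: inner_diff_left inner_diff_right bb inner_commute power2_eq_square)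
  show ?thesis
  \<comment> \<open>When the projection of the normal vanishes, the two hyperplanes coincide and
    there is no direction \<open>w\<close> to stretch along.\<close>
  proof (cases "proj b \<nu> = 0")
    case True
    then have \<nu>b: "\<nu> = (\<nu> \<bullet> b) *\<^sub>R b" by (simp add: proj_def)
    then have "norm \<nu> = ?c" using b by (metis mult.right_neutral norm_scaleR)
    then have "?c = 1" using \<nu> by simp
    moreover have "x \<in> plane b" if "x \<in> A" for x
    proof -
      have "x \<bullet> \<nu> = 0" using that A by (auto simp: plane_def)
      then have "(\<nu> \<bullet> b) * (x \<bullet> b) = 0" by (subst (asm) \<nu>b) simp
      then show ?thesis using \<nu> by (simp add: plane_def)
    qed
    then have "proj b ` A = A" by (force simp: proj_plane)
    ultimately show ?thesis by simp
  next
    case False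
    define r where "r = norm (proj b \<nu>)"
    define w where "w = (1 / r) *\<^sub>R proj b \<nu>"
    have r: "r > 0" "r\<^sup>2 = 1 - (\<nu> \<bullet> b)\<^sup>2" using False np[of \<nu>] \<nu> by (auto simp: r_def)
    have w: "norm w = 1" "w \<in> plane b"
      using r proj_in_plane[OF b, of \<nu>] by (auto simp: w_def r_def plane_def)
    \<comment> \<open>By Pythagoras the projection loses the square of \<open>x \<bullet> b\<close>
      from the squared norm. Since \<open>r * t = - (x \<bullet> b) * (\<nu> \<bullet> b)\<close>
      and r^2 = 1 - (nu.b)^2, the stretch restores exactly that amount.\<close>
    have iso: "norm (stretch w (1/?c) (proj b x)) = norm x" if x: "x \<in> plane \<nu>" for x
    proof -
      define t where "t = proj b x \<bullet> w"
      have "x \<bullet> \<nu> = 0" using x by (simp add: plane_def)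
      then have "r * t = - (x \<bullet> b) * (\<nu> \<bullet> b)"
        using r bb unfolding t_def w_def proj_def
        by (simp add: inner_diff_left inner_diff_right inner_commute)
      then have rt: "r\<^sup>2 * t\<^sup>2 = (x \<bullet> b)\<^sup>2 * (\<nu> \<bullet> b)\<^sup>2"
        by (metis power_mult_distrib power2_minus mult_minus_left)
      have c2: "?c\<^sup>2 = (\<nu> \<bullet> b)\<^sup>2" by simp
      have "(norm (stretch w (1/?c) (proj b x)))\<^sup>2 = (norm (proj b x))\<^sup>2 + ((1/?c)\<^sup>2 - 1) * t\<^sup>2"
        using w(1) unfolding stretch_def power2_norm_eq_inner t_def
        by (simp add: inner_add_left inner_add_right norm_eq_1 inner_commute power2_eq_square
            algebra_simps del: divide_cancel_left)
      also have "((1/?c)\<^sup>2 - 1) * t\<^sup>2 = (r\<^sup>2 * t\<^sup>2) / (\<nu> \<bullet> b)\<^sup>2"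
        using \<nu> by (simp add: r power_divide field_simps)
      also have "\<dots> = (x \<bullet> b)\<^sup>2" using \<nu> by (simp add: rt)
      finally have "(norm (stretch w (1/?c) (proj b x)))\<^sup>2 = (norm x)\<^sup>2" by (simp add: np)
      then show ?thesis by (metis norm_ge_zero power2_eq_imp_eq)
    qed
    have "stretch w s x - stretch w s y = stretch w s (x - y)" for s x y
      by (simp add: stretch_def inner_diff_left algebra_simps)
    then have "hausdorff_outer n ((\<lambda>x. stretch w (1/?c) (proj b x)) ` A) = hausdorff_outer n ((\<lambda>x. x) ` A)"
      using A(1) by (intro hausdorff_outer_isometry)
        (auto simp flip: proj_diff intro!: iso subspace_diff[OF subspace_plane])
    moreover have "hausdorff_outer n ((\<lambda>x. stretch w (1/?c) (proj b x)) ` A)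
        = ennreal (1/?c) * hausdorff_outer n (proj b ` A)"
    proof -
      have st: "b \<noteq> 0" "0 < 1/?c" "proj b ` A \<subseteq> plane b"
        using b \<nu> by (auto intro: proj_in_plane)
      note str = emeasure_stretch[OF st(1) w(2,1) st(2) A(2) st(3)]
      show ?thesis
        using str(2) emeasure_H[OF A(2)] emeasure_H[OF str(1)] by (simp add: image_image)
    qed
    ultimately have "ennreal ?c * (ennreal (1/?c) * hausdorff_outer n (proj b ` A)) = ennreal ?c * hausdorff_outer n A"
      by simp
    then show ?thesis using \<nu> by (simp add: mult.assoc[symmetric] ennreal_mult[symmetric])
  qed
qed

text \<open>The oblique projection \<open>P\<close> along \<open>b\<close> onto
  \<open>plane \<nu>\<close> does not change the image under \<open>proj b\<close>, so the exact
  formula applies to the image of \<open>A\<close> under \<open>P\<close>. It moves a difference x -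
  y by |nu.(x - y)| / |nu.b|, at most \<open>q\<close> times its length, so on \<open>A\<close> it
  is bi-Lipschitz with constants \<open>1 + q\<close> and \<open>1 / (1 - q)\<close>.\<close>

lemma hausdorff_outer_proj_nearly_flat:
  fixes b \<nu> :: 'a
  assumes b: "norm b = 1" and \<nu>: "norm \<nu> = 1"
    and \<epsilon>: "0 \<le> \<epsilon>" "\<epsilon> < \<bar>\<nu> \<bullet> b\<bar>"
    and flat: "\<And>x y. x \<in> A \<Longrightarrow> y \<in> A \<Longrightarrow> \<bar>\<nu> \<bullet> (x - y)\<bar> \<le> \<epsilon> * norm (x - y)"
    and A: "proj b ` A \<in> sets borel"
  defines "q \<equiv> \<epsilon> / \<bar>\<nu> \<bullet> b\<bar>"
  shows "hausdorff_outer n (proj b ` A) \<le> ennreal (\<bar>\<nu> \<bullet> b\<bar> * (1 + q) ^ n) * hausdorff_outer n A"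
    and "ennreal (\<bar>\<nu> \<bullet> b\<bar> * (1 - q) ^ n) * hausdorff_outer n A \<le> hausdorff_outer n (proj b ` A)"
proof -
  let ?c = "\<bar>\<nu> \<bullet> b\<bar>"
  have c: "?c > 0" and c': "\<nu> \<bullet> b \<noteq> 0" "b \<bullet> \<nu> \<noteq> 0" using \<epsilon> by (auto simp: inner_commute)
  have q: "0 \<le> q" "q < 1" using \<epsilon> c by (auto simp: q_def)
  define P where "P x = x - ((x \<bullet> \<nu>) / (b \<bullet> \<nu>)) *\<^sub>R b" for x
  have Pdiff: "P x - P y = P (x - y)" for x y
    by (simp add: P_def inner_diff_left algebra_simps diff_divide_distrib)
  have close: "norm (P (x - y) - (x - y)) \<le> q * norm (x - y)" if "x \<in> A" "y \<in> A" for x y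
  proof -
    have "norm (P (x - y) - (x - y)) = \<bar>\<nu> \<bullet> (x - y)\<bar> / ?c"
      using b by (simp add: P_def inner_commute)
    then show ?thesis using flat[OF that] c by (simp add: q_def divide_right_mono)
  qed
  have up: "norm (P x - P y) \<le> (1 + q) * norm (x - y)" if "x \<in> A" "y \<in> A" for x y
    using close[OF that] norm_triangle_ineq[of "P (x - y) - (x - y)" "x - y"]
    unfolding Pdiff by (simp add: algebra_simps)
  have lo: "norm (x - y) \<le> (1 / (1 - q)) * norm (P x - P y)" if "x \<in> A" "y \<in> A" for x y
    using close[OF that] norm_triangle_ineq2[of "x - y" "P (x - y)"] q
    unfolding Pdiff by (simp add: field_simps norm_minus_commute)
  have "proj b (P x) = proj b x" for x
    using b by (simp add: P_def proj_diff proj_scaleR proj_self)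
  then have img: "proj b ` P ` A = proj b ` A" by (simp add: image_image)
  have "P ` A \<subseteq> plane \<nu>" using c' by (auto simp: P_def plane_def inner_diff_left)
  then have main: "hausdorff_outer n (proj b ` A) = ennreal ?c * hausdorff_outer n (P ` A)"
    using hausdorff_outer_proj_plane[OF b \<nu> c'(1), of "P ` A"] A by (simp add: img)
  have "hausdorff_outer n (P ` A) \<le> ennreal ((1 + q) ^ n) * hausdorff_outer n ((\<lambda>x. x) ` A)"
    by (rule hausdorff_outer_image_le) (use q up in auto)
  then show "hausdorff_outer n (proj b ` A) \<le> ennreal (?c * (1 + q) ^ n) * hausdorff_outer n A"
    unfolding main using q by (simp add: ennreal_mult mult.assoc mult_left_mono)
  have "hausdorff_outer n ((\<lambda>x. x) ` A) \<le> ennreal ((1 / (1 - q)) ^ n) * hausdorff_outer n (P ` A)"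
    by (rule hausdorff_outer_image_le) (use q lo in auto)
  then have "ennreal ((1 - q) ^ n) * hausdorff_outer n A
      \<le> ennreal ((1 - q) ^ n) * (ennreal ((1 / (1 - q)) ^ n) * hausdorff_outer n (P ` A))"
    by (intro mult_left_mono) auto
  also have "\<dots> = hausdorff_outer n (P ` A)"
    using q by (simp add: mult.assoc[symmetric] ennreal_mult[symmetric] power_mult_distrib[symmetric])
  finally show "ennreal (?c * (1 - q) ^ n) * hausdorff_outer n A \<le> hausdorff_outer n (proj b ` A)"
    unfolding main using q by (simp add: ennreal_mult mult.assoc mult_left_mono)
qed

end

section \<open>Local geometry of hypersurfaces\<close>

text \<open>All that is kept of the defining function: its strict differentiability on the zero set, and the
  intermediate value argument of the implicit function theorem. Both conditions depend only on the
  direction of the gradient, so they can be stated for the unit normal.\<close>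
definition flat_at :: "'a::euclidean_space set \<Rightarrow> 'a \<Rightarrow> 'a \<Rightarrow> bool" where
  "flat_at M p \<nu> \<longleftrightarrow> (\<forall>\<epsilon>>0. \<exists>r>0. \<forall>x\<in>M \<inter> ball p r. \<forall>y\<in>M \<inter> ball p r.
     \<bar>\<nu> \<bullet> (x - y)\<bar> \<le> \<epsilon> * norm (x - y))"

definition crossed_at :: "'a::euclidean_space set \<Rightarrow> 'a \<Rightarrow> 'a \<Rightarrow> bool" where
  "crossed_at M p \<nu> \<longleftrightarrow> (\<forall>b. \<nu> \<bullet> b \<noteq> 0 \<longrightarrow>
     (\<forall>\<delta>>0. \<exists>\<eta>>0. \<forall>z\<in>ball p \<eta>. \<exists>t. \<bar>t\<bar> < \<delta> \<and> z + t *\<^sub>R b \<in> M))"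

text \<open>Near \<open>p\<close> the gradient of g minus its linear part at \<open>p\<close> has
  norm at most eps by continuity of \<open>G\<close>; the mean value inequality on the convex ball
  does the rest.\<close>

lemma GDERIV_strict:
  fixes g :: "'a::euclidean_space \<Rightarrow> real"
  assumes U: "open U" "p \<in> U" and g: "\<And>x. x \<in> U \<Longrightarrow> GDERIV g x :> G x"
    and G: "continuous_on U G" and \<epsilon>: "0 < \<epsilon>"
  obtains r where "0 < r" "ball p r \<subseteq> U"
    "\<And>x y. x \<in> ball p r \<Longrightarrow> y \<in> ball p r \<Longrightarrow> \<bar>g x - g y - G p \<bullet> (x - y)\<bar> \<le> \<epsilon> * norm (x - y)"
proof -
  obtain r1 where r1: "r1 > 0" "ball p r1 \<subseteq> U" using U open_contains_ball by blast
  obtain r2 where r2: "r2 > 0" "\<And>x. x \<in> U \<Longrightarrow> dist x p < r2 \<Longrightarrow> dist (G x) (G p) < \<epsilon>"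
    using G U(2) \<epsilon> unfolding continuous_on_iff by metis
  define r where "r = min r1 r2"
  have r: "r > 0" "ball p r \<subseteq> U" using r1 r2(1) by (auto simp: r_def)
  show thesis
  proof (rule that[OF r])
    fix x y assume xy: "x \<in> ball p r" "y \<in> ball p r"
    define h where "h x = g x - G p \<bullet> x" for x
    have der: "(h has_derivative (\<lambda>v. v \<bullet> (G x - G p))) (at x within ball p r)" if "x \<in> ball p r" for x
    proof -
      have "(g has_derivative (\<lambda>v. v \<bullet> G x)) (at x within ball p r)"
        using g[of x] subsetD[OF r(2) that] unfolding gderiv_def
        by (auto intro: has_derivative_at_withinI)
      then show ?thesis unfolding h_def
        by (auto intro!: derivative_eq_intros simp: inner_diff_right inner_commute)
    qed
    have on: "onorm (\<lambda>v. v \<bullet> (G x - G p)) \<le> \<epsilon>" if "x \<in> ball p r" for x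
    proof (rule onorm_bound)
      fix v :: 'a
      have "dist (G x) (G p) < \<epsilon>" using that r(2) by (intro r2(2)) (auto simp: r_def dist_commute)
      then have "norm v * norm (G x - G p) \<le> norm v * \<epsilon>"
        by (intro mult_left_mono) (auto simp: dist_norm)
      then show "norm (v \<bullet> (G x - G p)) \<le> \<epsilon> * norm v"
        using Cauchy_Schwarz_ineq2[of v "G x - G p"] by (simp add: mult.commute)
    qed (use \<epsilon> in simp)
    have "norm (h x - h y) \<le> \<epsilon> * norm (x - y)"
      by (rule differentiable_bound[OF convex_ball der on]) (use xy in auto)
    then show "\<bar>g x - g y - G p \<bullet> (x - y)\<bar> \<le> \<epsilon> * norm (x - y)"
      by (simp add: h_def inner_diff_right algebra_simps)
  qed
qed

text \<open>Flatness: \<open>g\<close> vanishes at both points, so strict differentiability leaves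
  only \<open>D \<bullet> (x - y)\<close>. Crossing: along a transversal direction \<open>g\<close>
  changes sign between z - s b and z + s b, with the same \<open>s\<close> for all z near
  \<open>p\<close>.\<close>

lemma smooth_hypersurface_local:
  fixes M :: "'a::euclidean_space set"
  assumes hyp: "smooth_hypersurface M" and p: "p \<in> M"
  obtains D where "D \<noteq> 0" "flat_at M p D" "crossed_at M p D" "\<exists>r>0. compact (M \<inter> cball p r)"
proof -
  obtain U g where U: "open U" "p \<in> U" and sm: "smooth_on U g"
    and nz: "\<forall>x\<in>U. \<exists>D. (GDERIV g x :> D) \<and> D \<noteq> 0" and MU: "M \<inter> U = {x \<in> U. g x = 0}"
    using hyp p unfolding smooth_hypersurface_def by meson
  have "Ck_on (Suc 0) U g" using sm unfolding smooth_on_def by blast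
  then obtain G where G: "\<And>x. x \<in> U \<Longrightarrow> GDERIV g x :> G x" and gcont: "continuous_on U g"
    and Gb: "\<And>b. b \<in> Basis \<Longrightarrow> continuous_on U (\<lambda>x. G x \<bullet> b)" by auto
  have Gcont: "continuous_on U G" using Gb by (subst continuous_on_componentwise) auto
  define D where "D = G p"
  have D0: "D \<noteq> 0"
  proof -
    \<comment> \<open>The nonzero gradient and the continuous gradient come from separate existence
      statements; uniqueness of the derivative identifies them at \<open>p\<close>.\<close>
    obtain D' where D': "GDERIV g p :> D'" "D' \<noteq> 0" using nz U by blast
    have "(\<lambda>h. h \<bullet> D') = (\<lambda>h. h \<bullet> D)"
      using D'(1) G[OF U(2)] unfolding gderiv_def D_def by (rule has_derivative_unique)
    then show ?thesis using D'(2) by (metis inner_eq_zero_iff inner_zero_right)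
  qed
  have mem: "x \<in> M \<longleftrightarrow> g x = 0" if "x \<in> U" for x using MU that by blast
  have flat: "flat_at M p D"
    unfolding flat_at_def
  proof (intro allI impI)
    fix \<epsilon> :: real assume "\<epsilon> > 0"
    then obtain r where r: "0 < r" "ball p r \<subseteq> U"
      "\<And>x y. x \<in> ball p r \<Longrightarrow> y \<in> ball p r \<Longrightarrow> \<bar>g x - g y - D \<bullet> (x - y)\<bar> \<le> \<epsilon> * norm (x - y)"
      using GDERIV_strict[OF U G Gcont] unfolding D_def by metis
    have "\<bar>D \<bullet> (x - y)\<bar> \<le> \<epsilon> * norm (x - y)" if "x \<in> M \<inter> ball p r" "y \<in> M \<inter> ball p r" for x y
      using r(3)[of x y] that r(2) mem[of x] mem[of y] by (auto simp: subset_iff)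
    then show "\<exists>r>0. \<forall>x\<in>M \<inter> ball p r. \<forall>y\<in>M \<inter> ball p r. \<bar>D \<bullet> (x - y)\<bar> \<le> \<epsilon> * norm (x - y)"
      using r(1) by blast
  qed
  have crossed: "crossed_at M p D"
    unfolding crossed_at_def
  proof (intro allI impI)
    fix b and \<delta> :: real assume b: "D \<bullet> b \<noteq> 0" and \<delta>: "0 < \<delta>"
    then have b0: "b \<noteq> 0" by auto
    \<comment> \<open>With this value the error at distance s |b| is at most half of the linear term
      s |D.b|, so the linear term decides the sign.\<close>
    define \<epsilon> where "\<epsilon> = \<bar>D \<bullet> b\<bar> / (2 * norm b)"
    have "\<epsilon> > 0" using b b0 by (simp add: \<epsilon>_def)
    then obtain r where r: "0 < r" "ball p r \<subseteq> U"
      "\<And>x y. x \<in> ball p r \<Longrightarrow> y \<in> ball p r \<Longrightarrow> \<bar>g x - g y - D \<bullet> (x - y)\<bar> \<le> \<epsilon> * norm (x - y)"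
      using GDERIV_strict[OF U G Gcont] unfolding D_def by metis
    \<comment> \<open>The first bound keeps the crossing parameter below \<open>\<delta>\<close>;
      the second keeps z + t b inside the ball of radius \<open>r\<close> for every z within
      \<open>r / 2\<close> of \<open>p\<close>.\<close>
    define s where "s = min (\<delta> / 2) (r / (2 * norm b))"
    have s: "0 < s" "s < \<delta>" "s * norm b \<le> r / 2"
      using \<delta> r(1) b0 by (auto simp: s_def min_def field_simps)
    have gp: "g p = 0" using mem[OF U(2)] p by simp
    have near: "p + t *\<^sub>R b \<in> ball p r" if "\<bar>t\<bar> \<le> s" for t
    proof -
      have "\<bar>t\<bar> * norm b \<le> s * norm b" using that by (simp add: mult_right_mono)
      then show ?thesis using s r(1) by (simp add: dist_norm)
    qed
    have lin: "\<bar>g (p + t *\<^sub>R b) - t * (D \<bullet> b)\<bar> \<le> s * \<bar>D \<bullet> b\<bar> / 2" if "\<bar>t\<bar> = s" for t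
      using r(3)[of "p + t *\<^sub>R b" p] near[of t] that r(1) b0 gp by (simp add: \<epsilon>_def mult.commute)
    \<comment> \<open>Multiplying by \<open>D \<bullet> b\<close> makes the sign pattern the same
      for both orientations of \<open>b\<close>.\<close>
    have sgn: "g (p + s *\<^sub>R b) * (D \<bullet> b) > 0" "g (p + (- s) *\<^sub>R b) * (D \<bullet> b) < 0"
    proof -
      have *: "\<bar>g (p + t *\<^sub>R b) * (D \<bullet> b) - t * (D \<bullet> b)\<^sup>2\<bar> \<le> s * (D \<bullet> b)\<^sup>2 / 2" if "\<bar>t\<bar> = s" for t
      proof -
        have "g (p + t *\<^sub>R b) * (D \<bullet> b) - t * (D \<bullet> b)\<^sup>2 = (g (p + t *\<^sub>R b) - t * (D \<bullet> b)) * (D \<bullet> b)"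
          by (simp add: algebra_simps power2_eq_square)
        then have "\<bar>g (p + t *\<^sub>R b) * (D \<bullet> b) - t * (D \<bullet> b)\<^sup>2\<bar>
            = \<bar>g (p + t *\<^sub>R b) - t * (D \<bullet> b)\<bar> * \<bar>D \<bullet> b\<bar>"
          by (simp add: abs_mult)
        also have "\<dots> \<le> s * \<bar>D \<bullet> b\<bar> / 2 * \<bar>D \<bullet> b\<bar>"
          by (rule mult_right_mono[OF lin[OF that]]) simp
        finally show ?thesis by (simp add: power2_eq_square mult.assoc)
      qed
      have pos: "s * (D \<bullet> b)\<^sup>2 > 0" using s b by simp
      have "\<bar>s\<bar> = s" "\<bar>- s\<bar> = s" using s(1) by auto
      from abs_le_D2[OF *[OF this(1)]] abs_le_D1[OF *[OF this(2)]] pos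
      show "g (p + s *\<^sub>R b) * (D \<bullet> b) > 0" "g (p + (- s) *\<^sub>R b) * (D \<bullet> b) < 0"
        by linarith+
    qed
    \<comment> \<open>The points whose translate by t b has the sign predicted by the linear part.
      These sets are open and contain \<open>p\<close> for \<open>t = s\<close> and
      \<open>t = - s\<close>, which makes the sign change uniform near \<open>p\<close>.\<close>
    define W where "W t = {z. z + t *\<^sub>R b \<in> U \<and> g (z + t *\<^sub>R b) * (D \<bullet> b) * t > 0}" for t
    have W_open: "open (W t)" for t
    proof -
      have "open {x \<in> U. g x * (D \<bullet> b) * t \<in> {0<..}}"
        by (rule continuous_open_preimage[unfolded vimage_def, simplified Int_def mem_Collect_eq])
           (auto intro!: continuous_intros gcont U)
      then have "open ((\<lambda>z. z + t *\<^sub>R b) -` {x \<in> U. g x * (D \<bullet> b) * t \<in> {0<..}})"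
        by (intro open_vimage continuous_intros)
      then show ?thesis by (simp add: W_def vimage_def)
    qed
    have "p \<in> W s" "p \<in> W (- s)"
      using mult_pos_pos[OF sgn(1) s(1)] mult_neg_neg[OF sgn(2), of "- s"] s(1)
        subsetD[OF r(2) near[of s]] subsetD[OF r(2) near[of "- s"]] by (auto simp: W_def)
    then have "open (W s \<inter> W (- s) \<inter> ball p (r / 2))" "p \<in> W s \<inter> W (- s) \<inter> ball p (r / 2)"
      using W_open r(1) by auto
    then obtain \<eta> where \<eta>: "\<eta> > 0" "ball p \<eta> \<subseteq> W s \<inter> W (- s) \<inter> ball p (r / 2)"
      using open_contains_ball by blast
    have "\<exists>t. \<bar>t\<bar> < \<delta> \<and> z + t *\<^sub>R b \<in> M" if z: "z \<in> ball p \<eta>" for z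
    proof -
      have inU: "z + t *\<^sub>R b \<in> U" if "\<bar>t\<bar> \<le> s" for t
      proof -
        have "\<bar>t\<bar> * norm b \<le> s * norm b" using that by (simp add: mult_right_mono)
        moreover have "dist p z < r / 2" using z \<eta> by auto
        moreover have "dist p (z + t *\<^sub>R b) \<le> dist p z + dist z (z + t *\<^sub>R b)" by (rule dist_triangle)
        ultimately have "dist p (z + t *\<^sub>R b) < r" using s(3) by (simp add: dist_norm)
        then show ?thesis using r(2) by auto
      qed
      have cont: "continuous_on {-s..s} (\<lambda>t. g (z + t *\<^sub>R b) * (D \<bullet> b))"
        by (intro continuous_intros continuous_on_compose2[OF gcont]) (auto intro!: inU)
      have "z \<in> W s" "z \<in> W (- s)" using z \<eta>(2) by auto
      then have "0 < (g (z + s *\<^sub>R b) * (D \<bullet> b)) * s" "0 < (g (z + (- s) *\<^sub>R b) * (D \<bullet> b)) * (- s)"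
        unfolding W_def by blast+
      then have "g (z + s *\<^sub>R b) * (D \<bullet> b) > 0" "g (z + (- s) *\<^sub>R b) * (D \<bullet> b) < 0"
        using s(1) by (simp_all only: zero_less_mult_iff) auto
      then obtain t where t: "-s \<le> t" "t \<le> s" "g (z + t *\<^sub>R b) * (D \<bullet> b) = 0"
        using IVT'[of "\<lambda>t. g (z + t *\<^sub>R b) * (D \<bullet> b)" "-s" 0 s] cont s(1) by auto
      then have "z + t *\<^sub>R b \<in> M" using mem[OF inU[of t]] b by auto
      then show ?thesis using t s by (intro exI[of _ t]) auto
    qed
    then show "\<exists>\<eta>>0. \<forall>z\<in>ball p \<eta>. \<exists>t. \<bar>t\<bar> < \<delta> \<and> z + t *\<^sub>R b \<in> M" using \<eta>(1) by blast
  qed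
  obtain r where r: "r > 0" "cball p r \<subseteq> U" using U open_contains_cball by blast
  have "M \<inter> cball p r = {x \<in> cball p r. g x = 0}" using r(2) mem by blast
  moreover have "closed {x \<in> cball p r. g x = 0}"
    using continuous_on_subset[OF gcont r(2)]
    by (rule continuous_closed_preimage_constant) simp
  ultimately have "compact (M \<inter> cball p r)"
    by (metis closed_Int_compact compact_cball Int_absorb2 inf_le2)
  then show thesis using that D0 flat crossed r(1) by blast
qed

text \<open>The height \<open>u t\<close> over the point p + t v is merely chosen by
  \<open>crossed_at\<close>. Flatness first gives u(t) = O(t) and then nu.(gamma(t) - p) = o(t),
  which determines the limit of u(t)/t. Differentiability at 0 is what both
  \<open>tangent_space\<close> and the chain rule at a point ask for, and the explicit form shows
  that the curve lies over a line when projected along \<open>b\<close>.\<close>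

lemma hypersurface_curve:
  fixes M :: "'a::euclidean_space set"
  assumes fl: "flat_at M p \<nu>" and cr: "crossed_at M p \<nu>" and p: "p \<in> M" and b: "\<nu> \<bullet> b \<noteq> 0"
  obtains \<gamma> u e where "0 < e" "\<gamma> 0 = p" "\<And>t. \<bar>t\<bar> < e \<Longrightarrow> \<gamma> t \<in> M"
    "\<And>t. \<bar>t\<bar> < e \<Longrightarrow> \<gamma> t = p + t *\<^sub>R v + u t *\<^sub>R b"
    "(\<gamma> has_vector_derivative (v - ((\<nu> \<bullet> v) / (\<nu> \<bullet> b)) *\<^sub>R b)) (at 0)"
proof -
  have b0: "norm b > 0" using b by auto
  define k where "k = \<bar>\<nu> \<bullet> b\<bar>"
  have k: "k > 0" using b by (simp add: k_def)
  \<comment> \<open>Chosen so that the error caused by u b is at most half of k |u| and can be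
    absorbed; the estimate \<open>uC\<close> results.\<close>
  define \<epsilon>0 where "\<epsilon>0 = k / (2 * norm b)"
  have "\<epsilon>0 > 0" using k b0 by (simp add: \<epsilon>0_def)
  then obtain r0 where r0: "r0 > 0" "\<And>x y. x \<in> M \<inter> ball p r0 \<Longrightarrow> y \<in> M \<inter> ball p r0 \<Longrightarrow>
      \<bar>\<nu> \<bullet> (x - y)\<bar> \<le> \<epsilon>0 * norm (x - y)"
    using fl unfolding flat_at_def by meson
  obtain \<eta> where \<eta>: "\<eta> > 0"
    "\<And>z. z \<in> ball p \<eta> \<Longrightarrow> \<exists>t. \<bar>t\<bar> < r0 / (2 * norm b) \<and> z + t *\<^sub>R b \<in> M"
    using cr b r0(1) b0 unfolding crossed_at_def by (metis divide_pos_pos mult_pos_pos zero_less_numeral)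
  define e where "e = min (r0 / 2) \<eta> / (norm v + 1)"
  have e: "e > 0" using r0(1) \<eta>(1) by (auto simp: e_def intro!: divide_pos_pos add_nonneg_pos)
  have tv: "\<bar>t\<bar> * norm v < r0 / 2" "\<bar>t\<bar> * norm v < \<eta>" if "\<bar>t\<bar> < e" for t
  proof -
    have "\<bar>t\<bar> * norm v \<le> \<bar>t\<bar> * (norm v + 1)" by (simp add: mult_left_mono)
    also have "\<dots> < min (r0 / 2) \<eta>" using that by (simp add: e_def pos_less_divide_eq add_nonneg_pos)
    finally show "\<bar>t\<bar> * norm v < r0 / 2" "\<bar>t\<bar> * norm v < \<eta>" by auto
  qed
  have "\<exists>u. \<bar>u\<bar> < r0 / (2 * norm b) \<and> p + t *\<^sub>R v + u *\<^sub>R b \<in> M" if "\<bar>t\<bar> < e" for t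
    using \<eta>(2)[of "p + t *\<^sub>R v"] tv[OF that] by (simp add: dist_norm)
  then obtain u' where u': "\<And>t. \<bar>t\<bar> < e \<Longrightarrow> \<bar>u' t\<bar> < r0 / (2 * norm b) \<and> p + t *\<^sub>R v + u' t *\<^sub>R b \<in> M"
    by metis
  \<comment> \<open>The choice at \<open>t = 0\<close> could pick another point of \<open>M\<close>
    on the line through \<open>p\<close>; the value 0 forces the curve through
    \<open>p\<close>.\<close>
  define u where "u t = (if t = 0 then 0 else u' t)" for t
  define \<gamma> where "\<gamma> t = p + t *\<^sub>R v + u t *\<^sub>R b" for t
  have \<gamma>M: "\<gamma> t \<in> M" if "\<bar>t\<bar> < e" for t
    using u'[OF that] p by (auto simp: \<gamma>_def u_def)
  have ub: "\<bar>u t\<bar> * norm b < r0 / 2" if "\<bar>t\<bar> < e" for t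
    using u'[OF that] b0 r0(1) by (auto simp: u_def field_simps)
  have \<gamma>_near: "norm (\<gamma> t - p) \<le> \<bar>t\<bar> * norm v + \<bar>u t\<bar> * norm b" for t
    using norm_triangle_ineq[of "t *\<^sub>R v" "u t *\<^sub>R b"] by (simp add: \<gamma>_def)
  have dot: "\<nu> \<bullet> (\<gamma> t - p) = t * (\<nu> \<bullet> v) + u t * (\<nu> \<bullet> b)" for t
    by (simp add: \<gamma>_def inner_add_right)
  define C where "C = 2 * (\<bar>\<nu> \<bullet> v\<bar> + \<epsilon>0 * norm v) / k"
  have uC: "\<bar>u t\<bar> \<le> C * \<bar>t\<bar>" if t: "\<bar>t\<bar> < e" for t
  proof -
    have "dist p (\<gamma> t) < r0" using \<gamma>_near[of t] tv[OF t] ub[OF t] by (simp add: dist_norm norm_minus_commute)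
    then have "\<bar>\<nu> \<bullet> (\<gamma> t - p)\<bar> \<le> \<epsilon>0 * norm (\<gamma> t - p)"
      using r0 \<gamma>M[OF t] p by simp
    also have "\<dots> \<le> \<epsilon>0 * (\<bar>t\<bar> * norm v + \<bar>u t\<bar> * norm b)"
      using \<gamma>_near[of t] \<open>\<epsilon>0 > 0\<close> by simp
    also have "\<dots> = \<epsilon>0 * \<bar>t\<bar> * norm v + \<bar>u t\<bar> * k / 2"
      using b0 by (simp add: \<epsilon>0_def field_simps)
    finally have "\<bar>t * (\<nu> \<bullet> v) + u t * (\<nu> \<bullet> b)\<bar> \<le> \<epsilon>0 * \<bar>t\<bar> * norm v + \<bar>u t\<bar> * k / 2"
      unfolding dot .
    moreover have "\<bar>u t\<bar> * k - \<bar>t\<bar> * \<bar>\<nu> \<bullet> v\<bar> \<le> \<bar>t * (\<nu> \<bullet> v) + u t * (\<nu> \<bullet> b)\<bar>"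
      unfolding k_def abs_mult[symmetric] by linarith
    ultimately have "\<bar>u t\<bar> * k / 2 \<le> \<bar>t\<bar> * (\<bar>\<nu> \<bullet> v\<bar> + \<epsilon>0 * norm v)"
      by (simp add: algebra_simps)
    then show ?thesis using k by (simp add: C_def field_simps)
  qed
  define w where "w = v - ((\<nu> \<bullet> v) / (\<nu> \<bullet> b)) *\<^sub>R b"
  \<comment> \<open>The final error is \<open>\<epsilon>' * \<bar>t\<bar> * (C' - 1)\<close>; the
    summand 1 keeps \<open>C'\<close> positive when \<open>v\<close> and \<open>C\<close>
    vanish.\<close>
  define C' where "C' = (norm v + C * norm b) * norm b / k + 1"
  have C0: "C \<ge> 0" using k \<open>\<epsilon>0 > 0\<close> by (simp add: C_def)
  then have C': "C' > 0" using k b0 by (simp add: C'_def add_nonneg_pos)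
  have "(\<gamma> has_vector_derivative w) (at 0)"
    unfolding has_vector_derivative_def has_derivative_at_alt
  proof (intro conjI allI impI)
    show "bounded_linear (\<lambda>x. x *\<^sub>R w)" by (rule bounded_linear_scaleR_left)
    fix \<epsilon> :: real assume \<epsilon>: "0 < \<epsilon>"
    define \<epsilon>' where "\<epsilon>' = \<epsilon> / C'"
    have "\<epsilon>' > 0" using \<epsilon> C' by (simp add: \<epsilon>'_def)
    then obtain r where r: "r > 0" "\<And>x y. x \<in> M \<inter> ball p r \<Longrightarrow> y \<in> M \<inter> ball p r \<Longrightarrow>
        \<bar>\<nu> \<bullet> (x - y)\<bar> \<le> \<epsilon>' * norm (x - y)"
      using fl unfolding flat_at_def by meson
    define K where "K = norm v + C * norm b + 1"
    have K: "K > 0" using C0 b0 by (simp add: K_def add_nonneg_pos)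
    define d where "d = min e (r / K)"
    have "d > 0" using e r(1) K by (simp add: d_def)
    moreover have "norm (\<gamma> t - \<gamma> 0 - (t - 0) *\<^sub>R w) \<le> \<epsilon> * norm (t - 0)" if "norm (t - 0) < d" for t
    proof -
      have t: "\<bar>t\<bar> < e" "\<bar>t\<bar> * K < r" using that K by (auto simp: d_def pos_less_divide_eq)
      have "\<bar>u t\<bar> * norm b \<le> C * \<bar>t\<bar> * norm b" using uC[OF t(1)] by (simp add: mult_right_mono)
      then have near: "norm (\<gamma> t - p) \<le> \<bar>t\<bar> * (norm v + C * norm b)"
        using \<gamma>_near[of t] by (simp add: algebra_simps)
      also have "\<dots> \<le> \<bar>t\<bar> * K" by (simp add: K_def mult_left_mono)
      finally have "\<gamma> t \<in> M \<inter> ball p r" using t \<gamma>M by (simp add: dist_norm norm_minus_commute)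
      then have "\<bar>\<nu> \<bullet> (\<gamma> t - p)\<bar> \<le> \<epsilon>' * norm (\<gamma> t - p)" using r p by simp
      also have "\<dots> \<le> \<epsilon>' * (\<bar>t\<bar> * (norm v + C * norm b))"
        using near \<open>\<epsilon>' > 0\<close> by simp
      finally have *: "\<bar>t * (\<nu> \<bullet> v) + u t * (\<nu> \<bullet> b)\<bar> \<le> \<epsilon>' * \<bar>t\<bar> * (norm v + C * norm b)"
        unfolding dot by simp
      \<comment> \<open>The error is exactly a multiple of \<open>b\<close>, with coefficient
        nu.(gamma(t) - p) / (nu.b), so flatness bounds it directly.\<close>
      have "\<gamma> t - \<gamma> 0 - (t - 0) *\<^sub>R w = ((t * (\<nu> \<bullet> v) + u t * (\<nu> \<bullet> b)) / (\<nu> \<bullet> b)) *\<^sub>R b"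
        using b by (simp add: \<gamma>_def w_def u_def algebra_simps add_divide_distrib)
      then have "norm (\<gamma> t - \<gamma> 0 - (t - 0) *\<^sub>R w) = \<bar>t * (\<nu> \<bullet> v) + u t * (\<nu> \<bullet> b)\<bar> / k * norm b"
        by (simp add: k_def)
      also have "\<dots> \<le> (\<epsilon>' * \<bar>t\<bar> * (norm v + C * norm b)) / k * norm b"
        using * k by (intro mult_right_mono divide_right_mono) auto
      also have "\<dots> = \<epsilon>' * \<bar>t\<bar> * (C' - 1)" by (simp add: C'_def)
      also have "\<dots> \<le> \<epsilon>' * \<bar>t\<bar> * C'" using \<open>\<epsilon>' > 0\<close> by (intro mult_left_mono) auto
      also have "\<dots> = \<epsilon> * norm (t - 0)" using C' by (simp add: \<epsilon>'_def)
      finally show ?thesis .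
    qed
    ultimately show "\<exists>d>0. \<forall>y. norm (y - 0) < d \<longrightarrow>
        norm (\<gamma> y - \<gamma> 0 - (y - 0) *\<^sub>R w) \<le> \<epsilon> * norm (y - 0)" by blast
  qed
  then show thesis
    by (intro that[of e \<gamma> u]) (use e \<gamma>M in \<open>auto simp: \<gamma>_def u_def w_def\<close>)
qed

text \<open>The given normal is only known to be orthogonal to velocities of curves. Its component
  orthogonal to the gradient \<open>D\<close> is itself such a velocity, hence has zero inner
  product with itself; so the normal is a nonzero multiple of \<open>D\<close>, and both conditions
  survive scaling.\<close>

lemma smooth_hypersurface_normal:
  fixes M :: "'a::euclidean_space set"
  assumes hyp: "smooth_hypersurface M" and p: "p \<in> M"
    and \<nu>: "norm \<nu> = 1" "\<And>v. v \<in> tangent_space M p \<Longrightarrow> \<nu> \<bullet> v = 0"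
  shows "flat_at M p \<nu>" "crossed_at M p \<nu>" "\<exists>r>0. compact (M \<inter> cball p r)"
proof -
  obtain D where D: "D \<noteq> 0" "flat_at M p D" "crossed_at M p D" "\<exists>r>0. compact (M \<inter> cball p r)"
    using smooth_hypersurface_local[OF hyp p] by blast
  show "\<exists>r>0. compact (M \<inter> cball p r)" by fact
  define k where "k = (\<nu> \<bullet> D) / (D \<bullet> D)"
  define v where "v = \<nu> - k *\<^sub>R D"
  have vD: "D \<bullet> v = 0" using D(1) by (simp add: v_def k_def inner_diff_right inner_commute)
  have "v \<in> tangent_space M p"
  proof -
    have "D \<bullet> D \<noteq> 0" using D(1) by simp
    then obtain \<gamma> u e where "0 < e" "\<gamma> 0 = p" "\<And>t. \<bar>t\<bar> < e \<Longrightarrow> \<gamma> t \<in> M"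
      "(\<gamma> has_vector_derivative (v - ((D \<bullet> v) / (D \<bullet> D)) *\<^sub>R D)) (at 0)"
      using hypersurface_curve[OF D(2,3) p, of D v] by metis
    then show ?thesis unfolding tangent_space_def
      by (intro CollectI exI[of _ \<gamma>] exI[of _ e]) (auto simp: vD dist_norm)
  qed
  then have "\<nu> \<bullet> v = 0" by (rule \<nu>(2))
  then have "v \<bullet> v = 0" using vD by (simp add: v_def inner_diff_left)
  then have \<nu>D: "\<nu> = k *\<^sub>R D" by (simp add: v_def)
  then have k: "k \<noteq> 0" using \<nu>(1) by auto
  show "flat_at M p \<nu>"
    unfolding flat_at_def
  proof (intro allI impI)
    fix \<epsilon> :: real assume "\<epsilon> > 0"
    then have "\<epsilon> / \<bar>k\<bar> > 0" using k by simp
    then obtain r where "r > 0" "\<And>x y. x \<in> M \<inter> ball p r \<Longrightarrow> y \<in> M \<inter> ball p r \<Longrightarrow>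
        \<bar>D \<bullet> (x - y)\<bar> \<le> \<epsilon> / \<bar>k\<bar> * norm (x - y)"
      using D(2) unfolding flat_at_def by meson
    then show "\<exists>r>0. \<forall>x\<in>M \<inter> ball p r. \<forall>y\<in>M \<inter> ball p r. \<bar>\<nu> \<bullet> (x - y)\<bar> \<le> \<epsilon> * norm (x - y)"
      using k by (intro exI[of _ r]) (auto simp: \<nu>D abs_mult field_simps)
  qed
  show "crossed_at M p \<nu>"
    using D(3) k unfolding crossed_at_def \<nu>D by simp
qed

section \<open>Comparison with the projection onto a hyperplane\<close>

text \<open>The admissible radius depends on eps. For each fixed eps a finite subcover is taken and
  \<open>E\<close> is split ball by ball; only afterwards does eps tend to 0.\<close>

lemma emeasure_le_of_local_le:
  fixes M1 M2 :: "'a::euclidean_space measure"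
  assumes sets: "sets M1 = sets borel" "sets M2 = sets borel" and A: "compact A"
    and loc: "\<And>\<epsilon> q. 0 < \<epsilon> \<Longrightarrow> q \<in> A \<Longrightarrow> \<exists>r>0. \<forall>E\<in>sets borel. E \<subseteq> A \<inter> ball q r \<longrightarrow>
        emeasure M1 E \<le> ennreal (1 + \<epsilon>) * emeasure M2 E"
    and E: "E \<in> sets borel" "E \<subseteq> A"
  shows "emeasure M1 E \<le> emeasure M2 E"
proof -
  have le: "emeasure M1 E \<le> ennreal (1 + \<epsilon>) * emeasure M2 E" if \<epsilon>: "0 < \<epsilon>" for \<epsilon>
  proof -
    obtain r where r: "\<And>q. q \<in> A \<Longrightarrow> 0 < r q"
      "\<And>q E. q \<in> A \<Longrightarrow> E \<in> sets borel \<Longrightarrow> E \<subseteq> A \<inter> ball q (r q) \<Longrightarrow>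
        emeasure M1 E \<le> ennreal (1 + \<epsilon>) * emeasure M2 E"
      using loc[OF \<epsilon>] by metis
    have "A \<subseteq> (\<Union>q\<in>A. ball q (r q))" using r(1) by force
    then obtain F where F: "F \<subseteq> A" "finite F" "A \<subseteq> (\<Union>q\<in>F. ball q (r q))"
      by (rule compactE_image[OF A open_ball])
    have "\<forall>E\<in>sets borel. E \<subseteq> A \<inter> (\<Union>q\<in>F. ball q (r q)) \<longrightarrow>
        emeasure M1 E \<le> ennreal (1 + \<epsilon>) * emeasure M2 E"
      using F(2,1)
    proof (induction F rule: finite_induct)
      case (insert q F)
      show ?case
      proof (intro ballI impI)
        fix E :: "'a set" assume E: "E \<in> sets borel" "E \<subseteq> A \<inter> (\<Union>q\<in>insert q F. ball q (r q))"
        let ?E1 = "E \<inter> ball q (r q)" and ?E2 = "E - ball q (r q)"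
        have split: "emeasure N E = emeasure N ?E1 + emeasure N ?E2" if "sets N = sets borel" for N
          using E(1) that plus_emeasure[of ?E1 N ?E2] by (simp add: Int_Diff_Un Int_Diff_disjoint)
        have "emeasure M1 ?E1 \<le> ennreal (1 + \<epsilon>) * emeasure M2 ?E1"
          using E insert by (intro r(2)[of q]) auto
        moreover have "emeasure M1 ?E2 \<le> ennreal (1 + \<epsilon>) * emeasure M2 ?E2"
        proof -
          have "?E2 \<in> sets borel" "?E2 \<subseteq> A \<inter> (\<Union>q\<in>F. ball q (r q))" using E by auto
          then show ?thesis using insert by blast
        qed
        ultimately show "emeasure M1 E \<le> ennreal (1 + \<epsilon>) * emeasure M2 E"
          unfolding split[OF sets(1)] split[OF sets(2)] distrib_left by (rule add_mono)
      qed
    qed (auto simp: subset_empty)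
    then show ?thesis using E F(3) by blast
  qed
  show ?thesis
  proof (cases "emeasure M2 E = \<infinity>")
    case False
    then obtain m where m: "0 \<le> m" "emeasure M2 E = ennreal m" by (metis ennreal_cases infinity_ennreal_def)
    show ?thesis
    proof (rule ennreal_le_epsilon)
      fix e :: real assume e: "0 < e"
      \<comment> \<open>The denominator \<open>m + 1\<close> also covers
        \<open>m = 0\<close>.\<close>
      define \<epsilon> where "\<epsilon> = e / (m + 1)"
      have "0 < \<epsilon>" using e m by (simp add: \<epsilon>_def)
      have "\<epsilon> * m \<le> e" using e m by (simp add: \<epsilon>_def field_simps)
      then have "ennreal ((1 + \<epsilon>) * m) \<le> ennreal (m + e)"
        by (intro ennreal_leI) (simp add: algebra_simps)
      moreover have "ennreal (1 + \<epsilon>) * emeasure M2 E = ennreal ((1 + \<epsilon>) * m)"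
        using m \<open>0 < \<epsilon>\<close> by (simp only: m(2) ennreal_mult)
      moreover have "emeasure M2 E + ennreal e = ennreal (m + e)" using m e by simp
      ultimately show "emeasure M1 E \<le> emeasure M2 E + ennreal e"
        using le[OF \<open>0 < \<epsilon>\<close>] by simp
    qed
  qed simp
qed

text \<open>From here on \<open>M\<close> enters only through flatness, crossing, local compactness
  and a continuous unit normal; the defining functions have been eliminated.\<close>

locale unit_normal_hypersurface = hausdorff_codim1 n H
  for n :: nat and H :: "'a::euclidean_space measure" +
  fixes M :: "'a set" and N :: "'a \<Rightarrow> 'a"
  assumes flat: "p \<in> M \<Longrightarrow> flat_at M p (N p)"
    and crossed: "p \<in> M \<Longrightarrow> crossed_at M p (N p)"
    and cpt: "p \<in> M \<Longrightarrow> \<exists>r>0. compact (M \<inter> cball p r)"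
    and N_cont: "continuous_on M N"
    and N_unit: "p \<in> M \<Longrightarrow> norm (N p) = 1"
begin

text \<open>By flatness, the component of x - y along \<open>b\<close> is bounded by the projection
  plus a part that can be absorbed, so the projection controls the whole difference. The sign clause
  later turns |N x . b| into a constant multiple of N x . b.\<close>

lemma chart:
  assumes p: "p \<in> M" and b: "norm b = 1" "N p \<bullet> b \<noteq> 0"
  obtains r L where "0 < r" "0 < L" "compact (M \<inter> cball p r)"
    "\<And>x. x \<in> M \<inter> cball p r \<Longrightarrow> 0 < (N x \<bullet> b) * (N p \<bullet> b)"
    "\<And>x y. x \<in> M \<inter> cball p r \<Longrightarrow> y \<in> M \<inter> cball p r \<Longrightarrow>
        norm (x - y) \<le> L * norm (proj b x - proj b y)"
proof -
  define c where "c = \<bar>N p \<bullet> b\<bar>"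
  have c: "0 < c" using b by (simp add: c_def)
  obtain r1 where r1: "0 < r1" "compact (M \<inter> cball p r1)" using cpt[OF p] by blast
  have "continuous_on M (\<lambda>x. (N x \<bullet> b) * (N p \<bullet> b))" by (intro continuous_intros N_cont)
  moreover have "0 < (N p \<bullet> b) * (N p \<bullet> b)" using b by (auto simp: zero_less_mult_iff)
  ultimately obtain r2 where r2: "0 < r2"
    "\<And>x. x \<in> M \<Longrightarrow> dist x p < r2 \<Longrightarrow> dist ((N x \<bullet> b) * (N p \<bullet> b)) ((N p \<bullet> b) * (N p \<bullet> b)) < (N p \<bullet> b) * (N p \<bullet> b)"
    using p unfolding continuous_on_iff by meson
  obtain r3 where r3: "0 < r3" "\<And>x y. x \<in> M \<inter> ball p r3 \<Longrightarrow> y \<in> M \<inter> ball p r3 \<Longrightarrow>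
      \<bar>N p \<bullet> (x - y)\<bar> \<le> c / 2 * norm (x - y)"
    using flat[OF p] c unfolding flat_at_def by (metis half_gt_zero)
  \<comment> \<open>Halving \<open>r2\<close> and \<open>r3\<close> passes from open balls to a
    closed one.\<close>
  define r where "r = min r1 (min (r2 / 2) (r3 / 2))"
  have r: "0 < r" "r \<le> r1" "r < r2" "r < r3" using r1(1) r2(1) r3(1) by (auto simp: r_def)
  \<comment> \<open>The 1 accounts for the projection itself and the fraction for the component
    along \<open>b\<close>, which is bounded by that multiple of the projection.\<close>
  define L where "L = 1 + (1 + c / 2) / (c / 2)"
  have L: "0 < L" using c by (simp add: L_def add_pos_pos)
  show thesis
  proof (rule that[OF r(1) L])
    have "M \<inter> cball p r = (M \<inter> cball p r1) \<inter> cball p r" using r by auto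
    then show "compact (M \<inter> cball p r)" using r1(2) by (metis compact_Int_closed closed_cball)
    show "0 < (N x \<bullet> b) * (N p \<bullet> b)" if "x \<in> M \<inter> cball p r" for x
      using r2(2)[of x] that r by (auto simp: dist_commute dist_real_def)
    show "norm (x - y) \<le> L * norm (proj b x - proj b y)"
      if "x \<in> M \<inter> cball p r" "y \<in> M \<inter> cball p r" for x y
    proof -
      define z where "z = x - y"
      have dec: "z = proj b z + (z \<bullet> b) *\<^sub>R b" by (simp add: proj_def)
      have nz: "norm z \<le> norm (proj b z) + \<bar>z \<bullet> b\<bar>"
        by (subst dec) (use norm_triangle_ineq[of "proj b z" "(z \<bullet> b) *\<^sub>R b"] b in simp)
      have "N p \<bullet> z = N p \<bullet> proj b z + (z \<bullet> b) * (N p \<bullet> b)"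
        by (subst dec) (simp add: inner_add_right)
      then have "\<bar>z \<bullet> b\<bar> * c \<le> \<bar>N p \<bullet> z\<bar> + \<bar>N p \<bullet> proj b z\<bar>"
        unfolding c_def abs_mult[symmetric] by linarith
      also have "\<dots> \<le> c / 2 * norm z + norm (proj b z)"
        using r3(2)[of x y] that r Cauchy_Schwarz_ineq2[of "N p" "proj b z"] N_unit[OF p]
        by (intro add_mono) (auto simp: z_def)
      also have "\<dots> \<le> c / 2 * (norm (proj b z) + \<bar>z \<bullet> b\<bar>) + norm (proj b z)"
        using nz c by (intro add_mono mult_left_mono) auto
      finally have "\<bar>z \<bullet> b\<bar> * (c / 2) \<le> (1 + c / 2) * norm (proj b z)"
        by (simp add: algebra_simps)
      then have "\<bar>z \<bullet> b\<bar> \<le> (1 + c / 2) / (c / 2) * norm (proj b z)"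
        using c by (simp add: field_simps)
      then show ?thesis using nz by (simp add: L_def z_def[symmetric] proj_diff[symmetric] algebra_simps)
    qed
  qed
qed

text \<open>Projecting and rescaling by 1/s sends the piece of radius \<open>s\<close> into one
  fixed unit disc of the hyperplane, and this map has an inverse with Lipschitz constant
  \<open>L * s\<close>. The rate s^n is what makes the singular weight integrable at the
  origin.\<close>

lemma hausdorff_growth:
  assumes p: "p \<in> M"
  shows "\<exists>r>0. \<exists>C\<ge>0. compact (M \<inter> cball p r) \<and>
    (\<forall>s. 0 < s \<longrightarrow> s \<le> r \<longrightarrow> emeasure H (M \<inter> cball p s) \<le> ennreal (C * s ^ n))"
proof -
  define b where "b = N p"
  have b: "norm b = 1" "N p \<bullet> b \<noteq> 0" using N_unit[OF p] by (auto simp: b_def norm_eq_1)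
  obtain r L where r: "0 < r" "0 < L" "compact (M \<inter> cball p r)"
    and lip: "\<And>x y. x \<in> M \<inter> cball p r \<Longrightarrow> y \<in> M \<inter> cball p r \<Longrightarrow>
        norm (x - y) \<le> L * norm (proj b x - proj b y)"
    using chart[OF p b] by metis
  define P where "P = plane b \<inter> cball 0 1"
  have "emeasure H P < \<infinity>"
    using b(1) unfolding P_def by (intro emeasure_plane_bounded[of b]) (auto intro: bounded_Int)
  then obtain C0 where C0: "0 \<le> C0" "emeasure H P = ennreal C0"
    by (metis ennreal_cases infinity_ennreal_def less_irrefl)
  have growth: "emeasure H (M \<inter> cball p s) \<le> ennreal (L ^ n * C0 * s ^ n)" if s: "0 < s" "s \<le> r" for s
  proof -
    let ?A = "M \<inter> cball p s" and ?g = "\<lambda>x. (1 / s) *\<^sub>R proj b (x - p)"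
    have "?A = (M \<inter> cball p r) \<inter> cball p s" using s by auto
    then have "?A \<in> sets borel" using r(3) by (metis compact_Int_closed closed_cball borel_compact)
    then have "emeasure H ?A = hausdorff_outer n ((\<lambda>x. x) ` ?A)" by (simp add: emeasure_H)
    also have "\<dots> \<le> ennreal ((L * s) ^ n) * hausdorff_outer n (?g ` ?A)"
    proof (rule hausdorff_outer_image_le)
      fix x y assume "x \<in> ?A" "y \<in> ?A"
      then have "norm (x - y) \<le> L * norm (proj b x - proj b y)" using s by (intro lip) auto
      moreover have "?g x - ?g y = (1 / s) *\<^sub>R (proj b x - proj b y)"
        by (simp add: proj_diff scaleR_diff_right)
      ultimately show "norm (x - y) \<le> L * s * norm (?g x - ?g y)" using s by simp
    qed (use r s in simp)
    finally have 1: "emeasure H ?A \<le> ennreal ((L * s) ^ n) * hausdorff_outer n (?g ` ?A)" .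
    have "?g ` ?A \<subseteq> P"
    proof safe
      fix x assume "x \<in> cball p s"
      then have "norm (proj b (x - p)) \<le> s"
        using norm_proj_le[OF b(1), of "x - p"] by (simp add: dist_norm norm_minus_commute)
      then show "?g x \<in> P" using s proj_in_plane[OF b(1), of "x - p"] by (auto simp: P_def plane_def)
    qed
    then have "hausdorff_outer n (?g ` ?A) \<le> hausdorff_outer n P" by (rule hausdorff_outer_mono)
    also have "hausdorff_outer n P = ennreal C0" using C0(2) by (simp add: emeasure_H P_def)
    finally have "emeasure H ?A \<le> ennreal ((L * s) ^ n) * ennreal C0"
      using 1 by (meson mult_left_mono order_trans zero_le)
    also have "\<dots> = ennreal ((L * s) ^ n * C0)" using r s C0 by (simp add: ennreal_mult)
    finally show "emeasure H ?A \<le> ennreal (L ^ n * C0 * s ^ n)"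
      by (simp add: power_mult_distrib ac_simps)
  qed
  show ?thesis
    by (rule exI[of _ r], rule conjI[OF r(1)], rule exI[of _ "L ^ n * C0"]) (use r C0 growth in auto)
qed

lemma emeasure_compact:
  assumes K: "compact K" "K \<subseteq> M"
  shows "emeasure H K < \<infinity>"
proof -
  have "\<exists>r>0. compact (M \<inter> cball p r) \<and> emeasure H (M \<inter> cball p r) < \<infinity>" if "p \<in> K" for p
  proof -
    have "p \<in> M" using K(2) that by blast
    then obtain r C where r: "0 < r" "0 \<le> C" "compact (M \<inter> cball p r)"
      "\<And>s. 0 < s \<Longrightarrow> s \<le> r \<Longrightarrow> emeasure H (M \<inter> cball p s) \<le> ennreal (C * s ^ n)"
      using hausdorff_growth by blast
    have "emeasure H (M \<inter> cball p r) < \<infinity>"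
      by (rule le_less_trans[OF r(4)[OF r(1) order_refl]]) simp
    then show ?thesis using r(1,3) by blast
  qed
  then obtain r where r: "\<And>p. p \<in> K \<Longrightarrow> 0 < r p" "\<And>p. p \<in> K \<Longrightarrow> compact (M \<inter> cball p (r p))"
    "\<And>p. p \<in> K \<Longrightarrow> emeasure H (M \<inter> cball p (r p)) < \<infinity>" by metis
  have "K \<subseteq> (\<Union>p\<in>K. ball p (r p))" using r(1) by force
  then obtain F where F: "F \<subseteq> K" "finite F" "K \<subseteq> (\<Union>p\<in>F. ball p (r p))"
    by (rule compactE_image[OF K(1) open_ball])
  have "emeasure H K \<le> emeasure H (\<Union>p\<in>F. M \<inter> cball p (r p))"
  proof (rule emeasure_mono)
    show "K \<subseteq> (\<Union>p\<in>F. M \<inter> cball p (r p))"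
    proof
      fix x assume "x \<in> K"
      then obtain p where "p \<in> F" "x \<in> ball p (r p)" "x \<in> M" using F(3) K(2) by blast
      then show "x \<in> (\<Union>p\<in>F. M \<inter> cball p (r p))" by (intro UN_I[of p]) auto
    qed
    have "M \<inter> cball p (r p) \<in> sets borel" if "p \<in> F" for p
      using that F(1) r(2) by (blast intro: borel_compact)
    then show "(\<Union>p\<in>F. M \<inter> cball p (r p)) \<in> sets H"
      unfolding sets_H using F(2) by (intro sets.finite_UN)
  qed
  also have "\<dots> \<le> (\<Sum>p\<in>F. emeasure H (M \<inter> cball p (r p)))"
  proof (rule emeasure_subadditive_finite[OF F(2)])
    show "(\<lambda>p. M \<inter> cball p (r p)) ` F \<subseteq> sets H"
      using F(1) r(2) by (intro image_subsetI) (simp add: borel_compact subset_iff)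
  qed
  also have "\<dots> < \<infinity>"
  proof -
    have "emeasure H (M \<inter> cball p (r p)) < top" if "p \<in> F" for p using that F(1) r(3)[of p] by auto
    then show ?thesis using F(2) by simp
  qed
  finally show ?thesis .
qed

section \<open>Area formula for the projection of a compact piece\<close>

context
  fixes b :: 'a and A :: "'a set" and L :: real
  assumes b: "norm b = 1" and A: "compact A" "A \<subseteq> M"
    and Nb: "\<And>x. x \<in> A \<Longrightarrow> N x \<bullet> b \<noteq> 0"
    and lip: "\<And>x y. x \<in> A \<Longrightarrow> y \<in> A \<Longrightarrow> norm (x - y) \<le> L * norm (proj b x - proj b y)"
begin

lemma chart_inj: "inj_on (proj b) A"
  using lip by (force simp: inj_on_def)

lemma chart_compact: "compact (proj b ` A)"
  using A by (intro compact_continuous_image continuous_intros)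

lemma chart_inverse_continuous: "continuous_on (proj b ` A) (inv_into A (proj b))"
proof -
  define L' where "L' = max L 0"
  have "norm (x - y) \<le> L' * norm (proj b x - proj b y)" if "x \<in> A" "y \<in> A" for x y
    using lip[OF that] mult_right_mono[of L L' "norm (proj b x - proj b y)"] by (auto simp: L'_def)
  then have "L'-lipschitz_on (proj b ` A) (inv_into A (proj b))"
    by (intro lipschitz_onI) (auto simp: dist_norm L'_def chart_inj)
  then show ?thesis by (rule lipschitz_on_continuous_on)
qed

text \<open>The value 0 off the compact image makes the inverse a Borel map on the whole
  space.\<close>

definition chart_inverse :: "'a \<Rightarrow> 'a" where
  "chart_inverse y = (if y \<in> proj b ` A then inv_into A (proj b) y else 0)"

lemma chart_inverse_measurable [measurable]: "chart_inverse \<in> borel_measurable borel"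
  unfolding chart_inverse_def[abs_def]
  using chart_compact chart_inverse_continuous
  by (intro borel_measurable_continuous_on_if) (auto intro: borel_compact)

lemma chart_image_eq: "proj b ` (A \<inter> E) = proj b ` A \<inter> chart_inverse -` E"
proof (intro equalityI subsetI)
  fix y assume "y \<in> proj b ` A \<inter> chart_inverse -` E"
  then obtain x where x: "x \<in> A" "y = proj b x" "chart_inverse y \<in> E" by blast
  then have "chart_inverse y = x" by (simp add: chart_inverse_def chart_inj)
  then show "y \<in> proj b ` (A \<inter> E)" using x by simp
next
  fix y assume "y \<in> proj b ` (A \<inter> E)"
  then obtain x where x: "x \<in> A" "x \<in> E" "y = proj b x" by blast
  then have "chart_inverse y = x" by (simp add: chart_inverse_def chart_inj)
  then show "y \<in> proj b ` A \<inter> chart_inverse -` E" using x by simp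
qed

lemma chart_image_borel:
  assumes "E \<in> sets borel" shows "proj b ` (A \<inter> E) \<in> sets borel"
  unfolding chart_image_eq
  using measurable_sets_borel[OF chart_inverse_measurable assms] chart_compact
  by (auto intro: borel_compact)

lemma normal_comp_measurable [measurable]:
  "(\<lambda>x. indicator A x * \<bar>N x \<bullet> b\<bar> :: real) \<in> borel_measurable borel"
proof -
  have "(\<lambda>x. indicator A x *\<^sub>R \<bar>N x \<bullet> b\<bar>) \<in> borel_measurable borel"
    by (rule borel_measurable_continuous_on_indicator)
      (auto intro!: borel_compact A continuous_intros continuous_on_subset[OF N_cont])
  then show ?thesis by simp
qed

text \<open>The area formula is proved as an equality of two measures concentrated on
  \<open>A\<close>: \<open>weighted\<close> has the density of the projection, and
  \<open>lifted\<close> is the measure on the projected image transported back.\<close>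

definition "weighted = density H (\<lambda>x. ennreal (indicator A x * \<bar>N x \<bullet> b\<bar>))"

definition "lifted = distr (density H (indicator (proj b ` A))) borel chart_inverse"

lemma sets_weighted [simp, measurable_cong]: "sets weighted = sets borel"
  by (simp add: weighted_def)

lemma sets_lifted [simp, measurable_cong]: "sets lifted = sets borel"
  by (simp add: lifted_def)

lemma A_borel [measurable]: "A \<in> sets borel" using A by (rule_tac borel_compact)

lemma PA_borel [measurable]: "proj b ` A \<in> sets borel" using chart_compact by (rule borel_compact)

lemma emeasure_lifted: "E \<in> sets borel \<Longrightarrow> emeasure lifted E = emeasure H (proj b ` (A \<inter> E))"
  unfolding lifted_def chart_image_eq
  using measurable_sets_borel[OF chart_inverse_measurable, of E]
  by (subst emeasure_distr) (auto intro!: emeasure_restricted)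

lemma emeasure_weighted:
  "E \<in> sets borel \<Longrightarrow> emeasure weighted E = (\<integral>\<^sup>+x. ennreal (indicator A x * \<bar>N x \<bullet> b\<bar>) * indicator E x \<partial>H)"
  unfolding weighted_def by (rule emeasure_density) auto

lemma weighted_bounds:
  assumes E: "E \<in> sets borel" "E \<subseteq> A" and k: "0 \<le> k1" "\<And>x. x \<in> E \<Longrightarrow> k1 \<le> \<bar>N x \<bullet> b\<bar>" "\<And>x. x \<in> E \<Longrightarrow> \<bar>N x \<bullet> b\<bar> \<le> k2"
  shows "ennreal k1 * emeasure H E \<le> emeasure weighted E" "emeasure weighted E \<le> ennreal k2 * emeasure H E"
proof -
  have "ennreal k1 * emeasure H E = (\<integral>\<^sup>+x. ennreal k1 * indicator E x \<partial>H)"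
    using E(1) by (simp add: nn_integral_cmult_indicator)
  also have "\<dots> \<le> emeasure weighted E"
    unfolding emeasure_weighted[OF E(1)] using E k
    by (intro nn_integral_mono) (auto simp: indicator_def intro!: ennreal_leI)
  finally show "ennreal k1 * emeasure H E \<le> emeasure weighted E" .
  have "emeasure weighted E \<le> (\<integral>\<^sup>+x. ennreal k2 * indicator E x \<partial>H)"
    unfolding emeasure_weighted[OF E(1)] using E k
    by (intro nn_integral_mono) (auto simp: indicator_def intro!: ennreal_leI)
  also have "\<dots> = ennreal k2 * emeasure H E"
    using E(1) by (simp add: nn_integral_cmult_indicator)
  finally show "emeasure weighted E \<le> ennreal k2 * emeasure H E" .
qed

text \<open>Near \<open>q\<close> both measures are almost \<open>c\<close> times \<open>H\<close>:
  \<open>lifted\<close> by the nearly flat comparison, \<open>weighted\<close> by continuity of the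
  normal.\<close>

lemma weighted_lifted_local:
  assumes q: "q \<in> A" and \<epsilon>: "0 < \<epsilon>"
  shows "\<exists>r>0. \<forall>E\<in>sets borel. E \<subseteq> A \<inter> ball q r \<longrightarrow>
      emeasure weighted E \<le> ennreal (1 + \<epsilon>) * emeasure lifted E"
    and "\<exists>r>0. \<forall>E\<in>sets borel. E \<subseteq> A \<inter> ball q r \<longrightarrow>
      emeasure lifted E \<le> ennreal (1 + \<epsilon>) * emeasure weighted E"
proof -
  define c where "c = \<bar>N q \<bullet> b\<bar>"
  have c: "0 < c" using Nb[OF q] by (simp add: c_def)
  have qM: "q \<in> M" using q A by auto
  \<comment> \<open>Both differences tend to eps > 0 as \<open>s\<close> tends to 0, which yields an
    \<open>s\<close> whose combined distortions cost at most \<open>1 + \<epsilon>\<close>.\<close>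
  have lim: "((\<lambda>s. (1 + \<epsilon>) * (1 - s) - (1 + s) ^ n) \<longlongrightarrow> (1 + \<epsilon>) * (1 - 0) - (1 + 0) ^ n) (at_right (0::real))"
    "((\<lambda>s. (1 + \<epsilon>) * (1 - s) ^ n - (1 + s)) \<longlongrightarrow> (1 + \<epsilon>) * (1 - 0) ^ n - (1 + 0)) (at_right (0::real))"
    by (intro tendsto_intros)+
  then have "\<forall>\<^sub>F s in at_right (0::real). 0 < (1 + \<epsilon>) * (1 - s) - (1 + s) ^ n"
    "\<forall>\<^sub>F s in at_right (0::real). 0 < (1 + \<epsilon>) * (1 - s) ^ n - (1 + s)"
    using order_tendstoD(1)[OF lim(1), of 0] order_tendstoD(1)[OF lim(2), of 0] \<epsilon> by simp_all
  moreover have "\<forall>\<^sub>F s in at_right (0::real). s \<in> {0<..<1}" by (rule eventually_at_right_real) simp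
  ultimately have "\<forall>\<^sub>F s in at_right (0::real). 0 < s \<and> s < 1 \<and> (1 + s) ^ n \<le> (1 + \<epsilon>) * (1 - s) \<and>
      (1 + s) \<le> (1 + \<epsilon>) * (1 - s) ^ n" by eventually_elim auto
  then obtain s where s: "0 < s" "s < 1" "(1 + s) ^ n \<le> (1 + \<epsilon>) * (1 - s)" "(1 + s) \<le> (1 + \<epsilon>) * (1 - s) ^ n"
    using eventually_happens'[OF trivial_limit_at_right_real] by blast
  \<comment> \<open>The tolerance \<open>s * c\<close> makes the quotient \<open>q\<close> of
    \<open>hausdorff_outer_proj_nearly_flat\<close> equal to \<open>s\<close>, and it is also the
    tolerance for |N x . b|.\<close>
  have sc0: "0 < s * c" using s(1) c by simp
  obtain r1 where r1: "0 < r1" "\<And>x y. x \<in> M \<inter> ball q r1 \<Longrightarrow> y \<in> M \<inter> ball q r1 \<Longrightarrow>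
      \<bar>N q \<bullet> (x - y)\<bar> \<le> s * c * norm (x - y)"
    using flat[OF qM] sc0 unfolding flat_at_def by meson
  have "continuous_on M (\<lambda>x. \<bar>N x \<bullet> b\<bar>)" by (intro continuous_intros N_cont)
  then obtain r2 where r2: "0 < r2" "\<And>x. x \<in> M \<Longrightarrow> dist x q < r2 \<Longrightarrow> dist \<bar>N x \<bullet> b\<bar> c < s * c"
    using qM sc0 unfolding continuous_on_iff c_def[symmetric] by (metis c_def)
  define r where "r = min r1 r2"
  have r: "0 < r" using r1 r2 by (simp add: r_def)
  have main: "emeasure weighted E \<le> ennreal (1 + \<epsilon>) * emeasure lifted E"
    "emeasure lifted E \<le> ennreal (1 + \<epsilon>) * emeasure weighted E"
    if E: "E \<in> sets borel" "E \<subseteq> A \<inter> ball q r" for E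
  proof -
    have AE: "A \<inter> E = E" using E by auto
    have PE: "proj b ` E \<in> sets borel" using chart_image_borel[OF E(1)] AE by simp
    have lifted: "emeasure lifted E = hausdorff_outer n (proj b ` E)"
      using emeasure_lifted[OF E(1)] PE by (simp add: AE emeasure_H)
    have fl: "\<bar>N q \<bullet> (x - y)\<bar> \<le> s * c * norm (x - y)" if "x \<in> E" "y \<in> E" for x y
      using that E A by (intro r1(2)) (auto simp: r_def)
    have sc: "0 \<le> s * c" "s * c < \<bar>N q \<bullet> b\<bar>" "s * c / \<bar>N q \<bullet> b\<bar> = s" using s c by (auto simp: c_def)
    have "hausdorff_outer n (proj b ` E) \<le> ennreal (\<bar>N q \<bullet> b\<bar> * (1 + s * c / \<bar>N q \<bullet> b\<bar>) ^ n) * hausdorff_outer n E"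
      by (rule hausdorff_outer_proj_nearly_flat(1)[OF b N_unit[OF qM] sc(1,2) _ PE]) (rule fl)
    moreover have "ennreal (\<bar>N q \<bullet> b\<bar> * (1 - s * c / \<bar>N q \<bullet> b\<bar>) ^ n) * hausdorff_outer n E
        \<le> hausdorff_outer n (proj b ` E)"
      by (rule hausdorff_outer_proj_nearly_flat(2)[OF b N_unit[OF qM] sc(1,2) _ PE]) (rule fl)
    ultimately have flatE: "emeasure lifted E \<le> ennreal (c * (1 + s) ^ n) * emeasure H E"
      "ennreal (c * (1 - s) ^ n) * emeasure H E \<le> emeasure lifted E"
      unfolding sc(3) lifted emeasure_H[OF E(1)] by (simp_all only: c_def)
    have near: "(1 - s) * c \<le> \<bar>N x \<bullet> b\<bar>" "\<bar>N x \<bullet> b\<bar> \<le> (1 + s) * c" if "x \<in> E" for x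
    proof -
      have "dist \<bar>N x \<bullet> b\<bar> c < s * c" using that E A by (intro r2(2)) (auto simp: r_def dist_commute)
      then show "(1 - s) * c \<le> \<bar>N x \<bullet> b\<bar>" "\<bar>N x \<bullet> b\<bar> \<le> (1 + s) * c"
        unfolding dist_real_def abs_less_iff by (simp_all add: algebra_simps)
    qed
    have "0 \<le> (1 - s) * c" using s c by simp
    have EA: "E \<subseteq> A" using E by auto
    have wE: "ennreal ((1 - s) * c) * emeasure H E \<le> emeasure weighted E"
      "emeasure weighted E \<le> ennreal ((1 + s) * c) * emeasure H E"
      by (rule weighted_bounds[OF E(1) EA \<open>0 \<le> (1 - s) * c\<close> near]; assumption)+
    have "emeasure weighted E \<le> ennreal ((1 + s) * c) * emeasure H E" by (rule wE(2))
    also have "\<dots> \<le> ennreal ((1 + \<epsilon>) * (c * (1 - s) ^ n)) * emeasure H E"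
      using mult_right_mono[OF s(4), of c] c by (intro mult_right_mono ennreal_leI) (auto simp: ac_simps)
    also have "\<dots> = ennreal (1 + \<epsilon>) * (ennreal (c * (1 - s) ^ n) * emeasure H E)"
      using \<epsilon> c s by (simp add: ennreal_mult mult.assoc)
    also have "\<dots> \<le> ennreal (1 + \<epsilon>) * emeasure lifted E"
      by (intro mult_left_mono flatE(2)) simp
    finally show "emeasure weighted E \<le> ennreal (1 + \<epsilon>) * emeasure lifted E" .
    have "emeasure lifted E \<le> ennreal (c * (1 + s) ^ n) * emeasure H E" by (rule flatE(1))
    also have "\<dots> \<le> ennreal ((1 + \<epsilon>) * ((1 - s) * c)) * emeasure H E"
      using mult_right_mono[OF s(3), of c] c by (intro mult_right_mono ennreal_leI) (auto simp: ac_simps)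
    also have "\<dots> = ennreal (1 + \<epsilon>) * (ennreal ((1 - s) * c) * emeasure H E)"
      using \<epsilon> c s by (simp add: ennreal_mult mult.assoc)
    also have "\<dots> \<le> ennreal (1 + \<epsilon>) * emeasure weighted E"
      by (intro mult_left_mono wE(1)) simp
    finally show "emeasure lifted E \<le> ennreal (1 + \<epsilon>) * emeasure weighted E" .
  qed
  show "\<exists>r>0. \<forall>E\<in>sets borel. E \<subseteq> A \<inter> ball q r \<longrightarrow>
      emeasure weighted E \<le> ennreal (1 + \<epsilon>) * emeasure lifted E"
    by (intro exI[of _ r] conjI[OF r] ballI impI main(1))
  show "\<exists>r>0. \<forall>E\<in>sets borel. E \<subseteq> A \<inter> ball q r \<longrightarrow>
      emeasure lifted E \<le> ennreal (1 + \<epsilon>) * emeasure weighted E"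
    by (intro exI[of _ r] conjI[OF r] ballI impI main(2))
qed

text \<open>The local comparisons hold in both directions with factors tending to 1, so compactness
  of \<open>A\<close> upgrades them to equality on Borel subsets of \<open>A\<close>, and neither
  measure charges the complement.\<close>

lemma weighted_eq_lifted: "weighted = lifted"
proof (rule measure_eqI)
  fix E assume "E \<in> sets weighted"
  then have E [measurable]: "E \<in> sets borel" by simp
  have "emeasure weighted E = emeasure weighted (A \<inter> E)"
    by (simp add: emeasure_weighted indicator_inter_arith[of A E])
      (rule nn_integral_cong, auto simp: indicator_def)
  also have "\<dots> = emeasure lifted (A \<inter> E)"
  proof (rule antisym)
    have AE: "A \<inter> E \<in> sets borel" "A \<inter> E \<subseteq> A" by auto
    show "emeasure weighted (A \<inter> E) \<le> emeasure lifted (A \<inter> E)"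
      by (rule emeasure_le_of_local_le[OF sets_weighted sets_lifted A(1) weighted_lifted_local(1) AE])
    show "emeasure lifted (A \<inter> E) \<le> emeasure weighted (A \<inter> E)"
      by (rule emeasure_le_of_local_le[OF sets_lifted sets_weighted A(1) weighted_lifted_local(2) AE])
  qed
  also have "\<dots> = emeasure lifted E" by (simp add: emeasure_lifted)
  finally show "emeasure weighted E = emeasure lifted E" .
qed simp

lemma area_formula:
  fixes f :: "'a \<Rightarrow> real"
  assumes f [measurable]: "f \<in> borel_measurable borel"
  shows "(LINT x|H. (indicator A x * \<bar>N x \<bullet> b\<bar>) * f x) =
    (LINT y|H. indicator (proj b ` A) y * f (inv_into A (proj b) y))"
proof -
  have "(LINT x|H. (indicator A x * \<bar>N x \<bullet> b\<bar>) * f x) = (LINT x|weighted. f x)"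
    unfolding weighted_def by (subst integral_density) auto
  also have "\<dots> = (LINT y|density H (\<lambda>y. ennreal (indicator (proj b ` A) y)). f (chart_inverse y))"
    unfolding weighted_eq_lifted lifted_def
    by (subst integral_distr) (auto simp: ennreal_indicator)
  also have "\<dots> = (LINT y|H. indicator (proj b ` A) y * f (chart_inverse y))"
    by (subst integral_density) auto
  also have "\<dots> = (LINT y|H. indicator (proj b ` A) y * f (inv_into A (proj b) y))"
    by (rule Bochner_Integration.integral_cong) (auto simp: chart_inverse_def indicator_def)
  finally show ?thesis .
qed

end

end

section \<open>Stokes formula for the tangential rotation fields\<close>

text \<open>Every difference quotient along \<open>v\<close> integrates to 0 by translation
  invariance, and dominated convergence passes to the derivative. This way of integrating by parts
  uses one direction at a time and no coordinates on the hyperplane.\<close>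

lemma (in hausdorff_codim1) integral_directional_derivative:
  fixes f f' :: "'a \<Rightarrow> real"
  assumes b: "b \<noteq> 0" and v: "v \<in> plane b"
    and [measurable]: "f \<in> borel_measurable borel" "f' \<in> borel_measurable borel"
    and der: "\<And>y. ((\<lambda>t. f (y + t *\<^sub>R v)) has_real_derivative f' y) (at 0)"
    and B: "\<And>y. \<bar>f' y\<bar> \<le> B" and C: "\<And>y. \<bar>f y\<bar> \<le> C"
    and supp: "\<And>y. y \<in> plane b \<Longrightarrow> R < norm y \<Longrightarrow> f y = 0"
  shows "(LINT y|HP b. f' y) = 0"
proof -
  \<comment> \<open>The shifts are by at most \<open>norm v\<close>, so on the hyperplane all
    difference quotients are supported in one ball.\<close>
  define R' where "R' = R + norm v"
  define s where "s k y = (f (y + (1 / real (Suc k)) *\<^sub>R v) - f y) * real (Suc k)" for k y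
  have [measurable]: "s k \<in> borel_measurable borel" for k unfolding s_def by measurable
  have fin: "emeasure (HP b) (cball 0 r) < \<infinity>" for r
    by (rule emeasure_HP_bounded[OF b]) auto
  have int_f: "integrable (HP b) f"
  proof (rule integrableI_bounded_set[where A = "cball 0 R" and B = C])
    show "AE x in HP b. x \<notin> cball 0 R \<longrightarrow> f x = 0"
      using AE_HP[of b] by eventually_elim (auto intro: supp)
  qed (use C fin in auto)
  have int_shift: "integrable (HP b) (\<lambda>y. f (y + w))" "(LINT y|HP b. f (y + w)) = (LINT y|HP b. f y)"
    if w: "w \<in> plane b" for w
  proof -
    have "integrable (distr (HP b) borel (\<lambda>y. y + w)) f" unfolding HP_translation[OF w] by (rule int_f)
    then show "integrable (HP b) (\<lambda>y. f (y + w))" by (subst (asm) integrable_distr_eq) auto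
    have "(LINT y|HP b. f (y + w)) = (LINT y|distr (HP b) borel (\<lambda>y. y + w). f y)"
      by (subst integral_distr) auto
    then show "(LINT y|HP b. f (y + w)) = (LINT y|HP b. f y)" unfolding HP_translation[OF w] .
  qed
  have vk: "(1 / real (Suc k)) *\<^sub>R v \<in> plane b" for k
    using v by (simp add: plane_def)
  have int0: "(LINT y|HP b. s k y) = 0" for k
    unfolding s_def using int_shift[OF vk[of k]] int_f by simp
  \<comment> \<open>The derivative hypothesis holds at every base point, hence along the whole line,
    and the mean value inequality gives the dominating constant.\<close>
  have lip: "\<bar>f (y + t *\<^sub>R v) - f y\<bar> \<le> B * \<bar>t\<bar>" for y t
  proof -
    have "((\<lambda>t. f (y + t *\<^sub>R v)) has_real_derivative f' (y + r *\<^sub>R v)) (at r)" for r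
    proof -
      have "((\<lambda>t. f (y + (t + r) *\<^sub>R v)) has_real_derivative f' (y + r *\<^sub>R v)) (at 0)"
        using der[of "y + r *\<^sub>R v"] by (simp add: algebra_simps)
      then show ?thesis using DERIV_shift[of "\<lambda>t. f (y + t *\<^sub>R v)" "f' (y + r *\<^sub>R v)" 0 r] by simp
    qed
    then have "norm (f (y + t *\<^sub>R v) - f (y + 0 *\<^sub>R v)) \<le> B * norm (t - 0)"
      by (intro field_differentiable_bound[of UNIV "\<lambda>t. f (y + t *\<^sub>R v)" "\<lambda>r. f' (y + r *\<^sub>R v)"])
         (auto simp: B)
    then show ?thesis by simp
  qed
  have "(\<lambda>k. LINT y|HP b. s k y) \<longlonglongrightarrow> (LINT y|HP b. f' y)"
  proof (rule integral_dominated_convergence[where w = "\<lambda>y. B * indicator (cball 0 R') y"])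
    show "integrable (HP b) (\<lambda>y. B * indicator (cball 0 R') y)"
      using fin by (intro integrable_mult_right integrable_real_indicator) auto
    show "AE y in HP b. (\<lambda>k. s k y) \<longlonglongrightarrow> f' y"
    proof (rule AE_I2)
      fix y
      have "((\<lambda>h. (f (y + h *\<^sub>R v) - f y) / h) \<longlongrightarrow> f' y) (at 0)"
        using der[of y] by (simp add: DERIV_def)
      moreover have "filterlim (\<lambda>k. 1 / real (Suc k)) (at 0) sequentially"
        unfolding filterlim_at using LIMSEQ_inverse_real_of_nat by (auto simp: inverse_eq_divide)
      ultimately have "(\<lambda>k. (f (y + (1 / real (Suc k)) *\<^sub>R v) - f y) / (1 / real (Suc k))) \<longlonglongrightarrow> f' y"
        by (rule filterlim_compose)
      then show "(\<lambda>k. s k y) \<longlonglongrightarrow> f' y" by (simp add: s_def)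
    qed
    show "AE y in HP b. norm (s k y) \<le> B * indicator (cball 0 R') y" for k
      using AE_HP[of b]
    proof eventually_elim
      case (elim y)
      show ?case
      proof (cases "norm y \<le> R'")
        case True
        have "norm (s k y) = \<bar>f (y + (1 / real (Suc k)) *\<^sub>R v) - f y\<bar> * real (Suc k)"
          by (simp add: s_def abs_mult)
        also have "\<dots> \<le> B * \<bar>1 / real (Suc k)\<bar> * real (Suc k)" by (intro mult_right_mono lip) simp
        finally show ?thesis using True by simp
      next
        case False
        let ?w = "(1 / real (Suc k)) *\<^sub>R v"
        have "norm ?w \<le> norm v" by (simp add: divide_le_eq mult_le_cancel_left1)
        then have Rw: "R < norm (y + ?w)"
          using False norm_triangle_ineq2[of "y + ?w" "?w"] norm_triangle_ineq2[of y "- ?w"] by (simp add: R'_def)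
        have "y + ?w \<in> plane b"
          using elim vk[of k] by (intro subspace_add[OF subspace_plane])
        then have 1: "f (y + ?w) = 0" using Rw by (rule supp)
        have "R < norm y" using False norm_ge_zero[of v] unfolding R'_def by linarith
        then have 2: "f y = 0" by (rule supp[OF elim])
        have "s k y = 0" unfolding s_def 1 2 by simp
        then show ?thesis using False by simp
      qed
    qed
  qed auto
  then show ?thesis unfolding int0 by (simp add: LIMSEQ_const_iff)
qed

lemma isCont_eventually_mem:
  "isCont g a \<Longrightarrow> open S \<Longrightarrow> g a \<in> S \<Longrightarrow> \<forall>\<^sub>F t in nhds a. g t \<in> S"
  unfolding isCont_def tendsto_at_iff_tendsto_nhds by (rule topological_tendstoD)

lemma GDERIV_along_curve:
  fixes F :: "'a::real_inner \<Rightarrow> real"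
  assumes "GDERIV F x :> D" "\<gamma> 0 = x" "(\<gamma> has_vector_derivative \<tau>) (at 0)"
  shows "((\<lambda>t. F (\<gamma> t)) has_real_derivative (D \<bullet> \<tau>)) (at 0)"
proof -
  have "(F has_derivative (\<lambda>h. h \<bullet> D)) (at (\<gamma> 0))"
    using assms(1,2) by (simp add: gderiv_def)
  with assms(3) have "((\<lambda>t. F (\<gamma> t)) has_derivative (\<lambda>t. (t *\<^sub>R \<tau>) \<bullet> D)) (at 0)"
    unfolding has_vector_derivative_def by (rule has_derivative_compose)
  moreover have "(\<lambda>t. (t *\<^sub>R \<tau>) \<bullet> D) = (*) (D \<bullet> \<tau>)"
    by (rule ext) (simp only: inner_scaleR_left inner_commute[of \<tau>] mult.commute)
  ultimately show ?thesis
    unfolding has_field_derivative_def by (simp only:)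
qed

lemma eventually_nhds_0_abs_less: "0 < e \<Longrightarrow> \<forall>\<^sub>F t in nhds (0::real). \<bar>t\<bar> < e"
  using eventually_nhds_metric[of "\<lambda>t. \<bar>t\<bar> < e" 0] by (auto simp: dist_real_def)

text \<open>Support is measured on \<open>M\<close> only: off \<open>M\<close> the function may be
  nonzero outside \<open>K\<close>. The neighbourhood \<open>W\<close> has to contain
  \<open>K\<close> rather than \<open>M\<close>, so it can be shrunk when multiplying by
  cut-offs.\<close>

definition test_function :: "'a::euclidean_space set \<Rightarrow> ('a \<Rightarrow> real) \<Rightarrow> ('a \<Rightarrow> 'a) \<Rightarrow> 'a set \<Rightarrow> 'a set \<Rightarrow> bool" where
  "test_function M F DF W K \<longleftrightarrow> open W \<and> compact K \<and> K \<subseteq> M \<inter> W \<and>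
     (\<forall>x\<in>W. GDERIV F x :> DF x) \<and> continuous_on W DF \<and> (\<forall>x\<in>M \<inter> W - K. F x = 0)"

lemma GDERIV_imp_continuous_on:
  assumes "\<And>x. x \<in> W \<Longrightarrow> GDERIV F x :> DF x"
  shows "continuous_on W F"
  by (intro continuous_at_imp_continuous_on ballI)
     (use assms in \<open>auto simp: gderiv_def intro: has_derivative_continuous\<close>)

context unit_normal_hypersurface
begin

text \<open>Unlike \<open>\<partial>\<^sub>v - (v \<bullet> \<nu>) \<partial>\<^sub>\<nu>\<close>, the fields \<open>(\<nu> \<bullet> e) \<partial>\<^sub>v - (\<nu> \<bullet> v) \<partial>\<^sub>e\<close> are tangential
  and free of curvature terms when integrated.\<close>
definition rot :: "'a \<Rightarrow> 'a \<Rightarrow> ('a \<Rightarrow> 'a) \<Rightarrow> 'a \<Rightarrow> real" where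
  "rot e v DF x = (N x \<bullet> e) * (DF x \<bullet> v) - (N x \<bullet> v) * (DF x \<bullet> e)"

lemma integrable_compact:
  fixes f :: "'a \<Rightarrow> real"
  assumes K: "compact K" "K \<subseteq> M" and f: "continuous_on K f"
  shows "integrable H (\<lambda>x. indicator K x * f x)"
proof -
  have m: "(\<lambda>x. indicator K x *\<^sub>R f x) \<in> borel_measurable borel"
    using K f by (intro borel_measurable_continuous_on_indicator borel_compact)
  have "bounded (f ` K)" using K f by (intro compact_imp_bounded compact_continuous_image)
  then obtain B where "\<And>x. x \<in> K \<Longrightarrow> norm (f x) \<le> B" by (auto simp: bounded_iff)
  then show ?thesis
    using m emeasure_compact[OF K] K
    by (intro integrableI_bounded_set[where A = K and B = B]) (auto intro: borel_compact)
qed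

lemma rot_continuous: "K \<subseteq> M \<Longrightarrow> continuous_on K DF \<Longrightarrow> continuous_on K (rot e v DF)"
  unfolding rot_def[abs_def]
  by (intro continuous_intros) (auto intro: continuous_on_subset[OF N_cont])

text \<open>Read in the chart, \<open>F\<close> becomes a function on the hyperplane whose
  derivative along \<open>v\<close> is the derivative of \<open>F\<close> along the tangential lift
  of \<open>v\<close>; its integral vanishes. The area formula returns to \<open>M\<close> with the
  factor |N x . b|, which clears the denominator of the lift and leaves \<open>rot\<close>.\<close>

lemma rot_chart:
  assumes p: "p \<in> M" and b: "norm b = 1" "N p \<bullet> b \<noteq> 0"
  shows "\<exists>r>0. \<forall>F DF W K v. test_function M F DF W K \<longrightarrow> K \<subseteq> ball p r \<longrightarrow> v \<in> plane b \<longrightarrow>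
     (LINT x|H. indicator K x * rot b v DF x) = 0"
proof -
  obtain r L where r: "0 < r" "0 < L" "compact (M \<inter> cball p r)"
    and sgn: "\<And>x. x \<in> M \<inter> cball p r \<Longrightarrow> 0 < (N x \<bullet> b) * (N p \<bullet> b)"
    and lip: "\<And>x y. x \<in> M \<inter> cball p r \<Longrightarrow> y \<in> M \<inter> cball p r \<Longrightarrow>
        norm (x - y) \<le> L * norm (proj b x - proj b y)"
    using chart[OF p b] by metis
  define A where "A = M \<inter> cball p r"
  have A: "compact A" "A \<subseteq> M" using r by (auto simp: A_def)
  have Nb: "N x \<bullet> b \<noteq> 0" if "x \<in> A" for x using sgn[of x] that by (auto simp: A_def)
  have lipA: "norm (x - y) \<le> L * norm (proj b x - proj b y)" if "x \<in> A" "y \<in> A" for x y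
    using lip that by (auto simp: A_def)
  note inj = chart_inj[OF b(1) A Nb lipA]
  note Ginv = chart_inverse_continuous[OF b(1) A Nb lipA]
  define G where "G = inv_into A (proj b)"
  have G: "G (proj b x) = x" if "x \<in> A" for x using inj that by (simp add: G_def)
  have "(LINT x|H. indicator K x * rot b v DF x) = 0"
    if test: "test_function M F DF W K" and Kr: "K \<subseteq> ball p r" and v: "v \<in> plane b" for F DF W K v
  proof -
    have W: "open W" and K: "compact K" "K \<subseteq> M" "K \<subseteq> W" and F: "\<And>x. x \<in> W \<Longrightarrow> GDERIV F x :> DF x"
      and DF: "continuous_on W DF" and F0: "\<And>x. x \<in> M \<Longrightarrow> x \<in> W \<Longrightarrow> x \<notin> K \<Longrightarrow> F x = 0"
      using test unfolding test_function_def by blast+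
    have KA: "K \<subseteq> A" using K Kr by (auto simp: A_def)
    define Q where "Q = proj b ` K"
    have Q: "compact Q" "Q \<subseteq> proj b ` A"
      unfolding Q_def using K KA by (auto intro!: compact_continuous_image continuous_intros)
    have GQ: "G ` Q = K" using G KA by (force simp: Q_def)
    have G_cont: "continuous_on Q G" using continuous_on_subset[OF Ginv Q(2)] by (simp add: G_def)
    \<comment> \<open>The tangent vector that projects to \<open>v\<close> along
      \<open>b\<close>.\<close>
    define \<tau> where "\<tau> x = v - ((N x \<bullet> v) / (N x \<bullet> b)) *\<^sub>R b" for x
    have \<tau>_cont: "continuous_on K \<tau>"
      unfolding \<tau>_def using KA Nb
      by (intro continuous_intros) (auto intro: continuous_on_subset[OF N_cont K(2)])
    have dot_cont: "continuous_on K (\<lambda>x. DF x \<bullet> \<tau> x)"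
      by (intro continuous_intros \<tau>_cont continuous_on_subset[OF DF K(3)])
    have F_cont: "continuous_on K F"
      by (rule continuous_on_subset[OF GDERIV_imp_continuous_on[OF F] K(3)])
    define h where "h y = (if y \<in> Q then F (G y) else 0)" for y
    define h' where "h' y = (if y \<in> Q then DF (G y) \<bullet> \<tau> (G y) else 0)" for y
    have [measurable]: "h \<in> borel_measurable borel" "h' \<in> borel_measurable borel"
      unfolding h_def[abs_def] h'_def[abs_def] using Q(1) GQ G_cont
      by (auto intro!: borel_measurable_continuous_on_if borel_compact
          continuous_on_compose2[OF F_cont] continuous_on_compose2[OF dot_cont])
    have "bounded ((\<lambda>x. DF x \<bullet> \<tau> x) ` K)" "bounded (F ` K)"
      using K dot_cont F_cont by (auto intro!: compact_imp_bounded compact_continuous_image)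
    then obtain B C where BC: "\<And>x. x \<in> K \<Longrightarrow> \<bar>DF x \<bullet> \<tau> x\<bar> \<le> B" "\<And>x. x \<in> K \<Longrightarrow> \<bar>F x\<bar> \<le> C"
      by (auto simp: bounded_iff)
    obtain R where R: "\<And>y. y \<in> Q \<Longrightarrow> norm y \<le> R"
      using compact_imp_bounded[OF Q(1)] by (auto simp: bounded_iff)
    have GK: "G y \<in> K" if "y \<in> Q" for y using GQ that by blast
    have h'B: "\<bar>h' y\<bar> \<le> max B 0" for y
      using BC(1)[OF GK, of y] by (cases "y \<in> Q") (simp_all add: h'_def le_max_iff_disj)
    have hC: "\<bar>h y\<bar> \<le> max C 0" for y
      using BC(2)[OF GK, of y] by (cases "y \<in> Q") (simp_all add: h_def le_max_iff_disj)
    have projv: "proj b (y + t *\<^sub>R v) = proj b y + t *\<^sub>R v" for y t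
      using proj_plane[OF v] by (simp add: proj_add proj_scaleR)
    \<comment> \<open>The derivative is demanded at every point of the space, hence the composition
      with \<open>proj b\<close>, which extends \<open>h\<close> constantly along
      \<open>b\<close>.\<close>
    have der: "((\<lambda>t. h (proj b (y + t *\<^sub>R v))) has_real_derivative h' (proj b y)) (at 0)" for y
    proof (cases "proj b y \<in> Q")
      case True
      then obtain x where x: "x \<in> K" "proj b y = proj b x" by (auto simp: Q_def)
      have xA: "x \<in> A" and xM: "x \<in> M" using x KA K by auto
      \<comment> \<open>The curve in \<open>M\<close> over the line through \<open>proj b y\<close>
        in direction \<open>v\<close>. Injectivity of the projection on \<open>A\<close> identifies
        it with the chart inverse along that line; where it leaves \<open>K\<close>,
        \<open>F\<close> vanishes, so boundary points of \<open>K\<close> cause no kink.\<close>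
      obtain \<gamma> u e where \<gamma>: "0 < e" "\<gamma> 0 = x" "\<And>t. \<bar>t\<bar> < e \<Longrightarrow> \<gamma> t \<in> M"
        "\<And>t. \<bar>t\<bar> < e \<Longrightarrow> \<gamma> t = x + t *\<^sub>R v + u t *\<^sub>R b"
        and \<gamma>': "(\<gamma> has_vector_derivative \<tau> x) (at 0)"
        using hypersurface_curve[OF flat[OF xM] crossed[OF xM] xM Nb[OF xA], of v] unfolding \<tau>_def by metis
      have "isCont \<gamma> 0" using \<gamma>' by (rule has_vector_derivative_continuous)
      then have "\<forall>\<^sub>F t in nhds 0. \<gamma> t \<in> W \<inter> ball p r"
        using W \<gamma>(2) x(1) K(3) Kr by (intro isCont_eventually_mem) auto
      moreover have "\<forall>\<^sub>F t in nhds (0::real). \<bar>t\<bar> < e"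
        using \<gamma>(1) by (rule eventually_nhds_0_abs_less)
      ultimately have ev: "\<forall>\<^sub>F t in nhds 0. h (proj b (y + t *\<^sub>R v)) = F (\<gamma> t)"
      proof eventually_elim
        case (elim t)
        have "proj b (\<gamma> t) = proj b (y + t *\<^sub>R v)"
          unfolding projv x(2) \<gamma>(4)[OF elim(2)] using proj_self[OF b(1)] proj_plane[OF v]
          by (simp add: proj_add proj_scaleR)
        moreover have \<gamma>A: "\<gamma> t \<in> A" using \<gamma>(3)[OF elim(2)] elim(1) by (auto simp: A_def)
        moreover have "proj b (\<gamma> t) \<in> Q \<longleftrightarrow> \<gamma> t \<in> K"
          using inj_on_image_mem_iff[OF inj \<gamma>A KA] by (simp add: Q_def)
        ultimately show ?case using F0[OF \<gamma>(3)[OF elim(2)]] elim(1) G[OF \<gamma>A] by (auto simp: h_def)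
      qed
      have "GDERIV F x :> DF x" using F x(1) K(3) by blast
      then have "((\<lambda>t. F (\<gamma> t)) has_real_derivative (DF x \<bullet> \<tau> x)) (at 0)"
        using \<gamma>(2) \<gamma>' by (rule GDERIV_along_curve)
      moreover have "h' (proj b y) = DF x \<bullet> \<tau> x" using x G[OF xA] by (auto simp: h'_def Q_def)
      ultimately show ?thesis using DERIV_cong_ev[OF refl ev refl] by simp
    next
      case False
      have "isCont (\<lambda>t. proj b (y + t *\<^sub>R v)) 0" unfolding projv by (intro continuous_intros)
      then have "\<forall>\<^sub>F t in nhds 0. proj b (y + t *\<^sub>R v) \<in> - Q"
        using compact_imp_closed[OF Q(1)] False by (intro isCont_eventually_mem) auto
      then have ev: "\<forall>\<^sub>F t in nhds 0. h (proj b (y + t *\<^sub>R v)) = 0"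
        by eventually_elim (simp add: h_def)
      have "h' (proj b y) = 0" using False by (simp add: h'_def)
      then show ?thesis using DERIV_cong_ev[OF refl ev refl] by simp
    qed
    have b0: "b \<noteq> 0" using b(1) by auto
    have zero: "(LINT y|HP b. h' (proj b y)) = 0"
    proof (rule integral_directional_derivative[OF b0 v _ _ der h'B hC])
      fix y assume "y \<in> plane b" "R < norm y"
      then show "h (proj b y) = 0" using R by (force simp: h_def proj_plane)
    qed auto
    have "(LINT x|H. (indicator A x * \<bar>N x \<bullet> b\<bar>) * (indicator K x * (DF x \<bullet> \<tau> x)))
        = (LINT y|H. indicator (proj b ` A) y * (indicator K (G y) * (DF (G y) \<bullet> \<tau> (G y))))"
      unfolding G_def
    proof (rule area_formula[OF b(1) A Nb lipA])
      have "(\<lambda>x. indicator K x *\<^sub>R (DF x \<bullet> \<tau> x)) \<in> borel_measurable borel"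
        using K dot_cont by (intro borel_measurable_continuous_on_indicator borel_compact)
      then show "(\<lambda>x. indicator K x * (DF x \<bullet> \<tau> x)) \<in> borel_measurable borel" by simp
    qed
    also have "\<dots> = (LINT y|H. indicator (plane b) y *\<^sub>R h' (proj b y))"
    proof (rule Bochner_Integration.integral_cong[OF refl])
      fix y
      have "y \<in> Q \<longleftrightarrow> y \<in> proj b ` A \<and> G y \<in> K"
      proof
        assume "y \<in> proj b ` A \<and> G y \<in> K"
        then obtain x where "x \<in> A" "y = proj b x" "G y \<in> K" by auto
        then show "y \<in> Q" using G by (auto simp: Q_def)
      qed (use Q GK in auto)
      moreover have "Q \<subseteq> plane b" using proj_in_plane[OF b(1)] by (auto simp: Q_def)
      ultimately show "indicator (proj b ` A) y * (indicator K (G y) * (DF (G y) \<bullet> \<tau> (G y)))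
          = indicator (plane b) y *\<^sub>R h' (proj b y)"
        by (cases "y \<in> Q") (auto simp: h'_def proj_plane indicator_def)
    qed
    also have "\<dots> = (LINT y|HP b. h' (proj b y))"
      unfolding HP_def
      using integral_density[of "\<lambda>y. h' (proj b y)" H "indicator (plane b)"] by (simp add: ennreal_indicator)
    finally have area0: "(LINT x|H. (indicator A x * \<bar>N x \<bullet> b\<bar>) * (indicator K x * (DF x \<bullet> \<tau> x))) = 0"
      using zero by simp
    \<comment> \<open>On \<open>A\<close> the sign of N x . b is that at \<open>p\<close>, so the
      absolute value in the area formula is a constant factor.\<close>
    define s where "s = sgn (N p \<bullet> b)"
    have s: "s \<noteq> 0" using b by (simp add: s_def sgn_eq_0_iff)
    have eq: "(indicator A x * \<bar>N x \<bullet> b\<bar>) * (indicator K x * (DF x \<bullet> \<tau> x)) = s * (indicator K x * rot b v DF x)" for x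
    proof (cases "x \<in> K")
      case True
      then have xA: "x \<in> A" using KA by auto
      then have "0 < (N x \<bullet> b) * (N p \<bullet> b)" using sgn by (simp add: A_def)
      then have "\<bar>N x \<bullet> b\<bar> = s * (N x \<bullet> b)"
        by (auto simp: s_def zero_less_mult_iff sgn_if)
      moreover have "(N x \<bullet> b) * (DF x \<bullet> \<tau> x) = rot b v DF x"
        using Nb[OF xA] by (simp add: rot_def \<tau>_def inner_diff_right algebra_simps)
      ultimately show ?thesis using True xA by (simp add: mult.assoc)
    qed simp
    have "(LINT x|H. s * (indicator K x * rot b v DF x)) = 0"
      using area0 unfolding eq .
    then have "s * (LINT x|H. indicator K x * rot b v DF x) = 0"
      unfolding integral_mult_right_zero .
    then show ?thesis using s by simp
  qed
  then show ?thesis using r(1) by blast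
qed

text \<open>\<open>rot\<close> is bilinear and alternating in its two vectors: \<open>e\<close> can
  be normalised, and \<open>v\<close> replaced by its projection, without losing generality.\<close>

lemma rot_transversal:
  assumes p: "p \<in> M" and e: "N p \<bullet> e \<noteq> 0"
  shows "\<exists>r>0. \<forall>F DF W K v. test_function M F DF W K \<longrightarrow> K \<subseteq> ball p r \<longrightarrow>
     (LINT x|H. indicator K x * rot e v DF x) = 0"
proof -
  have e0: "norm e > 0" using e by auto
  define b where "b = (1 / norm e) *\<^sub>R e"
  have b: "norm b = 1" "N p \<bullet> b \<noteq> 0" and eb: "e = norm e *\<^sub>R b"
    using e e0 by (auto simp: b_def)
  obtain r where r: "0 < r" and rot0: "\<forall>F DF W K v. test_function M F DF W K \<longrightarrow> K \<subseteq> ball p r \<longrightarrow> v \<in> plane b \<longrightarrow>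
     (LINT x|H. indicator K x * rot b v DF x) = 0"
    using rot_chart[OF p b] by blast
  have "rot e v DF x = norm e * rot b (proj b v) DF x" for v DF x
  proof -
    have "rot e v DF x = norm e * rot b v DF x"
      by (subst eb) (simp add: rot_def algebra_simps)
    also have "rot b v DF x = rot b (proj b v) DF x"
      by (simp add: rot_def proj_def inner_diff_right algebra_simps)
    finally show ?thesis .
  qed
  then have "(LINT x|H. indicator K x * rot e v DF x) = norm e * (LINT x|H. indicator K x * rot b (proj b v) DF x)"
    for K v DF by (simp add: mult.left_commute[of _ "norm e"])
  then show ?thesis using r rot0 proj_in_plane[OF b(1)] by (intro exI[of _ r]) auto
qed

lemma rot_local:
  assumes p: "p \<in> M"
  shows "\<exists>r>0. \<forall>F DF W K v. test_function M F DF W K \<longrightarrow> K \<subseteq> ball p r \<longrightarrow>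
     (LINT x|H. indicator K x * rot e v DF x) = 0"
proof (cases "N p \<bullet> e = 0")
  case False
  then show ?thesis by (rule rot_transversal[OF p])
next
  case True
  \<comment> \<open>\<open>rot\<close> is linear in \<open>e\<close>, and both \<open>e + N p\<close> and \<open>N p\<close> are transversal at \<open>p\<close>\<close>
  have NN: "N p \<bullet> N p = 1" using N_unit[OF p] by (simp add: norm_eq_1)
  have 1: "N p \<bullet> N p \<noteq> 0" and 2: "N p \<bullet> (e + N p) \<noteq> 0"
    using NN True by (simp_all add: inner_add_right)
  obtain r1 where r1: "0 < r1" "\<forall>F DF W K v. test_function M F DF W K \<longrightarrow> K \<subseteq> ball p r1 \<longrightarrow>
     (LINT x|H. indicator K x * rot (N p) v DF x) = 0" using rot_transversal[OF p 1] by blast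
  obtain r2 where r2: "0 < r2" "\<forall>F DF W K v. test_function M F DF W K \<longrightarrow> K \<subseteq> ball p r2 \<longrightarrow>
     (LINT x|H. indicator K x * rot (e + N p) v DF x) = 0" using rot_transversal[OF p 2] by blast
  have "(LINT x|H. indicator K x * rot e v DF x) = 0"
    if t: "test_function M F DF W K" "K \<subseteq> ball p (min r1 r2)" for F DF W K v
  proof -
    have K: "compact K" "K \<subseteq> M" "continuous_on K DF"
      using t(1) by (auto simp: test_function_def intro: continuous_on_subset)
    have Kr: "K \<subseteq> ball p r1" "K \<subseteq> ball p r2" using t(2) by auto
    have int: "integrable H (\<lambda>x. indicator K x * rot e v DF x)" for e
      by (intro integrable_compact K rot_continuous)
    have "rot e v DF x = rot (e + N p) v DF x - rot (N p) v DF x" for x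
      by (simp add: rot_def inner_add_right algebra_simps)
    then have "(LINT x|H. indicator K x * rot e v DF x)
        = (LINT x|H. indicator K x * rot (e + N p) v DF x) - (LINT x|H. indicator K x * rot (N p) v DF x)"
      using int by (simp add: right_diff_distrib)
    also have "(LINT x|H. indicator K x * rot (e + N p) v DF x) = 0"
      by (rule r2(2)[rule_format, OF t(1) Kr(2)])
    also have "(LINT x|H. indicator K x * rot (N p) v DF x) = 0"
      by (rule r1(2)[rule_format, OF t(1) Kr(1)])
    finally show ?thesis by simp
  qed
  then show ?thesis using r1(1) r2(1) by (intro exI[of _ "min r1 r2"]) auto
qed

end

section \<open>A partition of unity of class C^1\<close>

definition bump :: "'a::euclidean_space \<Rightarrow> real \<Rightarrow> 'a \<Rightarrow> real" where
  "bump q \<rho> x = (max 0 (\<rho>\<^sup>2 - (x - q) \<bullet> (x - q)))\<^sup>2"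

definition bump_grad :: "'a::euclidean_space \<Rightarrow> real \<Rightarrow> 'a \<Rightarrow> 'a" where
  "bump_grad q \<rho> x = (- 4 * max 0 (\<rho>\<^sup>2 - (x - q) \<bullet> (x - q))) *\<^sub>R (x - q)"

text \<open>Squaring the positive part removes its kink to first order, which is exactly the
  regularity that \<open>test_function\<close> asks of a cut-off.\<close>

lemma DERIV_max_sq: "((\<lambda>s::real. (max 0 s)\<^sup>2) has_real_derivative 2 * max 0 s) (at s)"
proof -
  consider "s > 0" | "s < 0" | "s = 0" by linarith
  then show ?thesis
  proof cases
    case 1
    have ev: "\<forall>\<^sub>F t in nhds s. (max 0 t)\<^sup>2 = t\<^sup>2"
      by (rule eventually_mono[OF eventually_nhds_in_open[of "{0<..}"]]) (use 1 in auto)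
    have "((\<lambda>s::real. s\<^sup>2) has_real_derivative 2 * max 0 s) (at s)"
      using 1 by (auto intro!: derivative_eq_intros)
    then show ?thesis using DERIV_cong_ev[OF refl ev refl] by simp
  next
    case 2
    have ev: "\<forall>\<^sub>F t in nhds s. (max 0 t)\<^sup>2 = 0"
      by (rule eventually_mono[OF eventually_nhds_in_open[of "{..<0}"]]) (use 2 in auto)
    then show ?thesis using DERIV_cong_ev[OF refl ev refl] 2 by simp
  next
    case 3
    have "(\<lambda>h::real. ((max 0 (0 + h))\<^sup>2 - (max 0 0)\<^sup>2) / h) \<midarrow>0\<rightarrow> 0"
    proof (rule Lim_null_comparison[of _ "\<lambda>h. \<bar>h\<bar>"])
      show "\<forall>\<^sub>F h in at 0. norm (((max 0 (0 + h))\<^sup>2 - (max 0 0)\<^sup>2) / h) \<le> \<bar>h::real\<bar>"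
        by (rule always_eventually) (auto simp: max_def power2_eq_square)
      show "((\<lambda>h::real. \<bar>h\<bar>) \<longlongrightarrow> 0) (at 0)" by (intro tendsto_rabs_zero tendsto_ident_at)
    qed
    then show ?thesis using 3 by (simp add: DERIV_def)
  qed
qed

lemma GDERIV_bump: "GDERIV (bump q \<rho>) x :> bump_grad q \<rho> x"
proof -
  have "GDERIV (\<lambda>x. \<rho>\<^sup>2 - (x - q) \<bullet> (x - q)) x :> (- 2) *\<^sub>R (x - q)"
    unfolding gderiv_def by (auto intro!: derivative_eq_intros simp: inner_commute algebra_simps)
  from GDERIV_DERIV_compose[OF this DERIV_max_sq]
  have "GDERIV (bump q \<rho>) x :> (2 * max 0 (\<rho>\<^sup>2 - (x - q) \<bullet> (x - q))) *\<^sub>R (- 2) *\<^sub>R (x - q)"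
    unfolding bump_def .
  then show ?thesis by (simp add: bump_grad_def)
qed

lemma bump_grad_continuous: "continuous_on S (bump_grad q \<rho>)"
  unfolding bump_grad_def by (intro continuous_intros)

lemma bump_nonneg: "0 \<le> bump q \<rho> x"
  by (simp add: bump_def)

lemma bump_pos: "x \<in> ball q \<rho> \<Longrightarrow> 0 < bump q \<rho> x"
proof -
  assume "x \<in> ball q \<rho>"
  then have "norm (x - q) < \<rho>" by (simp add: dist_norm norm_minus_commute)
  then have "(norm (x - q))\<^sup>2 < \<rho>\<^sup>2" by (intro power_strict_mono) auto
  then show ?thesis by (simp add: bump_def power2_norm_eq_inner)
qed

lemma bump_outside:
  assumes "x \<notin> cball q \<rho>" "0 < \<rho>"
  shows "bump q \<rho> x = 0" "bump_grad q \<rho> x = 0"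
proof -
  have "\<rho> \<le> norm (x - q)" using assms by (simp add: dist_norm norm_minus_commute)
  then have "\<rho>\<^sup>2 \<le> (norm (x - q))\<^sup>2" using assms by (intro power_mono) auto
  then show "bump q \<rho> x = 0" "bump_grad q \<rho> x = 0"
    by (auto simp: bump_def bump_grad_def power2_norm_eq_inner)
qed

lemma GDERIV_unique: "GDERIV f x :> D \<Longrightarrow> GDERIV f x :> E \<Longrightarrow> D = E"
proof -
  assume "GDERIV f x :> D" "GDERIV f x :> E"
  then have "(\<lambda>h. h \<bullet> D) = (\<lambda>h. h \<bullet> E)" unfolding gderiv_def by (rule has_derivative_unique)
  then have "(D - E) \<bullet> D = (D - E) \<bullet> E" by meson
  then have "(D - E) \<bullet> (D - E) = 0" by (simp only: inner_diff_right)
  then show "D = E" by simp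
qed

lemma GDERIV_sum:
  assumes "finite I" "\<And>i. i \<in> I \<Longrightarrow> GDERIV (f i) x :> D i"
  shows "GDERIV (\<lambda>x. \<Sum>i\<in>I. f i x) x :> (\<Sum>i\<in>I. D i)"
  using assms by (induction I rule: finite_induct) (auto intro!: GDERIV_const GDERIV_add)

text \<open>A partition of unity over finitely many balls supplied by \<open>rot_local\<close>
  writes \<open>F\<close> near \<open>K\<close> as a sum of test functions with small supports;
  \<open>rot\<close> is linear in the gradient.\<close>

lemma (in unit_normal_hypersurface) rot_integral_zero:
  assumes test: "test_function M F DF W K"
  shows "(LINT x|H. indicator K x * rot e v DF x) = 0"
proof -
  have W: "open W" and K: "compact K" "K \<subseteq> M" "K \<subseteq> W" and F: "\<And>x. x \<in> W \<Longrightarrow> GDERIV F x :> DF x"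
    and DF: "continuous_on W DF" and F0: "\<And>x. x \<in> M \<Longrightarrow> x \<in> W \<Longrightarrow> x \<notin> K \<Longrightarrow> F x = 0"
    using test unfolding test_function_def by blast+
  obtain r where r: "\<And>p. p \<in> K \<Longrightarrow> 0 < r p" "\<And>p. p \<in> K \<Longrightarrow> \<forall>F DF W K v. test_function M F DF W K \<longrightarrow>
      K \<subseteq> ball p (r p) \<longrightarrow> (LINT x|H. indicator K x * rot e v DF x) = 0"
    using rot_local[of _ e] K(2) by (metis subsetD)
  \<comment> \<open>Half the radius, so that the closed ball supporting a bump lies in the open ball
    of \<open>rot_local\<close>.\<close>
  define \<rho> where "\<rho> p = r p / 2" for p
  have \<rho>: "0 < \<rho> p" "\<rho> p < r p" if "p \<in> K" for p using r(1)[OF that] by (auto simp: \<rho>_def)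
  have "K \<subseteq> (\<Union>p\<in>K. ball p (\<rho> p))" using \<rho>(1) by force
  then obtain I where I: "I \<subseteq> K" "finite I" "K \<subseteq> (\<Union>p\<in>I. ball p (\<rho> p))"
    by (rule compactE_image[OF K(1) open_ball])
  define \<psi> where "\<psi> p = bump p (\<rho> p)" for p
  define D\<psi> where "D\<psi> p = bump_grad p (\<rho> p)" for p
  define \<Psi> where "\<Psi> x = (\<Sum>p\<in>I. \<psi> p x)" for x
  define D\<Psi> where "D\<Psi> x = (\<Sum>p\<in>I. D\<psi> p x)" for x
  have \<psi>': "GDERIV (\<psi> p) x :> D\<psi> p x" for p x unfolding \<psi>_def D\<psi>_def by (rule GDERIV_bump)
  have \<Psi>': "GDERIV \<Psi> x :> D\<Psi> x" for x
    unfolding \<Psi>_def D\<Psi>_def by (rule GDERIV_sum[OF I(2) \<psi>'])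
  have cont: "continuous_on S (\<psi> p)" "continuous_on S \<Psi>" "continuous_on S (D\<psi> p)" "continuous_on S D\<Psi>" for S p
    using GDERIV_imp_continuous_on[OF \<psi>'] GDERIV_imp_continuous_on[OF \<Psi>'] bump_grad_continuous
    by (auto simp: D\<psi>_def D\<Psi>_def intro!: continuous_on_sum)
  \<comment> \<open>Division by the sum of the bumps requires its positivity, which holds on a
    smaller neighbourhood of \<open>K\<close>.\<close>
  define W' where "W' = W \<inter> {x. 0 < \<Psi> x}"
  have W': "open W'" unfolding W'_def
    by (intro open_Int W open_Collect_less continuous_intros cont)
  have KW': "K \<subseteq> W'"
  proof
    fix x assume x: "x \<in> K"
    then obtain p where p: "p \<in> I" "x \<in> ball p (\<rho> p)" using I(3) by auto
    have "0 < \<Psi> x" unfolding \<Psi>_def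
      by (rule sum_pos2[OF I(2) p(1)]) (use p bump_pos bump_nonneg in \<open>auto simp: \<psi>_def\<close>)
    then show "x \<in> W'" using x K(3) by (auto simp: W'_def)
  qed
  define \<theta> where "\<theta> p x = \<psi> p x * inverse (\<Psi> x)" for p x
  define D\<theta> where "D\<theta> p x = \<psi> p x *\<^sub>R (- (inverse (\<Psi> x))\<^sup>2 *\<^sub>R D\<Psi> x) + inverse (\<Psi> x) *\<^sub>R D\<psi> p x" for p x
  define Fp where "Fp p x = F x * \<theta> p x" for p x
  define DFp where "DFp p x = F x *\<^sub>R D\<theta> p x + \<theta> p x *\<^sub>R DF x" for p x
  define Kp where "Kp p = K \<inter> cball p (\<rho> p)" for p
  have Fp': "GDERIV (Fp p) x :> DFp p x" if "x \<in> W'" for p x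
  proof -
    have "\<Psi> x \<noteq> 0" using that by (simp add: W'_def)
    then have "GDERIV (\<theta> p) x :> D\<theta> p x"
      unfolding \<theta>_def[abs_def] D\<theta>_def by (intro GDERIV_mult \<psi>' GDERIV_inverse \<Psi>')
    then show ?thesis unfolding Fp_def[abs_def] DFp_def using that F
      by (intro GDERIV_mult) (auto simp: W'_def)
  qed
  have DFp_cont: "continuous_on W' (DFp p)" for p
    unfolding DFp_def[abs_def] \<theta>_def D\<theta>_def
    by (intro continuous_intros cont) (auto simp: W'_def intro: continuous_on_subset[OF DF]
        continuous_on_subset[OF GDERIV_imp_continuous_on[OF F]])
  have out: "\<theta> p x = 0" "D\<theta> p x = 0" if "x \<notin> cball p (\<rho> p)" "p \<in> I" for p x
    using bump_outside[OF that(1) \<rho>(1)] I(1) that(2) by (auto simp: \<theta>_def D\<theta>_def \<psi>_def D\<psi>_def)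
  have testp: "test_function M (Fp p) (DFp p) W' (Kp p)" if p: "p \<in> I" for p
    unfolding test_function_def
  proof (intro conjI W')
    show "compact (Kp p)" using K(1) by (simp add: Kp_def compact_Int_closed)
    show "Kp p \<subseteq> M \<inter> W'" using K KW' by (auto simp: Kp_def)
    show "\<forall>x\<in>W'. GDERIV (Fp p) x :> DFp p x" using Fp' by blast
    show "continuous_on W' (DFp p)" by (rule DFp_cont)
    show "\<forall>x\<in>M \<inter> W' - Kp p. Fp p x = 0"
    proof
      fix x assume x: "x \<in> M \<inter> W' - Kp p"
      show "Fp p x = 0"
      proof (cases "x \<in> K")
        case True
        then have "x \<notin> cball p (\<rho> p)" using x by (simp add: Kp_def)
        then have "\<theta> p x = 0" using p by (rule out(1))
        then show ?thesis by (simp add: Fp_def)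
      next
        case False
        then have "F x = 0" using x by (intro F0) (auto simp: W'_def)
        then show ?thesis by (simp add: Fp_def)
      qed
    qed
  qed
  have zero: "(LINT x|H. indicator (Kp p) x * rot e v (DFp p) x) = 0" if p: "p \<in> I" for p
  proof -
    have "Kp p \<subseteq> ball p (r p)" using \<rho>(2)[of p] p I(1) by (auto simp: Kp_def)
    then show ?thesis using r(2)[of p] p I(1) testp[OF p] by blast
  qed
  have Kp_eq: "indicator K x * rot e v (DFp p) x = indicator (Kp p) x * rot e v (DFp p) x" if p: "p \<in> I" for p x
  proof (cases "x \<in> K \<and> x \<notin> cball p (\<rho> p)")
    case True
    then have "DFp p x = 0" using out[OF _ p] by (simp add: DFp_def)
    then show ?thesis by (simp add: rot_def)
  qed (auto simp: Kp_def indicator_def)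
  \<comment> \<open>Since the quotients sum to 1 on the open set \<open>W'\<close>, the localised
    functions sum to \<open>F\<close> there, and uniqueness of the gradient gives the identity for
    the explicit expressions.\<close>
  have DF_sum: "DF x = (\<Sum>p\<in>I. DFp p x)" if x: "x \<in> K" for x
  proof (rule GDERIV_unique)
    have xW': "x \<in> W'" using x KW' by auto
    have "(\<Sum>p\<in>I. Fp p y) = F y" if "y \<in> W'" for y
    proof -
      have "(\<Sum>p\<in>I. Fp p y) = F y * (\<Psi> y * inverse (\<Psi> y))"
        by (simp add: Fp_def \<theta>_def \<Psi>_def sum_distrib_left sum_distrib_right)
      then show ?thesis using that by (simp add: W'_def)
    qed
    moreover have "GDERIV (\<lambda>y. \<Sum>p\<in>I. Fp p y) x :> (\<Sum>p\<in>I. DFp p x)"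
      by (rule GDERIV_sum[OF I(2) Fp'[OF xW']])
    ultimately show "GDERIV F x :> (\<Sum>p\<in>I. DFp p x)"
      unfolding gderiv_def using has_derivative_transform_within_open[OF _ W' xW'] by blast
    show "GDERIV F x :> DF x" using F x K(3) by blast
  qed
  have "indicator K x * rot e v DF x = (\<Sum>p\<in>I. indicator (Kp p) x * rot e v (DFp p) x)" for x
  proof (cases "x \<in> K")
    case True
    have "rot e v DF x = (\<Sum>p\<in>I. rot e v (DFp p) x)"
      unfolding rot_def DF_sum[OF True] by (simp add: inner_sum_left sum_distrib_left sum_subtractf)
    then have "indicator K x * rot e v DF x = (\<Sum>p\<in>I. indicator K x * rot e v (DFp p) x)"
      by (simp add: sum_distrib_left)
    also have "\<dots> = (\<Sum>p\<in>I. indicator (Kp p) x * rot e v (DFp p) x)"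
      by (rule sum.cong[OF refl Kp_eq])
    finally show ?thesis .
  qed (auto simp: Kp_def)
  then have "(LINT x|H. indicator K x * rot e v DF x) = (LINT x|H. (\<Sum>p\<in>I. indicator (Kp p) x * rot e v (DFp p) x))"
    by simp
  also have "\<dots> = (\<Sum>p\<in>I. LINT x|H. indicator (Kp p) x * rot e v (DFp p) x)"
  proof (rule Bochner_Integration.integral_sum)
    fix p assume "p \<in> I"
    then show "integrable H (\<lambda>x. indicator (Kp p) x * rot e v (DFp p) x)"
      using testp[of p] unfolding test_function_def
      by (intro integrable_compact rot_continuous) (auto intro: continuous_on_subset)
  qed
  also have "\<dots> = 0" using zero by simp
  finally show ?thesis .
qed

section \<open>Divergence of the radial field\<close>

text \<open>The bound 2 |f g| <= f^2 + g^2 makes the product integrable, so that the Cauchy-Schwarz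
  inequality for nonnegative extended integrals can be read in the reals.\<close>

lemma integral_le_sqrt_mult_sqrt:
  fixes f g h :: "'a \<Rightarrow> real"
  assumes [measurable]: "f \<in> borel_measurable M" "g \<in> borel_measurable M"
    and f: "integrable M (\<lambda>x. (f x)\<^sup>2)" and g: "integrable M (\<lambda>x. (g x)\<^sup>2)"
    and h: "integrable M h" and le: "\<And>x. h x \<le> f x * g x"
  shows "(LINT x|M. h x) \<le> sqrt (LINT x|M. (f x)\<^sup>2) * sqrt (LINT x|M. (g x)\<^sup>2)"
proof -
  have fg: "integrable M (\<lambda>x. f x * g x)"
  proof (rule Bochner_Integration.integrable_bound)
    show "integrable M (\<lambda>x. (f x)\<^sup>2 + (g x)\<^sup>2)" using f g by simp
    have "\<bar>f x * g x\<bar> \<le> (f x)\<^sup>2 + (g x)\<^sup>2" for x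
    proof -
      have "2 * \<bar>f x * g x\<bar> \<le> (f x)\<^sup>2 + (g x)\<^sup>2"
        using sum_squares_bound[of "\<bar>f x\<bar>" "\<bar>g x\<bar>"] by (simp add: abs_mult mult.assoc)
      then show ?thesis using abs_ge_zero[of "f x * g x"] by linarith
    qed
    then show "AE x in M. norm (f x * g x) \<le> norm ((f x)\<^sup>2 + (g x)\<^sup>2)" by simp
  qed auto
  define P where "P = (LINT x|M. \<bar>f x * g x\<bar>)"
  define F where "F = (LINT x|M. (f x)\<^sup>2)"
  define G where "G = (LINT x|M. (g x)\<^sup>2)"
  have nonneg: "0 \<le> P" "0 \<le> F" "0 \<le> G" by (auto simp: P_def F_def G_def)
  have "(\<integral>\<^sup>+x. ennreal \<bar>f x\<bar> * ennreal \<bar>g x\<bar> \<partial>M)\<^sup>2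
      \<le> (\<integral>\<^sup>+x. (ennreal \<bar>f x\<bar>)\<^sup>2 \<partial>M) * (\<integral>\<^sup>+x. (ennreal \<bar>g x\<bar>)\<^sup>2 \<partial>M)"
    by (rule Cauchy_Schwarz_nn_integral) measurable
  also have "(\<integral>\<^sup>+x. ennreal \<bar>f x\<bar> * ennreal \<bar>g x\<bar> \<partial>M) = (\<integral>\<^sup>+x. ennreal \<bar>f x * g x\<bar> \<partial>M)"
    by (simp add: ennreal_mult[symmetric] abs_mult)
  also have "\<dots> = ennreal P"
    unfolding P_def using fg by (intro nn_integral_eq_integral integrable_abs) auto
  also have "(\<integral>\<^sup>+x. (ennreal \<bar>f x\<bar>)\<^sup>2 \<partial>M) = (\<integral>\<^sup>+x. ennreal ((f x)\<^sup>2) \<partial>M)"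
    by (simp add: ennreal_power)
  also have "\<dots> = ennreal F" unfolding F_def using f by (intro nn_integral_eq_integral) auto
  also have "(\<integral>\<^sup>+x. (ennreal \<bar>g x\<bar>)\<^sup>2 \<partial>M) = (\<integral>\<^sup>+x. ennreal ((g x)\<^sup>2) \<partial>M)"
    by (simp add: ennreal_power)
  also have "\<dots> = ennreal G" unfolding G_def using g by (intro nn_integral_eq_integral) auto
  finally have "P\<^sup>2 \<le> F * G"
    using nonneg by (simp add: ennreal_power ennreal_mult[symmetric])
  then have "P \<le> sqrt F * sqrt G"
    using real_le_rsqrt[of P "F * G"] by (simp add: real_sqrt_mult)
  moreover have "(LINT x|M. h x) \<le> P"
    unfolding P_def using fg h by (intro integral_mono) (auto intro: order_trans[OF le])
  ultimately show ?thesis by (simp add: F_def G_def)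
qed

context unit_normal_hypersurface
begin

text \<open>Differentiate N.N = 1 along a curve in \<open>M\<close> with velocity
  \<open>\<tau>\<close>. The extension of the normal has unit length only on \<open>M\<close>, so in
  the normal direction nothing similar holds; the correction term in \<open>mean_curv\<close>
  accounts for this.\<close>

lemma normal_derivative_tangential:
  assumes p: "p \<in> M" and DN: "(N has_derivative DN) (at p)" and \<tau>: "N p \<bullet> \<tau> = 0"
  shows "N p \<bullet> DN \<tau> = 0"
proof -
  have NN: "N p \<bullet> N p = 1" using N_unit[OF p] by (simp add: norm_eq_1)
  then have "N p \<bullet> N p \<noteq> 0" by simp
  then obtain \<gamma> u e where \<gamma>: "0 < e" "\<gamma> 0 = p" "\<And>t. \<bar>t\<bar> < e \<Longrightarrow> \<gamma> t \<in> M"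
    and \<gamma>': "(\<gamma> has_vector_derivative (\<tau> - ((N p \<bullet> \<tau>) / (N p \<bullet> N p)) *\<^sub>R N p)) (at 0)"
    using hypersurface_curve[OF flat[OF p] crossed[OF p] p, of "N p" \<tau>] by metis
  have "(\<gamma> has_derivative (\<lambda>t. t *\<^sub>R \<tau>)) (at 0)"
    using \<gamma>' by (simp add: \<tau> has_vector_derivative_def)
  moreover have "(N has_derivative DN) (at (\<gamma> 0))" using DN \<gamma>(2) by simp
  ultimately have "((\<lambda>t. N (\<gamma> t)) has_derivative (\<lambda>t. DN (t *\<^sub>R \<tau>))) (at 0)"
    by (rule has_derivative_compose)
  from has_derivative_inner[OF this this]
  have d1: "((\<lambda>t. N (\<gamma> t) \<bullet> N (\<gamma> t)) has_derivative
      (\<lambda>t. N (\<gamma> 0) \<bullet> DN (t *\<^sub>R \<tau>) + DN (t *\<^sub>R \<tau>) \<bullet> N (\<gamma> 0))) (at 0)" .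
  have ev: "N (\<gamma> t) \<bullet> N (\<gamma> t) = 1" if "t \<in> {-e<..<e}" for t
    using N_unit[OF \<gamma>(3)[of t]] that by (simp add: norm_eq_1 abs_less_iff)
  have d2: "((\<lambda>t. N (\<gamma> t) \<bullet> N (\<gamma> t)) has_derivative (\<lambda>t. 0)) (at (0::real))"
    by (rule has_derivative_transform_within_open[of "\<lambda>t. 1" _ _ _ "{-e<..<e}"]) (use \<gamma>(1) ev in auto)
  have "(\<lambda>t. N (\<gamma> 0) \<bullet> DN (t *\<^sub>R \<tau>) + DN (t *\<^sub>R \<tau>) \<bullet> N (\<gamma> 0)) = (\<lambda>t. 0)"
    by (rule has_derivative_unique[OF d1 d2])
  from fun_cong[OF this, of 1] show ?thesis by (simp add: \<gamma>(2) inner_commute)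
qed

text \<open>Differentiate \<open>\<phi>\<close> along a curve in \<open>M\<close> whose velocity is
  its own tangential gradient: the function is 0 along the curve, so that gradient has length 0. The
  full gradient may survive, since the extension off \<open>M\<close> is arbitrary.\<close>

lemma tgrad_outside_support:
  assumes U: "\<And>x. x \<in> M \<Longrightarrow> GDERIV \<phi> x :> D\<phi> x"
    and K: "compact K" "\<And>x. x \<in> M - K \<Longrightarrow> \<phi> x = 0" and p: "p \<in> M - K"
  shows "tgrad (N p) (D\<phi> p) = 0"
proof -
  define \<tau> where "\<tau> = tgrad (N p) (D\<phi> p)"
  have pM: "p \<in> M" using p by simp
  have NN: "N p \<bullet> N p = 1" using N_unit[OF pM] by (simp add: norm_eq_1)
  have \<tau>: "N p \<bullet> \<tau> = 0"
    using NN by (simp add: \<tau>_def tgrad_def inner_diff_right inner_commute)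
  have "N p \<bullet> N p \<noteq> 0" using NN by simp
  then obtain \<gamma> u e where \<gamma>: "0 < e" "\<gamma> 0 = p" "\<And>t. \<bar>t\<bar> < e \<Longrightarrow> \<gamma> t \<in> M"
    and \<gamma>'0: "(\<gamma> has_vector_derivative (\<tau> - ((N p \<bullet> \<tau>) / (N p \<bullet> N p)) *\<^sub>R N p)) (at 0)"
    using hypersurface_curve[OF flat[OF pM] crossed[OF pM] pM, of "N p" \<tau>] by metis
  then have \<gamma>': "(\<gamma> has_vector_derivative \<tau>) (at 0)" by (simp add: \<tau>)
  have "isCont \<gamma> 0" using \<gamma>' by (rule has_vector_derivative_continuous)
  then have "\<forall>\<^sub>F t in nhds 0. \<gamma> t \<in> - K"
    using compact_imp_closed[OF K(1)] p \<gamma>(2) by (intro isCont_eventually_mem) auto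
  moreover have "\<forall>\<^sub>F t in nhds (0::real). \<bar>t\<bar> < e"
    using \<gamma>(1) by (rule eventually_nhds_0_abs_less)
  ultimately have ev: "\<forall>\<^sub>F t in nhds 0. \<phi> (\<gamma> t) = 0"
    by eventually_elim (use \<gamma>(3) K(2) in auto)
  have "((\<lambda>t. \<phi> (\<gamma> t)) has_real_derivative (D\<phi> p \<bullet> \<tau>)) (at 0)"
    using U[OF pM] \<gamma>(2) \<gamma>' by (rule GDERIV_along_curve)
  moreover have "((\<lambda>t. \<phi> (\<gamma> t)) has_real_derivative 0) (at 0)"
    using DERIV_cong_ev[OF refl ev refl, of 0] by simp
  ultimately have "D\<phi> p \<bullet> \<tau> = 0" by (rule DERIV_unique)
  then have "\<tau> \<bullet> D\<phi> p = 0" by (simp only: inner_commute)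
  moreover have "\<tau> \<bullet> \<tau> = \<tau> \<bullet> D\<phi> p - (D\<phi> p \<bullet> N p) * (N p \<bullet> \<tau>)"
    by (subst (2) \<tau>_def) (simp add: tgrad_def inner_diff_right inner_commute)
  ultimately show ?thesis using \<tau> by (simp add: \<tau>_def[symmetric])
qed

end

text \<open>\<open>G i j\<close> is the gradient of h x_i nu_j when \<open>d\<close> is the gradient
  of h and \<open>L\<close> the Jacobian of nu. Summing nu_j d_i - nu_i d_j over these products
  gives the tangential divergence of h x plus the terms where nu_j is differentiated, h (nu . L x -
  (x.nu) tr L); by \<open>Lt\<close> these amount to -h H (x.nu). The dimension drops from n + 1 to
  n through the diagonal terms i = j.\<close>

lemma sum_rot_divergence:
  fixes \<nu> x d :: "'a::euclidean_space" and L :: "'a \<Rightarrow> 'a" and h :: real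
  assumes dim: "DIM('a) = n + 1" and L: "linear L" and \<nu>: "\<nu> \<bullet> \<nu> = 1"
    and Lt: "\<nu> \<bullet> L x = (x \<bullet> \<nu>) * (\<nu> \<bullet> L \<nu>)"
  defines "G i j \<equiv> h *\<^sub>R ((x \<bullet> i) *\<^sub>R (\<Sum>k\<in>Basis. (L k \<bullet> j) *\<^sub>R k) + (\<nu> \<bullet> j) *\<^sub>R i) + ((x \<bullet> i) * (\<nu> \<bullet> j)) *\<^sub>R d"
  shows "(\<Sum>i\<in>Basis. \<Sum>j\<in>Basis. (\<nu> \<bullet> j) * (G i j \<bullet> i) - (\<nu> \<bullet> i) * (G i j \<bullet> j))
    = real n * h + d \<bullet> x - (d \<bullet> \<nu>) * (\<nu> \<bullet> x) - h * mean_curv \<nu> L * (x \<bullet> \<nu>)"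
proof -
  have Lg: "(\<Sum>k\<in>Basis. (L k \<bullet> j) *\<^sub>R k) \<bullet> i = L i \<bullet> j" if "i \<in> Basis" for i j
    using that by (simp add: inner_sum_left inner_Basis if_distrib cong: if_cong)
  have quad: "(\<Sum>i\<in>Basis. \<Sum>j\<in>Basis. (y \<bullet> i) * (z \<bullet> j) * (L i \<bullet> j)) = z \<bullet> L y" for y z
  proof -
    have "L y = L (\<Sum>i\<in>Basis. (y \<bullet> i) *\<^sub>R i)" by (simp add: euclidean_representation)
    also have "\<dots> = (\<Sum>i\<in>Basis. (y \<bullet> i) *\<^sub>R L i)"
      using L by (simp add: linear_sum linear_cmul)
    finally have "z \<bullet> L y = (\<Sum>i\<in>Basis. (y \<bullet> i) * (z \<bullet> L i))" by (simp add: inner_sum_right)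
    also have "\<dots> = (\<Sum>i\<in>Basis. \<Sum>j\<in>Basis. (y \<bullet> i) * (z \<bullet> j) * (L i \<bullet> j))"
      by (subst euclidean_inner[of z]) (simp add: sum_distrib_left mult.assoc)
    finally show ?thesis by simp
  qed
  have summand: "(\<nu> \<bullet> j) * (G i j \<bullet> i) - (\<nu> \<bullet> i) * (G i j \<bullet> j) =
      h * ((x \<bullet> i) * (\<nu> \<bullet> j) * (L i \<bullet> j)) + h * ((\<nu> \<bullet> j) * (\<nu> \<bullet> j)) + ((x \<bullet> i) * (d \<bullet> i)) * ((\<nu> \<bullet> j) * (\<nu> \<bullet> j))
      - h * (((\<nu> \<bullet> i) * (x \<bullet> i)) * (L j \<bullet> j)) - (if i = j then h * ((\<nu> \<bullet> i) * (\<nu> \<bullet> i)) else 0)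
      - ((\<nu> \<bullet> i) * (x \<bullet> i)) * ((\<nu> \<bullet> j) * (d \<bullet> j))" if ij: "i \<in> Basis" "j \<in> Basis" for i j
    using ij by (simp add: G_def inner_add_left Lg inner_Basis algebra_simps)
  have "(\<Sum>i\<in>Basis. \<Sum>j\<in>Basis. (\<nu> \<bullet> j) * (G i j \<bullet> i) - (\<nu> \<bullet> i) * (G i j \<bullet> j)) =
      h * (\<Sum>i\<in>Basis. \<Sum>j\<in>Basis. (x \<bullet> i) * (\<nu> \<bullet> j) * (L i \<bullet> j))
      + real DIM('a) * (h * (\<Sum>j\<in>Basis. (\<nu> \<bullet> j) * (\<nu> \<bullet> j)))
      + (\<Sum>i\<in>Basis. (x \<bullet> i) * (d \<bullet> i)) * (\<Sum>j\<in>Basis. (\<nu> \<bullet> j) * (\<nu> \<bullet> j))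
      - h * ((\<Sum>i\<in>Basis. (\<nu> \<bullet> i) * (x \<bullet> i)) * (\<Sum>j\<in>Basis. L j \<bullet> j))
      - h * (\<Sum>i\<in>Basis. (\<nu> \<bullet> i) * (\<nu> \<bullet> i))
      - (\<Sum>i\<in>Basis. (\<nu> \<bullet> i) * (x \<bullet> i)) * (\<Sum>j\<in>Basis. (\<nu> \<bullet> j) * (d \<bullet> j))"
    by (simp add: summand sum.distrib sum_subtractf sum_distrib_left[symmetric] sum_distrib_right[symmetric]
        cong: sum.cong)
  also have "\<dots> = h * (\<nu> \<bullet> L x) + real (n + 1) * h + x \<bullet> d - h * ((\<nu> \<bullet> x) * (\<Sum>j\<in>Basis. L j \<bullet> j)) - h
      - (\<nu> \<bullet> x) * (\<nu> \<bullet> d)"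
    unfolding quad euclidean_inner[symmetric] \<nu> dim by simp
  also have "\<dots> = real n * h + d \<bullet> x - (d \<bullet> \<nu>) * (\<nu> \<bullet> x)
      - h * ((\<Sum>j\<in>Basis. L j \<bullet> j) - \<nu> \<bullet> L \<nu>) * (x \<bullet> \<nu>)"
    unfolding Lt by (simp add: inner_commute algebra_simps)
  also have "(\<Sum>j\<in>Basis. L j \<bullet> j) - \<nu> \<bullet> L \<nu> = mean_curv \<nu> L"
  proof -
    have "\<nu> \<bullet> L \<nu> = (\<Sum>i\<in>Basis. (\<nu> \<bullet> i) * (\<Sum>j\<in>Basis. (L j \<bullet> i) * (\<nu> \<bullet> j)))"
      unfolding quad[symmetric] by (subst sum.swap) (simp add: sum_distrib_left ac_simps)
    then show ?thesis by (simp add: mean_curv_def sum_subtractf)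
  qed
  finally show ?thesis .
qed

text \<open>The rotation formula is applied to h x_i N_j for each pair of basis vectors; the sum
  over all pairs is the radial divergence pointwise on \<open>K\<close>.\<close>

lemma (in unit_normal_hypersurface) divergence_radial:
  assumes V: "open V" "M \<subseteq> V"
    and DN: "\<And>x. x \<in> V \<Longrightarrow> (N has_derivative DN x) (at x)"
    and DN_cont: "\<And>v. continuous_on V (\<lambda>x. DN x v)"
    and test: "test_function M h Dh W K"
  shows "(LINT x|H. indicator K x * (real n * h x + Dh x \<bullet> x - (Dh x \<bullet> N x) * (N x \<bullet> x)
      - h x * mean_curv (N x) (DN x) * (x \<bullet> N x))) = 0"
proof -
  have W: "open W" and K: "compact K" "K \<subseteq> M" "K \<subseteq> W" and h: "\<And>x. x \<in> W \<Longrightarrow> GDERIV h x :> Dh x"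
    and Dh: "continuous_on W Dh" and h0: "\<And>x. x \<in> M \<Longrightarrow> x \<in> W \<Longrightarrow> x \<notin> K \<Longrightarrow> h x = 0"
    using test unfolding test_function_def by blast+
  define F where "F i j x = h x * ((x \<bullet> i) * (N x \<bullet> j))" for i j x
  define DF where "DF i j x = h x *\<^sub>R ((x \<bullet> i) *\<^sub>R (\<Sum>k\<in>Basis. (DN x k \<bullet> j) *\<^sub>R k) + (N x \<bullet> j) *\<^sub>R i)
      + ((x \<bullet> i) * (N x \<bullet> j)) *\<^sub>R Dh x" for i j x
  have F': "GDERIV (F i j) x :> DF i j x" if x: "x \<in> W \<inter> V" for i j x
  proof -
    have lin: "linear (DN x)" using DN[of x] x by (auto intro: has_derivative_linear)
    have adj: "DN x v \<bullet> j = v \<bullet> (\<Sum>k\<in>Basis. (DN x k \<bullet> j) *\<^sub>R k)" for v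
    proof -
      have "DN x v = DN x (\<Sum>k\<in>Basis. (v \<bullet> k) *\<^sub>R k)" by (simp add: euclidean_representation)
      also have "\<dots> = (\<Sum>k\<in>Basis. (v \<bullet> k) *\<^sub>R DN x k)" using lin by (simp add: linear_sum linear_cmul)
      finally show ?thesis by (simp add: inner_sum_left inner_sum_right mult.commute)
    qed
    have "((\<lambda>x. N x \<bullet> j) has_derivative (\<lambda>v. DN x v \<bullet> j)) (at x)"
      using DN[of x] x by (intro has_derivative_inner_left) auto
    then have "GDERIV (\<lambda>x. N x \<bullet> j) x :> (\<Sum>k\<in>Basis. (DN x k \<bullet> j) *\<^sub>R k)"
      unfolding gderiv_def by (rule has_derivative_eq_rhs) (rule ext, rule adj)
    moreover have "GDERIV (\<lambda>x. x \<bullet> i) x :> i"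
      unfolding gderiv_def by (auto intro!: derivative_eq_intros)
    ultimately show ?thesis
      unfolding F_def[abs_def] DF_def using x h by (intro GDERIV_mult) auto
  qed
  have N_contV: "continuous_on V N"
    by (intro continuous_at_imp_continuous_on ballI) (use DN has_derivative_continuous in blast)
  have DF_cont: "continuous_on (W \<inter> V) (DF i j)" for i j
    unfolding DF_def[abs_def]
    by (intro continuous_intros) (auto intro: continuous_on_subset[OF DN_cont] continuous_on_subset[OF N_contV]
        continuous_on_subset[OF Dh] continuous_on_subset[OF GDERIV_imp_continuous_on[OF h]])
  have testij: "test_function M (F i j) (DF i j) (W \<inter> V) K" for i j
    unfolding test_function_def using W V K F' DF_cont h0 by (auto simp: F_def)
  have int: "integrable H (\<lambda>x. indicator K x * rot j i (DF i j) x)" for i j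
    using K V(2) by (intro integrable_compact rot_continuous continuous_on_subset[OF DF_cont]) auto
  have pointwise: "indicator K x * (real n * h x + Dh x \<bullet> x - (Dh x \<bullet> N x) * (N x \<bullet> x)
      - h x * mean_curv (N x) (DN x) * (x \<bullet> N x)) = (\<Sum>i\<in>Basis. \<Sum>j\<in>Basis. indicator K x * rot j i (DF i j) x)" for x
  proof (cases "x \<in> K")
    case True
    then have xM: "x \<in> M" and xV: "x \<in> V" using K V by auto
    have lin: "linear (DN x)" using DN[OF xV] by (rule has_derivative_linear)
    have NN: "N x \<bullet> N x = 1" using N_unit[OF xM] by (simp add: norm_eq_1)
    \<comment> \<open>The tangential part of \<open>x\<close> contributes nothing to the normal
      component of the derivative; what remains is the hypothesis \<open>Lt\<close> of
      \<open>sum_rot_divergence\<close>.\<close>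
    have "N x \<bullet> DN x (x - (x \<bullet> N x) *\<^sub>R N x) = 0"
      by (rule normal_derivative_tangential[OF xM DN[OF xV]])
         (simp add: inner_diff_right NN inner_commute)
    then have "N x \<bullet> DN x x = (x \<bullet> N x) * (N x \<bullet> DN x (N x))"
      using lin by (simp add: linear_diff linear_cmul inner_diff_right)
    from sum_rot_divergence[OF dim lin NN this, of "h x" "Dh x"] True
    show ?thesis by (simp add: rot_def DF_def)
  qed simp
  have "(LINT x|H. (\<Sum>i\<in>Basis. \<Sum>j\<in>Basis. indicator K x * rot j i (DF i j) x))
      = (\<Sum>i\<in>Basis. \<Sum>j\<in>Basis. LINT x|H. indicator K x * rot j i (DF i j) x)"
    by (subst Bochner_Integration.integral_sum;
        (intro Bochner_Integration.integrable_sum int sum.cong refl Bochner_Integration.integral_sum)?)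
  also have "\<dots> = 0" using rot_integral_zero[OF testij] by simp
  finally show ?thesis unfolding pointwise .
qed

section \<open>Integrability of the singular weight at the origin\<close>

lemma (in unit_normal_hypersurface) AE_nonzero: "AE x in H. x \<noteq> 0"
proof -
  have "emeasure H {0} = 0" using n_pos by (simp add: emeasure_H hausdorff_outer_singleton)
  then show ?thesis by (intro AE_I[of _ _ "{0}"]) auto
qed

lemma ex_dyadic:
  fixes s r :: real
  assumes "0 < s" "s \<le> r"
  obtains k :: nat where "r / 2 ^ Suc k < s" "s \<le> r / 2 ^ k"
proof -
  obtain m where "(1 / 2) ^ m < s / r" using real_arch_pow_inv[of "s / r" "1 / 2"] assms by auto
  then have ex: "r / 2 ^ m < s" using assms by (simp add: field_simps power_one_over)
  define m0 where "m0 = (LEAST m. r / 2 ^ m < s)"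
  have m0: "r / 2 ^ m0 < s" unfolding m0_def using ex by (rule LeastI)
  then obtain k where k: "m0 = Suc k" using assms by (cases m0) auto
  then have "\<not> r / 2 ^ k < s" unfolding m0_def using not_less_Least[of k "\<lambda>m. r / 2 ^ m < s"] by simp
  then show thesis using that m0 k by auto
qed

text \<open>Away from the origin the weight is continuous. Near it, a dyadic decomposition and the
  growth bound s^n give a geometric series of ratio 2^(a - n), convergent because
  \<open>a < n\<close>.\<close>

lemma (in unit_normal_hypersurface) integrable_norm_powr:
  assumes a: "0 \<le> a" "a < real n" and K: "compact K" "K \<subseteq> M"
  shows "integrable H (\<lambda>x. indicator K x * norm x powr (- a))"
proof -
  have away: "integrable H (\<lambda>x. indicator K' x * norm x powr (- a))"
    if "compact K'" "K' \<subseteq> M" "0 \<notin> K'" for K'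
    using that by (intro integrable_compact continuous_intros) auto
  show ?thesis
  proof (cases "0 \<in> K")
    case True
    then obtain r C where r: "0 < r" "0 \<le> C" "compact (M \<inter> cball 0 r)"
      and growth: "\<And>s. 0 < s \<Longrightarrow> s \<le> r \<Longrightarrow> emeasure H (M \<inter> cball 0 s) \<le> ennreal (C * s ^ n)"
      using hausdorff_growth[of 0] K(2) by blast
    define B where "B k = M \<inter> cball 0 (r / 2 ^ k)" for k :: nat
    have rk: "0 < r / 2 ^ k" "r / 2 ^ k \<le> r" for k :: nat using r(1) by (auto simp: divide_le_eq)
    have Bm [measurable]: "B k \<in> sets borel" for k
    proof -
      have "B k = (M \<inter> cball 0 r) \<inter> cball 0 (r / 2 ^ k)" using rk[of k] by (auto simp: B_def)
      then show ?thesis using r(3) by (metis compact_Int_closed closed_cball borel_compact)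
    qed
    \<comment> \<open>An upper bound for the weight outside the inner radius of the k-th dyadic
      shell.\<close>
    define c where "c k = (r / 2 ^ Suc k) powr (- a)" for k :: nat
    have inner: "integrable H (\<lambda>x. indicator (B 0) x * norm x powr (- a))"
    proof (rule integrableI_nonneg)
      \<comment> \<open>Full balls stand in for the shells, and a point uses only the term of its
        own shell. At the origin the left-hand side is 0 because
        \<open>0 powr (- a) = 0\<close>.\<close>
      have pt: "ennreal (indicator (B 0) x * norm x powr (- a)) \<le> (\<Sum>k. ennreal (c k) * indicator (B k) x)" for x
      proof (cases "x \<in> B 0 \<and> x \<noteq> 0")
        case True
        then have "0 < norm x" "norm x \<le> r" by (auto simp: B_def)
        then obtain k :: nat where k: "r / 2 ^ Suc k < norm x" "norm x \<le> r / 2 ^ k" by (rule ex_dyadic)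
        have "norm x powr (- a) \<le> c k"
          unfolding c_def using k rk[of "Suc k"] a(1) by (intro powr_mono2') auto
        then have "ennreal (indicator (B 0) x * norm x powr (- a)) \<le> ennreal (c k) * indicator (B k) x"
          using True k(2) by (auto simp: B_def intro!: ennreal_leI)
        also have "\<dots> \<le> (\<Sum>k. ennreal (c k) * indicator (B k) x)"
        proof -
          define g where "g k = ennreal (c k) * indicator (B k) x" for k
          have "sum g {k} \<le> suminf g" by (rule sum_le_suminf) auto
          then show ?thesis by (simp add: g_def[symmetric])
        qed
        finally show ?thesis .
      qed auto
      have summand: "ennreal (c k) * emeasure H (B k) \<le> ennreal (C * r powr (real n - a) * 2 powr a * (2 powr (a - real n)) ^ k)" for k
      proof -
        have "ennreal (c k) * emeasure H (B k) \<le> ennreal (c k) * ennreal (C * (r / 2 ^ k) ^ n)"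
          unfolding B_def using growth[OF rk] by (rule mult_left_mono) simp
        also have "\<dots> = ennreal (c k * (C * (r / 2 ^ k) ^ n))"
          using r by (simp add: ennreal_mult c_def)
        also have "c k * (C * (r / 2 ^ k) ^ n) = C * r powr (real n - a) * 2 powr a * (2 powr (a - real n)) ^ k"
        proof -
          have dyadic: "r / 2 ^ j = r * 2 powr (- real j)" for j :: nat
            by (simp add: powr_minus_divide powr_realpow)
          have "(r / 2 ^ k) ^ n = (r * 2 powr (- real k)) powr real n"
            using r(1) unfolding dyadic by (subst powr_realpow) auto
          then have "(r / 2 ^ k) ^ n = r powr real n * 2 powr (- real n * real k)"
            using r(1) by (simp add: powr_mult powr_powr mult.commute)
          moreover have "c k = r powr (- a) * 2 powr (a * (real k + 1))"
            using r(1) unfolding c_def dyadic by (simp add: powr_mult powr_powr algebra_simps)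
          moreover have "(2 powr (a - real n)) ^ k = 2 powr ((a - real n) * real k)"
            by (simp add: powr_powr powr_realpow[symmetric])
          moreover have "r powr (- a) * r powr real n = r powr (real n - a)"
            by (simp add: powr_add[symmetric])
          moreover have "2 powr (a * (real k + 1)) * 2 powr (- real n * real k) = 2 powr a * 2 powr ((a - real n) * real k)"
            by (simp add: powr_add[symmetric] algebra_simps)
          ultimately show ?thesis by (simp add: mult.assoc mult.left_commute)
        qed
        finally show ?thesis .
      qed
      have q: "2 powr (a - real n) < 1" using a(2) by (simp add: powr_less_one)
      have "(\<integral>\<^sup>+x. ennreal (indicator (B 0) x * norm x powr (- a)) \<partial>H)
          \<le> (\<integral>\<^sup>+x. (\<Sum>k. ennreal (c k) * indicator (B k) x) \<partial>H)"
        by (intro nn_integral_mono pt)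
      also have "\<dots> = (\<Sum>k. ennreal (c k) * emeasure H (B k))"
        by (subst nn_integral_suminf) (auto simp: nn_integral_cmult_indicator)
      also have "\<dots> \<le> (\<Sum>k. ennreal (C * r powr (real n - a) * 2 powr a * (2 powr (a - real n)) ^ k))"
        by (intro suminf_le summand) auto
      also have "\<dots> < \<infinity>"
        using q r by (subst suminf_ennreal2) (auto intro!: summable_mult summable_geometric)
      finally show "(\<integral>\<^sup>+x. ennreal (indicator (B 0) x * norm x powr (- a)) \<partial>H) < \<infinity>" .
    qed auto
    define K' where "K' = K - ball 0 r"
    have K': "compact K'" "K' \<subseteq> M" "0 \<notin> K'"
      using K r(1) by (auto simp: K'_def intro: compact_diff)
    show ?thesis
    proof (rule Bochner_Integration.integrable_bound)
      show "integrable H (\<lambda>x. indicator (B 0) x * norm x powr (- a) + indicator K' x * norm x powr (- a))"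
        using inner away[OF K'] by simp
      have "indicator K x * norm x powr (- a) \<le> indicator (B 0) x * norm x powr (- a) + indicator K' x * norm x powr (- a)" for x
        using K(2) by (auto simp: indicator_def K'_def B_def)
      then show "AE x in H. norm (indicator K x * norm x powr (- a)) \<le>
          norm (indicator (B 0) x * norm x powr (- a) + indicator K' x * norm x powr (- a))"
        by (simp add: abs_of_nonneg)
      show "(\<lambda>x. indicator K x * norm x powr (- a)) \<in> borel_measurable H"
        using borel_compact[OF K(1)] by measurable
    qed
  qed (use away K in auto)
qed

section \<open>The weighted inequality\<close>

context unit_normal_hypersurface
begin

text \<open>The exponent may be negative, as for \<open>a - 2\<close> with \<open>a < 2\<close>; the
  weight is then a positive power of the norm and bounded on \<open>K\<close>.\<close>

lemma integrable_weight:
  fixes c :: "'a \<Rightarrow> real"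
  assumes e: "e < real n" and K: "compact K" "K \<subseteq> M" and c: "continuous_on K c"
  shows "integrable H (\<lambda>x. indicator K x * (norm x powr (- e) * c x))"
proof -
  have [measurable]: "K \<in> sets borel" using K(1) by (rule borel_compact)
  have "(\<lambda>x. indicator K x *\<^sub>R c x) \<in> borel_measurable borel"
    by (intro borel_measurable_continuous_on_indicator c) measurable
  then have [measurable]: "(\<lambda>x. indicator K x * c x) \<in> borel_measurable borel" by simp
  have "bounded (c ` K)" using K c by (intro compact_imp_bounded compact_continuous_image)
  then obtain B where B: "\<And>x. x \<in> K \<Longrightarrow> \<bar>c x\<bar> \<le> B" by (auto simp: bounded_iff)
  have w: "integrable H (\<lambda>x. indicator K x * norm x powr (- e))"
  proof (cases "0 \<le> e")
    case True
    then show ?thesis by (rule integrable_norm_powr[OF _ e K])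
  next
    case False
    obtain R where R: "\<And>x. x \<in> K \<Longrightarrow> norm x \<le> R" using compact_imp_bounded[OF K(1)] by (auto simp: bounded_iff)
    show ?thesis
    proof (rule integrableI_bounded_set[where A = K and B = "R powr (- e)"])
      show "AE x in H. x \<in> K \<longrightarrow> norm (indicator K x * norm x powr (- e)) \<le> R powr (- e)"
        using R False by (intro AE_I2) (auto intro!: powr_mono2)
    qed (use emeasure_compact[OF K] in auto)
  qed
  have eq: "indicator K x * (norm x powr (- e) * c x) = (indicator K x * norm x powr (- e)) * (indicator K x * c x)" for x
    by (simp add: indicator_def)
  show ?thesis
  proof (rule Bochner_Integration.integrable_bound)
    show "integrable H (\<lambda>x. B * (indicator K x * norm x powr (- e)))" using w by simp
    show "(\<lambda>x. indicator K x * (norm x powr (- e) * c x)) \<in> borel_measurable H"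
      unfolding eq by measurable
    show "AE x in H. norm (indicator K x * (norm x powr (- e) * c x)) \<le> norm (B * (indicator K x * norm x powr (- e)))"
    proof (rule AE_I2)
      fix x
      show "norm (indicator K x * (norm x powr (- e) * c x)) \<le> norm (B * (indicator K x * norm x powr (- e)))"
      proof (cases "x \<in> K")
        case True
        then have "\<bar>c x\<bar> \<le> \<bar>B\<bar>" using B by force
        then show ?thesis using True by (simp add: abs_mult mult.commute mult_right_mono)
      qed simp
    qed
  qed
qed

text \<open>The regularisation tends to 0 along 1/(k + 1), with a fixed multiple of |x|^(-a) on
  \<open>K\<close> as dominating function. The origin, where pointwise convergence may fail, is a
  null set.\<close>

lemma integral_regularized_limit:
  fixes P Q :: "'a \<Rightarrow> real"
  assumes a: "0 \<le> a" "a < real n" and K: "compact K" "K \<subseteq> M"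
    and P: "continuous_on K P" and Q: "continuous_on K Q"
    and zero: "\<And>\<epsilon>. 0 < \<epsilon> \<Longrightarrow> (LINT x|H. indicator K x * (P x * (x \<bullet> x + \<epsilon>) powr (- a / 2)
        - Q x * (x \<bullet> x + \<epsilon>) powr (- a / 2 - 1) * (x \<bullet> x - (x \<bullet> N x)\<^sup>2))) = 0"
  shows "(LINT x|H. indicator K x * (norm x powr (- a) * (P x - Q x * (1 - ((x /\<^sub>R norm x) \<bullet> N x)\<^sup>2)))) = 0"
proof -
  have [measurable]: "K \<in> sets borel" using K(1) by (rule borel_compact)
  \<comment> \<open>The data are continuous only on \<open>K\<close>; cutting them off there gives
    Borel functions on the whole space.\<close>
  define PK where "PK x = indicator K x * P x" for x
  define QK where "QK x = indicator K x * Q x" for x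
  define w where "w x = indicator K x * (x \<bullet> N x)" for x
  have ind: "(\<lambda>x. indicator K x * f x) \<in> borel_measurable borel" if "continuous_on K f" for f :: "'a \<Rightarrow> real"
    using borel_measurable_continuous_on_indicator[OF _ that] by simp
  have [measurable]: "PK \<in> borel_measurable borel" "QK \<in> borel_measurable borel" "w \<in> borel_measurable borel"
    unfolding PK_def[abs_def] QK_def[abs_def] w_def[abs_def]
    by (intro ind P Q continuous_intros continuous_on_subset[OF N_cont] K)+
  define f where "f k x = PK x * (x \<bullet> x + 1 / real (Suc k)) powr (- a / 2)
        - QK x * (x \<bullet> x + 1 / real (Suc k)) powr (- a / 2 - 1) * (x \<bullet> x - (w x)\<^sup>2)" for k x
  define g where "g x = norm x powr (- a) * (PK x - QK x * (1 - (w x / norm x)\<^sup>2))" for x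
  have fm [measurable]: "f k \<in> borel_measurable borel" for k unfolding f_def[abs_def] by measurable
  have gm [measurable]: "g \<in> borel_measurable borel" unfolding g_def[abs_def] by measurable
  have f0: "(LINT x|H. f k x) = 0" for k
  proof -
    have "f k x = indicator K x * (P x * (x \<bullet> x + 1 / real (Suc k)) powr (- a / 2)
        - Q x * (x \<bullet> x + 1 / real (Suc k)) powr (- a / 2 - 1) * (x \<bullet> x - (x \<bullet> N x)\<^sup>2))" for x
      by (cases "x \<in> K") (simp_all add: f_def PK_def QK_def w_def)
    then show ?thesis using zero[of "1 / real (Suc k)"] by simp
  qed
  have wx: "(w x)\<^sup>2 \<le> x \<bullet> x" for x
  proof (cases "x \<in> K")
    case True
    then have "norm (N x) = 1" using N_unit K(2) by blast
    then have "\<bar>w x\<bar> \<le> norm x" using Cauchy_Schwarz_ineq2[of x "N x"] True by (simp add: w_def)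
    then have "\<bar>w x\<bar>\<^sup>2 \<le> (norm x)\<^sup>2" by (rule power_mono) simp
    then show ?thesis by (simp add: power2_norm_eq_inner)
  qed (simp add: w_def)
  have "bounded (P ` K)" "bounded (Q ` K)"
    using K P Q by (auto intro!: compact_imp_bounded compact_continuous_image)
  then obtain B C where BC: "\<And>x. x \<in> K \<Longrightarrow> \<bar>P x\<bar> \<le> B" "\<And>x. x \<in> K \<Longrightarrow> \<bar>Q x\<bar> \<le> C"
    by (auto simp: bounded_iff)
  have npow: "norm x powr (- a) = (x \<bullet> x) powr (- a / 2)"
    "norm x powr (- a) = (x \<bullet> x) powr (- a / 2 - 1) * (x \<bullet> x)" if "x \<noteq> 0" for x :: 'a
  proof -
    have "x \<bullet> x = norm x powr 2" using that by (simp add: power2_norm_eq_inner[symmetric] powr_numeral)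
    then show *: "norm x powr (- a) = (x \<bullet> x) powr (- a / 2)" by (simp only: powr_powr) simp
    have "(x \<bullet> x) powr (- a / 2) = (x \<bullet> x) powr ((- a / 2 - 1) + 1)" by simp
    also have "\<dots> = (x \<bullet> x) powr (- a / 2 - 1) * (x \<bullet> x)"
      unfolding powr_add using that by simp
    finally show "norm x powr (- a) = (x \<bullet> x) powr (- a / 2 - 1) * (x \<bullet> x)" using * by simp
  qed
  have "(\<lambda>k. LINT x|H. f k x) \<longlonglongrightarrow> (LINT x|H. g x)"
  proof (rule integral_dominated_convergence[where w = "\<lambda>x. (B + C) * (indicator K x * norm x powr (- a))"])
    show "integrable H (\<lambda>x. (B + C) * (indicator K x * norm x powr (- a)))"
      using integrable_norm_powr[OF a K] by simp
    show "AE x in H. (\<lambda>k. f k x) \<longlonglongrightarrow> g x"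
      using AE_nonzero
    proof eventually_elim
      case (elim x)
      have xx: "x \<bullet> x \<noteq> 0" using elim by simp
      have "(\<lambda>k. x \<bullet> x + inverse (real (Suc k))) \<longlonglongrightarrow> x \<bullet> x + 0"
        by (intro tendsto_intros LIMSEQ_inverse_real_of_nat)
      then have s: "(\<lambda>k. x \<bullet> x + 1 / real (Suc k)) \<longlonglongrightarrow> x \<bullet> x" by (simp add: inverse_eq_divide)
      have lim: "(\<lambda>k. f k x) \<longlonglongrightarrow> PK x * (x \<bullet> x) powr (- a / 2) - QK x * (x \<bullet> x) powr (- a / 2 - 1) * (x \<bullet> x - (w x)\<^sup>2)"
        unfolding f_def by (intro tendsto_intros s) (use xx in auto)
      have e: "(x \<bullet> x) powr (- a / 2 - 1) * (x \<bullet> x - (w x)\<^sup>2) = norm x powr (- a) * (1 - (w x / norm x)\<^sup>2)"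
        unfolding npow(2)[OF elim] using elim
        by (simp add: power_divide power2_norm_eq_inner field_simps)
      show ?case
        using lim unfolding mult.assoc e npow(1)[OF elim, symmetric] g_def by (simp add: algebra_simps)
    qed
    show "AE x in H. norm (f k x) \<le> (B + C) * (indicator K x * norm x powr (- a))" for k
      using AE_nonzero
    proof eventually_elim
      case (elim x)
      show ?case
      proof (cases "x \<in> K")
        case True
        let ?s = "x \<bullet> x + 1 / real (Suc k)"
        have xx: "0 < x \<bullet> x" using elim by simp
        have s: "x \<bullet> x \<le> ?s" by simp
        have le: "?s powr (- a / 2) \<le> norm x powr (- a)"
          unfolding npow(1)[OF elim] using a(1) xx s by (intro powr_mono2') auto
        have "\<bar>x \<bullet> x - (w x)\<^sup>2\<bar> \<le> x \<bullet> x" using wx[of x] by simp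
        \<comment> \<open>The squared tangential length of \<open>x\<close> is at most
          \<open>?s\<close>, which compensates the extra negative power, so both terms have the same
          dominating function.\<close>
        then have "?s powr (- a / 2 - 1) * \<bar>x \<bullet> x - (w x)\<^sup>2\<bar> \<le> ?s powr (- a / 2 - 1) * ?s"
          using s by (intro mult_left_mono powr_ge_zero) (rule order.trans)
        also have "\<dots> = ?s powr (- a / 2)"
        proof -
          have "?s powr (- a / 2) = ?s powr ((- a / 2 - 1) + 1)" by simp
          also have "\<dots> = ?s powr (- a / 2 - 1) * ?s"
            unfolding powr_add using xx s by (simp add: add_nonneg_nonneg)
          finally show ?thesis by simp
        qed
        finally have 2: "?s powr (- a / 2 - 1) * \<bar>x \<bullet> x - (w x)\<^sup>2\<bar> \<le> norm x powr (- a)" using le by linarith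
        have "norm (f k x) \<le> \<bar>P x\<bar> * ?s powr (- a / 2) + \<bar>Q x\<bar> * (?s powr (- a / 2 - 1) * \<bar>x \<bullet> x - (w x)\<^sup>2\<bar>)"
          using True abs_triangle_ineq4[of "P x * ?s powr (- a / 2)" "Q x * ?s powr (- a / 2 - 1) * (x \<bullet> x - (w x)\<^sup>2)"]
          by (simp add: f_def PK_def QK_def abs_mult mult.assoc)
        also have "\<dots> \<le> B * norm x powr (- a) + C * norm x powr (- a)"
          using BC[OF True] le 2 abs_ge_zero[of "P x"] abs_ge_zero[of "Q x"] by (intro add_mono mult_mono) auto
        finally show ?thesis using True by (simp add: distrib_right)
      qed (simp add: f_def PK_def QK_def)
    qed
  qed (auto simp: measurable_cong_sets[OF sets_H refl])
  then have "(LINT x|H. g x) = 0" unfolding f0 by (simp add: LIMSEQ_const_iff)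
  moreover have "g x = indicator K x * (norm x powr (- a) * (P x - Q x * (1 - ((x /\<^sub>R norm x) \<bullet> N x)\<^sup>2)))" for x
    by (cases "x \<in> K") (simp_all add: g_def PK_def QK_def w_def divide_inverse mult.commute)
  ultimately show ?thesis by simp
qed

text \<open>The divergence formula is used with phi^2 times the regularised weight. Differentiating
  the weight produces the factor -a with the squared tangential part of \<open>x\<close>;
  differentiating phi^2 produces the gradient term of \<open>R\<close>.\<close>

lemma weighted_identity:
  fixes \<phi> :: "'a \<Rightarrow> real" and D\<phi> :: "'a \<Rightarrow> 'a"
  assumes a: "0 \<le> a" "a < real n"
    and V: "open V" "M \<subseteq> V"
    and DN: "\<And>x. x \<in> V \<Longrightarrow> (N has_derivative DN x) (at x)"
    and DN_cont: "\<And>v. continuous_on V (\<lambda>x. DN x v)"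
    and test: "test_function M \<phi> D\<phi> U K"
  defines "R x \<equiv> \<phi> x * (mean_curv (N x) (DN x) * \<phi> x * (x \<bullet> N x) - 2 * (tgrad (N x) (D\<phi> x) \<bullet> x))"
  shows "(LINT x|H. indicator K x * (norm x powr (- a) *
      (real n * (\<phi> x)\<^sup>2 - R x - a * (\<phi> x)\<^sup>2 * (1 - ((x /\<^sub>R norm x) \<bullet> N x)\<^sup>2)))) = 0"
    and "continuous_on K R"
    and "continuous_on K (\<lambda>x. 4 * (norm (tgrad (N x) (D\<phi> x)))\<^sup>2 + \<bar>mean_curv (N x) (DN x) * \<phi> x\<bar>\<^sup>2)"
proof -
  have U: "open U" and K: "compact K" "K \<subseteq> M" "K \<subseteq> U" and \<phi>': "\<And>x. x \<in> U \<Longrightarrow> GDERIV \<phi> x :> D\<phi> x"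
    and D\<phi>: "continuous_on U D\<phi>" and \<phi>0: "\<And>x. x \<in> M \<Longrightarrow> x \<in> U \<Longrightarrow> x \<notin> K \<Longrightarrow> \<phi> x = 0"
    using test unfolding test_function_def by blast+
  have \<phi>_cont: "continuous_on U \<phi>" by (rule GDERIV_imp_continuous_on[OF \<phi>'])
  have cK: "continuous_on K \<phi>" "continuous_on K D\<phi>" "continuous_on K N" "\<And>v. continuous_on K (\<lambda>x. DN x v)"
    using K V by (auto intro: continuous_on_subset[OF \<phi>_cont] continuous_on_subset[OF D\<phi>]
        continuous_on_subset[OF N_cont] continuous_on_subset[OF DN_cont])
  have Hc: "continuous_on K (\<lambda>x. mean_curv (N x) (DN x))"
    unfolding mean_curv_def by (intro continuous_intros cK)
  have tg: "continuous_on K (\<lambda>x. tgrad (N x) (D\<phi> x))"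
    unfolding tgrad_def by (intro continuous_intros cK)
  show R: "continuous_on K R"
    unfolding R_def by (intro continuous_intros cK Hc tg)
  show "continuous_on K (\<lambda>x. 4 * (norm (tgrad (N x) (D\<phi> x)))\<^sup>2 + \<bar>mean_curv (N x) (DN x) * \<phi> x\<bar>\<^sup>2)"
    by (intro continuous_intros cK Hc tg)
  show "(LINT x|H. indicator K x * (norm x powr (- a) *
      (real n * (\<phi> x)\<^sup>2 - R x - a * (\<phi> x)\<^sup>2 * (1 - ((x /\<^sub>R norm x) \<bullet> N x)\<^sup>2)))) = 0"
  proof (rule integral_regularized_limit[OF a K(1,2)])
    show "continuous_on K (\<lambda>x. real n * (\<phi> x)\<^sup>2 - R x)" "continuous_on K (\<lambda>x. a * (\<phi> x)\<^sup>2)"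
      by (intro continuous_intros cK R)+
    fix \<epsilon> :: real assume \<epsilon>: "0 < \<epsilon>"
    \<comment> \<open>Strictly positive, so \<open>h\<close> is of class C^1 even when
      \<open>M\<close> passes through the origin.\<close>
    define s where "s x = x \<bullet> x + \<epsilon>" for x :: 'a
    have s: "0 < s x" for x using \<epsilon> by (simp add: s_def add_nonneg_pos)
    define h where "h x = (\<phi> x)\<^sup>2 * s x powr (- a / 2)" for x
    define Dh where "Dh x = (\<phi> x)\<^sup>2 *\<^sub>R ((- a / 2 * s x powr (- a / 2 - 1)) *\<^sub>R (2 *\<^sub>R x))
        + (s x powr (- a / 2)) *\<^sub>R ((2 * \<phi> x) *\<^sub>R D\<phi> x)" for x
    have h': "GDERIV h x :> Dh x" if x: "x \<in> U" for x
    proof -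
      have "GDERIV s x :> 2 *\<^sub>R x"
        unfolding s_def[abs_def] gderiv_def by (auto intro!: derivative_eq_intros simp: inner_commute)
      moreover have "DERIV (\<lambda>t. t powr (- a / 2)) (s x) :> - a / 2 * s x powr (- a / 2 - 1)"
        by (rule has_real_derivative_powr[OF s])
      ultimately have 1: "GDERIV (\<lambda>x. s x powr (- a / 2)) x :> (- a / 2 * s x powr (- a / 2 - 1)) *\<^sub>R (2 *\<^sub>R x)"
        by (rule GDERIV_DERIV_compose)
      have "DERIV (\<lambda>t. t\<^sup>2) (\<phi> x) :> 2 * \<phi> x" by (auto intro!: derivative_eq_intros)
      then have 2: "GDERIV (\<lambda>x. (\<phi> x)\<^sup>2) x :> (2 * \<phi> x) *\<^sub>R D\<phi> x"
        by (rule GDERIV_DERIV_compose[OF \<phi>'[OF x]])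
      show ?thesis unfolding h_def[abs_def] Dh_def by (rule GDERIV_mult[OF 2 1])
    qed
    have Dh_cont: "continuous_on U Dh"
      unfolding Dh_def[abs_def] using s
      by (intro continuous_intros \<phi>_cont D\<phi>) (auto simp: s_def less_imp_neq[THEN not_sym] intro!: continuous_intros)
    have "test_function M h Dh U K"
      unfolding test_function_def using U K h' Dh_cont \<phi>0 by (auto simp: h_def)
    from divergence_radial[OF V DN DN_cont this]
    have "(LINT x|H. indicator K x * (real n * h x + Dh x \<bullet> x - (Dh x \<bullet> N x) * (N x \<bullet> x)
        - h x * mean_curv (N x) (DN x) * (x \<bullet> N x))) = 0" .
    moreover have "real n * h x + Dh x \<bullet> x - (Dh x \<bullet> N x) * (N x \<bullet> x) - h x * mean_curv (N x) (DN x) * (x \<bullet> N x)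
      = (real n * (\<phi> x)\<^sup>2 - R x) * s x powr (- a / 2) - a * (\<phi> x)\<^sup>2 * s x powr (- a / 2 - 1) * (x \<bullet> x - (x \<bullet> N x)\<^sup>2)" for x
    proof -
      define p q where "p = s x powr (- a / 2)" and "q = s x powr (- a / 2 - 1)"
      have Dh_eq: "Dh x \<bullet> y = - a * (\<phi> x)\<^sup>2 * q * (x \<bullet> y) + 2 * \<phi> x * p * (D\<phi> x \<bullet> y)" for y
        by (simp add: Dh_def p_def q_def inner_add_left inner_diff_left algebra_simps)
      have comm: "N x \<bullet> x = x \<bullet> N x" by (rule inner_commute)
      have tg_eq: "tgrad (N x) (D\<phi> x) \<bullet> x = D\<phi> x \<bullet> x - (D\<phi> x \<bullet> N x) * (N x \<bullet> x)"
        by (simp add: tgrad_def inner_diff_left)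
      show ?thesis
        unfolding h_def R_def p_def[symmetric] q_def[symmetric] Dh_eq tg_eq comm
        by (simp add: power2_eq_square algebra_simps)
    qed
    ultimately show "(LINT x|H. indicator K x * ((real n * (\<phi> x)\<^sup>2 - R x) * (x \<bullet> x + \<epsilon>) powr (- a / 2)
        - a * (\<phi> x)\<^sup>2 * (x \<bullet> x + \<epsilon>) powr (- a / 2 - 1) * (x \<bullet> x - (x \<bullet> N x)\<^sup>2))) = 0"
      by (simp only: s_def)
  qed
qed

lemma weighted_inequality:
  fixes \<phi> :: "'a \<Rightarrow> real" and D\<phi> :: "'a \<Rightarrow> 'a"
  assumes a: "0 \<le> a" "a < real n"
    and V: "open V" "M \<subseteq> V"
    and DN: "\<And>x. x \<in> V \<Longrightarrow> (N has_derivative DN x) (at x)"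
    and DN_cont: "\<And>v. continuous_on V (\<lambda>x. DN x v)"
    and test: "test_function M \<phi> D\<phi> U K"
  shows "(real n - a) * (LINT x|H. indicator K x * ((\<phi> x)\<^sup>2 / norm x powr a))
      + a * (LINT x|H. indicator K x * (((x /\<^sub>R norm x) \<bullet> N x)\<^sup>2 * (\<phi> x)\<^sup>2 / norm x powr a))
    \<le> sqrt (LINT x|H. indicator K x * ((\<phi> x)\<^sup>2 / norm x powr a))
      * sqrt (LINT x|H. indicator K x * ((4 * (norm (tgrad (N x) (D\<phi> x)))\<^sup>2
            + \<bar>mean_curv (N x) (DN x) * \<phi> x\<bar>\<^sup>2) / norm x powr (a - 2)))"
proof -
  define R where "R x = \<phi> x * (mean_curv (N x) (DN x) * \<phi> x * (x \<bullet> N x) - 2 * (tgrad (N x) (D\<phi> x) \<bullet> x))" for x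
  define E where "E x = 4 * (norm (tgrad (N x) (D\<phi> x)))\<^sup>2 + \<bar>mean_curv (N x) (DN x) * \<phi> x\<bar>\<^sup>2" for x
  note id = weighted_identity[OF a V DN DN_cont test, folded R_def E_def]
  have K: "compact K" "K \<subseteq> M" and \<phi>: "continuous_on K \<phi>"
    using test GDERIV_imp_continuous_on[of U \<phi> D\<phi>]
    by (auto simp: test_function_def intro: continuous_on_subset)
  have [measurable]: "K \<in> sets borel" using K(1) by (rule borel_compact)
  have ind: "(\<lambda>x. indicator K x * f x) \<in> borel_measurable borel" if "continuous_on K f" for f :: "'a \<Rightarrow> real"
    using borel_measurable_continuous_on_indicator[OF _ that] by simp
  define fA where "fA x = indicator K x * ((\<phi> x)\<^sup>2 / norm x powr a)" for x
  define fB where "fB x = indicator K x * (((x /\<^sub>R norm x) \<bullet> N x)\<^sup>2 * (\<phi> x)\<^sup>2 / norm x powr a)" for x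
  define fC where "fC x = indicator K x * (E x / norm x powr (a - 2))" for x
  define fR where "fR x = indicator K x * (norm x powr (- a) * R x)" for x
  have fA: "integrable H fA"
  proof -
    have "fA = (\<lambda>x. indicator K x * (norm x powr (- a) * (\<phi> x)\<^sup>2))"
      by (rule ext) (simp add: fA_def powr_minus_divide)
    then show ?thesis using \<phi> a K by (auto intro!: integrable_weight continuous_intros)
  qed
  have fC: "integrable H fC"
  proof -
    have "fC = (\<lambda>x. indicator K x * (norm x powr (- (a - 2)) * E x))"
      unfolding fC_def powr_minus_divide by simp
    then show ?thesis using a integrable_weight[OF _ K id(3), of "a - 2"] by simp
  qed
  have fR: "integrable H fR"
    unfolding fR_def[abs_def] by (rule integrable_weight[OF a(2) K id(2)])
  have fB: "integrable H fB"
  proof (rule Bochner_Integration.integrable_bound[OF fA])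
    have [measurable]: "(\<lambda>x. indicator K x * (x \<bullet> N x)) \<in> borel_measurable borel"
      "(\<lambda>x. indicator K x * \<phi> x) \<in> borel_measurable borel"
      using \<phi> K by (auto intro!: ind continuous_intros continuous_on_subset[OF N_cont])
    have "fB = (\<lambda>x. ((indicator K x * (x \<bullet> N x)) / norm x)\<^sup>2 * (indicator K x * \<phi> x)\<^sup>2 / norm x powr a)"
      by (rule ext) (simp add: fB_def indicator_def divide_inverse mult.commute)
    then show "fB \<in> borel_measurable H" by simp
    have "norm (fB x) \<le> norm (fA x)" for x
    proof (cases "x \<in> K \<and> x \<noteq> 0")
      case True
      then have "norm (N x) = 1" using N_unit K(2) by blast
      then have "\<bar>(x /\<^sub>R norm x) \<bullet> N x\<bar> \<le> 1"
        using Cauchy_Schwarz_ineq2[of "x /\<^sub>R norm x" "N x"] True by simp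
      then have "((x /\<^sub>R norm x) \<bullet> N x)\<^sup>2 \<le> 1" by (simp add: abs_square_le_1)
      then have "((x /\<^sub>R norm x) \<bullet> N x)\<^sup>2 * ((\<phi> x)\<^sup>2 / norm x powr a) \<le> 1 * ((\<phi> x)\<^sup>2 / norm x powr a)"
        by (intro mult_right_mono) auto
      then show ?thesis using True by (simp add: fA_def fB_def)
    qed (auto simp: fA_def fB_def)
    then show "AE x in H. norm (fB x) \<le> norm (fA x)" by simp
  qed
  have "indicator K x * (norm x powr (- a) * (real n * (\<phi> x)\<^sup>2 - R x - a * (\<phi> x)\<^sup>2 * (1 - ((x /\<^sub>R norm x) \<bullet> N x)\<^sup>2)))
      = (real n - a) * fA x + a * fB x - fR x" for x
    unfolding fA_def fB_def fR_def powr_minus_divide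
    by (simp add: algebra_simps diff_divide_distrib add_divide_distrib)
  then have "(LINT x|H. (real n - a) * fA x + a * fB x - fR x) = 0"
    using id(1) by simp
  then have main: "(real n - a) * (LINT x|H. fA x) + a * (LINT x|H. fB x) = (LINT x|H. fR x)"
    using fA fB fR by simp
  \<comment> \<open>The weight |x|^(-a) |x| is split as |x|^(-a/2) times |x|^(1 - a/2), so that the
    squares of the two factors are the two integrands under the roots.\<close>
  define f1 where "f1 x = indicator K x * (\<bar>\<phi> x\<bar> * norm x powr (- a / 2))" for x
  define f2 where "f2 x = indicator K x * (sqrt (E x) * norm x powr (1 - a / 2))" for x
  have E0: "0 \<le> E x" for x by (simp add: E_def)
  have f1sq: "(f1 x)\<^sup>2 = fA x" for x
  proof -
    have "(norm x powr (- a / 2))\<^sup>2 = norm x powr (- a)"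
      by (simp add: power2_eq_square powr_add[symmetric])
    also have "\<dots> = 1 / norm x powr a" by (rule powr_minus_divide)
    finally have sq: "(norm x powr (- a / 2))\<^sup>2 = 1 / norm x powr a" .
    have "(f1 x)\<^sup>2 = indicator K x * ((\<phi> x)\<^sup>2 * (norm x powr (- a / 2))\<^sup>2)"
      unfolding f1_def power_mult_distrib by (simp add: indicator_def)
    then show ?thesis unfolding sq fA_def by simp
  qed
  have f2sq: "(f2 x)\<^sup>2 = fC x" for x
  proof -
    have "(norm x powr (1 - a / 2))\<^sup>2 = norm x powr (- (a - 2))"
      by (simp add: power2_eq_square powr_add[symmetric])
    also have "\<dots> = 1 / norm x powr (a - 2)" by (rule powr_minus_divide)
    finally have sq: "(norm x powr (1 - a / 2))\<^sup>2 = 1 / norm x powr (a - 2)" .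
    have "(f2 x)\<^sup>2 = indicator K x * (E x * (norm x powr (1 - a / 2))\<^sup>2)"
      unfolding f2_def power_mult_distrib using E0 by (simp add: indicator_def)
    then show ?thesis unfolding sq fC_def by simp
  qed
  have [measurable]: "f1 \<in> borel_measurable H" "f2 \<in> borel_measurable H"
  proof -
    have [measurable]: "(\<lambda>x. indicator K x * \<bar>\<phi> x\<bar>) \<in> borel_measurable borel"
      "(\<lambda>x. indicator K x * sqrt (E x)) \<in> borel_measurable borel"
      using \<phi> id(3) by (auto intro!: ind continuous_intros)
    have "f1 = (\<lambda>x. (indicator K x * \<bar>\<phi> x\<bar>) * norm x powr (- a / 2))"
      "f2 = (\<lambda>x. (indicator K x * sqrt (E x)) * norm x powr (1 - a / 2))"
      by (auto simp: f1_def f2_def)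
    then show "f1 \<in> borel_measurable H" "f2 \<in> borel_measurable H" by simp_all
  qed
  have le: "fR x \<le> f1 x * f2 x" for x
  \<comment> \<open>At the origin both sides are 0, since powers of 0 under \<open>powr\<close> are
    0.\<close>
  proof (cases "x \<in> K \<and> x \<noteq> 0")
    case True
    then have "norm (N x) = 1" using N_unit K(2) by blast
    then have NN: "N x \<bullet> N x = 1" by (simp add: norm_eq_1)
    define g where "g = tgrad (N x) (D\<phi> x)"
    define \<alpha> where "\<alpha> = mean_curv (N x) (DN x) * \<phi> x"
    define p where "p = x \<bullet> N x"
    \<comment> \<open>The tangential part of \<open>x\<close>; the tangential gradient sees nothing
      else.\<close>
    define y where "y = x - p *\<^sub>R N x"
    have gN: "g \<bullet> N x = 0" using NN by (simp add: g_def tgrad_def inner_diff_left)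
    have gx: "g \<bullet> x = g \<bullet> y" using gN by (simp add: y_def inner_diff_right)
    have xy: "(norm x)\<^sup>2 = p\<^sup>2 + (norm y)\<^sup>2"
      unfolding power2_norm_eq_inner y_def
      using NN by (simp add: inner_diff_left inner_diff_right p_def inner_commute power2_eq_square)
    have "\<bar>\<alpha> * p - 2 * (g \<bullet> x)\<bar> \<le> \<bar>\<alpha>\<bar> * \<bar>p\<bar> + (2 * norm g) * norm y"
      using Cauchy_Schwarz_ineq2[of g y] abs_triangle_ineq4[of "\<alpha> * p" "2 * (g \<bullet> x)"]
      by (simp add: gx abs_mult)
    also have "\<dots> \<le> sqrt (E x) * norm x"
    proof (rule power2_le_imp_le)
      \<comment> \<open>Lagrange's identity in the plane; dropping the second square is the
        Cauchy-Schwarz inequality.\<close>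
      have "(\<bar>\<alpha>\<bar> * \<bar>p\<bar> + (2 * norm g) * norm y)\<^sup>2 + (\<bar>\<alpha>\<bar> * norm y - (2 * norm g) * \<bar>p\<bar>)\<^sup>2
          = (\<bar>\<alpha>\<bar>\<^sup>2 + (2 * norm g)\<^sup>2) * (\<bar>p\<bar>\<^sup>2 + (norm y)\<^sup>2)"
        by (simp only: power2_eq_square) (simp add: algebra_simps)
      also have "\<dots> = E x * (norm x)\<^sup>2"
        by (simp add: E_def g_def \<alpha>_def xy power_mult_distrib)
      also have "\<dots> = (sqrt (E x) * norm x)\<^sup>2" using E0 by (simp add: power_mult_distrib)
      finally show "(\<bar>\<alpha>\<bar> * \<bar>p\<bar> + (2 * norm g) * norm y)\<^sup>2 \<le> (sqrt (E x) * norm x)\<^sup>2"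
        using zero_le_power2[of "\<bar>\<alpha>\<bar> * norm y - (2 * norm g) * \<bar>p\<bar>"] by linarith
    qed (use E0 in simp)
    finally have bound: "\<bar>\<alpha> * p - 2 * (g \<bullet> x)\<bar> \<le> sqrt (E x) * norm x" .
    have "R x \<le> \<bar>\<phi> x\<bar> * \<bar>\<alpha> * p - 2 * (g \<bullet> x)\<bar>"
      unfolding R_def abs_mult[symmetric] \<alpha>_def p_def g_def by (rule abs_ge_self)
    also have "\<dots> \<le> \<bar>\<phi> x\<bar> * (sqrt (E x) * norm x)" by (intro mult_left_mono bound) simp
    finally have "fR x \<le> norm x powr (- a) * (\<bar>\<phi> x\<bar> * (sqrt (E x) * norm x))"
      using True by (simp add: fR_def mult_left_mono)
    also have "norm x powr (- a) * norm x = norm x powr (- a / 2) * norm x powr (1 - a / 2)"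
    proof -
      have "norm x powr (- a / 2) * norm x powr (1 - a / 2) = norm x powr (- a + 1)"
        by (simp add: powr_add[symmetric])
      also have "\<dots> = norm x powr (- a) * norm x" unfolding powr_add using True by simp
      finally show ?thesis by simp
    qed
    then have "norm x powr (- a) * (\<bar>\<phi> x\<bar> * (sqrt (E x) * norm x)) = f1 x * f2 x"
      using True by (simp add: f1_def f2_def mult.assoc mult.left_commute)
    finally show ?thesis .
  qed (auto simp: fR_def f1_def f2_def)
  have "(LINT x|H. fR x) \<le> sqrt (LINT x|H. (f1 x)\<^sup>2) * sqrt (LINT x|H. (f2 x)\<^sup>2)"
    using fA fC fR le by (intro integral_le_sqrt_mult_sqrt) (simp_all add: f1sq f2sq)
  then show ?thesis
    unfolding main[symmetric] f1sq f2sq fA_def fB_def fC_def E_def .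
qed

end

text \<open>\<open>measure_of\<close> falls back to the zero measure when its argument is not a
  measure on the generated sigma-algebra, hence the conditional.\<close>

lemma emeasure_hausdorff_measure:
  fixes A :: "'a::euclidean_space set"
  shows "emeasure (hausdorff_measure n) A =
    (if measure_space UNIV (sets borel) (hausdorff_outer n :: 'a set \<Rightarrow> ennreal) \<and> A \<in> sets borel
     then hausdorff_outer n A else 0)"
proof -
  have "sigma_sets UNIV (sets (borel :: 'a measure)) = sets borel"
    using sets.sigma_sets_eq[of "borel :: 'a measure"] by simp
  then show ?thesis unfolding hausdorff_measure_def by (simp add: emeasure_measure_of_conv)
qed

theorem theorem1p3:
  fixes M :: "'a::euclidean_space set"
    and n :: nat and a :: real
    and V :: "'a set" and N :: "'a \<Rightarrow> 'a" and DN :: "'a \<Rightarrow> 'a \<Rightarrow> 'a"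
    and U :: "'a set" and \<phi> :: "'a \<Rightarrow> real" and D\<phi> :: "'a \<Rightarrow> 'a"
  assumes dim: "DIM('a) = n + 1"
    and hyp: "smooth_hypersurface M"
    and a: "0 \<le> a" "a < real n"
    \<comment> \<open>N is a C^1 extension (to an open neighbourhood V of M) of a unit normal field on M\<close>
    and V: "open V" "M \<subseteq> V"
    and N_deriv: "\<forall>x\<in>V. (N has_derivative DN x) (at x)"
    and N_C1: "\<forall>v. continuous_on V (\<lambda>x. DN x v)"
    and N_unit: "\<forall>p\<in>M. norm (N p) = 1"
    and N_normal: "\<forall>p\<in>M. \<forall>v\<in>tangent_space M p. N p \<bullet> v = 0"
    \<comment> \<open>phi in C^1_c(M): C^1 extension to an open neighbourhood U of M, compact support in M\<close>
    and U: "open U" "M \<subseteq> U"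
    and phi_deriv: "\<forall>x\<in>U. GDERIV \<phi> x :> D\<phi> x"
    and phi_C1: "continuous_on U D\<phi>"
    and phi_supp: "\<exists>K. compact K \<and> K \<subseteq> M \<and> (\<forall>x\<in>M - K. \<phi> x = 0)"
  shows "(real n - a) * (LINT x:M|hausdorff_measure n. (\<phi> x)\<^sup>2 / norm x powr a)
         + a * (LINT x:M|hausdorff_measure n.
                  ((x /\<^sub>R norm x) \<bullet> N x)\<^sup>2 * (\<phi> x)\<^sup>2 / norm x powr a)
         \<le> sqrt (LINT x:M|hausdorff_measure n. (\<phi> x)\<^sup>2 / norm x powr a)
           * sqrt (LINT x:M|hausdorff_measure n.
                  (4 * (norm (tgrad (N x) (D\<phi> x)))\<^sup>2 + \<bar>mean_curv (N x) (DN x) * \<phi> x\<bar>\<^sup>2)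
                    / norm x powr (a - 2))"
proof (cases "measure_space UNIV (sets borel) (hausdorff_outer n :: 'a set \<Rightarrow> ennreal)")
  case False
  \<comment> \<open>By definition of \<open>measure_of\<close> the Hausdorff measure would then be zero. This case split
    saves proving that Borel sets are Caratheodory measurable.\<close>
  have null: "(LINT x:M|hausdorff_measure n. f x) = 0" for f :: "'a \<Rightarrow> real"
    unfolding set_lebesgue_integral_def
    by (intro integral_eq_zero_AE AE_I[of _ _ "space (hausdorff_measure n)"])
       (auto simp: emeasure_hausdorff_measure False)
  show ?thesis unfolding null by simp
next
  case True
  define H :: "'a measure" where "H = hausdorff_measure n"
  have N_cont: "continuous_on M N"
    by (intro continuous_at_imp_continuous_on ballI)
       (use N_deriv V(2) has_derivative_continuous in blast)
  interpret unit_normal_hypersurface n H M N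
  proof
    show "DIM('a) = n + 1" by fact
    show "0 < n" using a by simp
    show "sets H = sets borel"
      unfolding H_def hausdorff_measure_def using sets.sigma_sets_eq[of "borel :: 'a measure"] by simp
    show "emeasure H A = hausdorff_outer n A" if "A \<in> sets borel" for A
      using True that by (simp add: H_def emeasure_hausdorff_measure)
    show "flat_at M p (N p)" "crossed_at M p (N p)" "\<exists>r>0. compact (M \<inter> cball p r)" if "p \<in> M" for p
      using smooth_hypersurface_normal[OF hyp that] N_unit N_normal that by auto
  qed (use N_unit N_cont in auto)
  obtain K where K: "compact K" "K \<subseteq> M" "\<And>x. x \<in> M - K \<Longrightarrow> \<phi> x = 0" using phi_supp by blast
  have test: "test_function M \<phi> D\<phi> U K"
    using K U phi_deriv phi_C1 by (auto simp: test_function_def)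
  \<comment> \<open>Off \<open>K\<close> the ambient gradient may be nonzero, but the integrands
    contain only its tangential part, and the curvature carries a factor \<open>\<phi> x\<close>.
    All integrals over \<open>M\<close> therefore reduce to \<open>K\<close>.\<close>
  have tg: "tgrad (N x) (D\<phi> x) = 0" if "x \<in> M - K" for x
    by (rule tgrad_outside_support[OF _ K(1,3) that]) (use phi_deriv U(2) in auto)
  have on_K: "(LINT x:M|H. f x) = (LINT x|H. indicator K x * f x)"
    if "\<And>x. x \<in> M - K \<Longrightarrow> f x = 0" for f :: "'a \<Rightarrow> real"
    unfolding set_lebesgue_integral_def using that K(2)
    by (intro Bochner_Integration.integral_cong) (auto simp: indicator_def)
  have "(LINT x:M|H. (\<phi> x)\<^sup>2 / norm x powr a) = (LINT x|H. indicator K x * ((\<phi> x)\<^sup>2 / norm x powr a))"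
    "(LINT x:M|H. ((x /\<^sub>R norm x) \<bullet> N x)\<^sup>2 * (\<phi> x)\<^sup>2 / norm x powr a)
      = (LINT x|H. indicator K x * (((x /\<^sub>R norm x) \<bullet> N x)\<^sup>2 * (\<phi> x)\<^sup>2 / norm x powr a))"
    "(LINT x:M|H. (4 * (norm (tgrad (N x) (D\<phi> x)))\<^sup>2 + \<bar>mean_curv (N x) (DN x) * \<phi> x\<bar>\<^sup>2) / norm x powr (a - 2))
      = (LINT x|H. indicator K x * ((4 * (norm (tgrad (N x) (D\<phi> x)))\<^sup>2
          + \<bar>mean_curv (N x) (DN x) * \<phi> x\<bar>\<^sup>2) / norm x powr (a - 2)))"
    by (rule on_K; simp add: K(3) tg)+
  then show ?thesis
    unfolding H_def[symmetric]
    using weighted_inequality[OF a V _ _ test, of DN] N_deriv N_C1 by simp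
qed

end
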